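(* The bilinear form $\langle-,-\rangle:\mathcal{A}\times\mathcal{A}\to\mathbb{Z}$ on the noncrossing algebra $\mathcal{A}$ is unimodular, i.e. it induces an isomorphism $\mathcal{A}\cong\mathcal{A}^*=\mathrm{Hom}_{\mathbb{Z}}(\mathcal{A},\mathbb{Z})$ given by $x\mapsto\langle x,-\rangle$ for $x\in\mathcal{A}$.
   Context: $(W,S)$ is a finite Coxeter system of rank $n$, $T=\bigcup_{w\in W}wSw^{-1}$ its set of reflections. $\ell_T(w)$ is the least number of reflections in an expression of $w$ as a product of reflections. The absolute order on $W$: $u\le v$ iff $\ell_T(v)=\ell_T(u)+\ell_T(u^{-1}v)$. Throughout, $\gamma$ is a fixed Coxeter element: $S=S_1\sqcup S_2$ with each $S_i$ consisting of pairwise commuting reflections, $\gamma=(\prod_{s\in S_1}s)(\prod_{s\in S_2}s)$. $\mathcal{L}=[e,\gamma]$, $\mathcal{L}_k=\{w\in\mathcal{L}:\ell_T(w)=k\}$, and $\mathrm{Rex}_T(w)$ is the set of sequences $(t_1,\dots,t_k)$ of reflections with $k=\ell_T(w)$, $w=t_1\cdots t_k$. Write $u^w=w^{-1}uw$. The noncrossing algebra $\mathcal{A}$ is the unital graded $\mathbb{Z}$-algebra generated by $a_t$ ($t\in T$) of degree $1$ with relations $a_t^2=0$; $a_{t_1}a_{t_2}=0$ if $t_1t_2\not\le\gamma$; and $\sum_{(t_1,t_2)\in\mathrm{Rex}_T(w)}a_{t_1}a_{t_2}=0$ for $w\in\mathcal{L}_2$. Its degree-$k$ part $\mathcal{A}_k$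 ($0\le k\le n$, $\mathcal{A}_0=\mathbb{Z}$, $\mathcal{A}_k=0$ for $k>n$) is spanned by the monomials $a_{t_1}\cdots a_{t_k}$ with $(t_1,\dots,t_k)\in\bigcup_{w\in\mathcal{L}_k}\mathrm{Rex}_T(w)$. For $t\in T$, the well-defined $\mathbb{Z}$-linear map $\delta_t:\mathcal{A}_k\to\mathcal{A}_{k-1}$ is given on such monomials by $$\delta_t(a_{t_1}\cdots a_{t_k})=\sum_{i=1}^k(-1)^{i-1}\delta_{t,t_i}\,a_{t_1^{t_i}}\cdots a_{t_{i-1}^{t_i}}\,\widehat{a}_{t_i}\,a_{t_{i+1}}\cdots a_{t_k},$$ with $\delta_{t,t_i}$ the Kronecker delta. The bilinear form is defined (and well-defined) by $\langle1,1\rangle=1$; $\langle\mathcal{A}_k,\mathcal{A}_\ell\rangle=0$ for $k\ne\ell$; and $\langle a_{t_1}a_{t_2}\cdots a_{t_k},x\rangle=\delta_{t_k}\cdots\delta_{t_1}(x)\in\mathcal{A}_0=\mathbb{Z}$ for $x\in\mathcal{A}_k$ and $t_1,\dots,t_k\in T$. *)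

theory Defs
  imports "HOL-Algebra.Algebra" "HOL-Library.Poly_Mapping"
begin

section \<open>Coxeter systems\<close>

definition list_prod :: "('a, 'm) monoid_scheme \<Rightarrow> 'a list \<Rightarrow> 'a" where
  "list_prod G xs = foldr (\<otimes>\<^bsub>G\<^esub>) xs \<one>\<^bsub>G\<^esub>"

text \<open>The entry \<open>0\<close> encodes \<open>m(s,t) = \<infinity>\<close>; the relation \<open>(s t)\<^sup>0 = 1\<close> is then vacuous, as it should be.\<close>

definition coxeter_matrix :: "'a set \<Rightarrow> ('a \<Rightarrow> 'a \<Rightarrow> nat) \<Rightarrow> bool" where
  "coxeter_matrix S m \<longleftrightarrow>
     (\<forall>s\<in>S. m s s = 1) \<and> (\<forall>s\<in>S. \<forall>t\<in>S. s \<noteq> t \<longrightarrow> m s t = m t s \<and> m s t \<noteq> 1)"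

inductive coxeter_step :: "'a set \<Rightarrow> ('a \<Rightarrow> 'a \<Rightarrow> nat) \<Rightarrow> 'a list \<Rightarrow> 'a list \<Rightarrow> bool"
  for S :: "'a set" and m :: "'a \<Rightarrow> 'a \<Rightarrow> nat" where
  "\<lbrakk>u \<in> lists S; v \<in> lists S; s \<in> S; t \<in> S\<rbrakk>
   \<Longrightarrow> coxeter_step S m (u @ concat (replicate (m s t) [s, t]) @ v) (u @ v)"

text \<open>
  \<open>W\<close> is the group presented by the generators \<open>S\<close> and the relations \<open>(s t)\<^bsup>m(s,t)\<^esup> = 1\<close>.
  As \<open>m s s = 1\<close>, the relations contain \<open>s s = 1\<close>, so every element of the presented group is
  the class of a word in \<open>S\<close> without formal inverses, and the congruence generated by the
  relations on such words is equality in the presented group.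
\<close>

definition coxeter_system :: "('a, 'm) monoid_scheme \<Rightarrow> 'a set \<Rightarrow> bool" where
  "coxeter_system W S \<longleftrightarrow>
     group W \<and> S \<subseteq> carrier W \<and> generate W S = carrier W \<and>
     (\<exists>m. coxeter_matrix S m \<and>
        (\<forall>u\<in>lists S. \<forall>v\<in>lists S.
           list_prod W u = list_prod W v \<longleftrightarrow> equivclp (coxeter_step S m) u v))"

definition reflections :: "('a, 'm) monoid_scheme \<Rightarrow> 'a set \<Rightarrow> 'a set" where
  "reflections W S = (\<Union>w\<in>carrier W. {w \<otimes>\<^bsub>W\<^esub> s \<otimes>\<^bsub>W\<^esub> inv\<^bsub>W\<^esub> w | s. s \<in> S})"

definition refl_length :: "('a, 'm) monoid_scheme \<Rightarrow> 'a set \<Rightarrow> 'a \<Rightarrow> nat" where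
  "refl_length W S w =
     (LEAST k. \<exists>ts \<in> lists (reflections W S). length ts = k \<and> list_prod W ts = w)"

definition abs_le :: "('a, 'm) monoid_scheme \<Rightarrow> 'a set \<Rightarrow> 'a \<Rightarrow> 'a \<Rightarrow> bool" where
  "abs_le W S u v \<longleftrightarrow>
     refl_length W S v = refl_length W S u + refl_length W S (inv\<^bsub>W\<^esub> u \<otimes>\<^bsub>W\<^esub> v)"

text \<open>The lists enumerate \<open>S\<^sub>1\<close> and \<open>S\<^sub>2\<close>; by commutativity their order does not matter.\<close>

definition bipartite_coxeter_element :: "('a, 'm) monoid_scheme \<Rightarrow> 'a set \<Rightarrow> 'a \<Rightarrow> bool" where
  "bipartite_coxeter_element W S \<gamma> \<longleftrightarrow>
     (\<exists>ss1 ss2. distinct ss1 \<and> distinct ss2 \<and>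
        set ss1 \<union> set ss2 = S \<and> set ss1 \<inter> set ss2 = {} \<and>
        (\<forall>s\<in>set ss1. \<forall>t\<in>set ss1. s \<otimes>\<^bsub>W\<^esub> t = t \<otimes>\<^bsub>W\<^esub> s) \<and>
        (\<forall>s\<in>set ss2. \<forall>t\<in>set ss2. s \<otimes>\<^bsub>W\<^esub> t = t \<otimes>\<^bsub>W\<^esub> s) \<and>
        \<gamma> = list_prod W ss1 \<otimes>\<^bsub>W\<^esub> list_prod W ss2)"

definition nc_level :: "('a, 'm) monoid_scheme \<Rightarrow> 'a set \<Rightarrow> 'a \<Rightarrow> nat \<Rightarrow> 'a set" where
  "nc_level W S \<gamma> k = {w \<in> carrier W. abs_le W S w \<gamma> \<and> refl_length W S w = k}"

definition Rex :: "('a, 'm) monoid_scheme \<Rightarrow> 'a set \<Rightarrow> 'a \<Rightarrow> 'a list set" where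
  "Rex W S w =
     {ts \<in> lists (reflections W S). length ts = refl_length W S w \<and> list_prod W ts = w}"

definition conj_by :: "('a, 'm) monoid_scheme \<Rightarrow> 'a \<Rightarrow> 'a \<Rightarrow> 'a" where
  "conj_by W u w = inv\<^bsub>W\<^esub> w \<otimes>\<^bsub>W\<^esub> u \<otimes>\<^bsub>W\<^esub> w"


section \<open>Free associative algebras over the integers\<close>

text \<open>
  The free monoid, written additively so that \<open>'a free_mon \<Rightarrow>\<^sub>0 int\<close>, with the convolution
  product of \<^theory>\<open>HOL-Library.Poly_Mapping\<close>, is its monoid ring.
\<close>

datatype 'a free_mon = Word (letters: "'a list")

instantiation free_mon :: (type) monoid_add
begin

definition zero_free_mon :: "'a free_mon" where
  "zero_free_mon = Word []"

definition plus_free_mon :: "'a free_mon \<Rightarrow> 'a free_mon \<Rightarrow> 'a free_mon" where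
  "plus_free_mon u v = Word (letters u @ letters v)"

instance
  by standard (simp_all add: zero_free_mon_def plus_free_mon_def)

end

definition free_algebra :: "'a set \<Rightarrow> ('a free_mon \<Rightarrow>\<^sub>0 int) ring" where
  "free_algebra V =
     \<lparr>carrier = {p. \<forall>u \<in> Poly_Mapping.keys p. letters u \<in> lists V},
      monoid.mult = (*), one = 1, ring.zero = 0, ring.add = (+)\<rparr>"

definition word_monom :: "'a list \<Rightarrow> ('a free_mon \<Rightarrow>\<^sub>0 int)" where
  "word_monom xs = Poly_Mapping.single (Word xs) 1"

lemma free_algebra_simps [simp]:
  "monoid.mult (free_algebra V) = (*)" "monoid.one (free_algebra V) = 1"
  "ring.zero (free_algebra V) = 0" "ring.add (free_algebra V) = (+)"
  by (simp_all add: free_algebra_def)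

lemma ring_free_algebra: "ring (free_algebra V)"
proof (rule ringI)
  have carrier_iff: "p \<in> carrier (free_algebra V) \<longleftrightarrow>
      (\<forall>u \<in> Poly_Mapping.keys p. letters u \<in> lists V)" for p
    by (simp add: free_algebra_def)
  have add_closed: "p + q \<in> carrier (free_algebra V)"
    if "p \<in> carrier (free_algebra V)" "q \<in> carrier (free_algebra V)" for p q
    using that Poly_Mapping.keys_add[of p q] unfolding carrier_iff by blast
  have zero_closed: "0 \<in> carrier (free_algebra V)"
    by (simp add: carrier_iff)
  have one_closed: "1 \<in> carrier (free_algebra V)"
    by (simp add: carrier_iff zero_free_mon_def)
  have uminus_closed: "- p \<in> carrier (free_algebra V)"
    if "p \<in> carrier (free_algebra V)" for p
    using that unfolding carrier_iff by (simp add: in_keys_iff)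
  have mult_closed: "p * q \<in> carrier (free_algebra V)"
    if "p \<in> carrier (free_algebra V)" "q \<in> carrier (free_algebra V)" for p q
    unfolding carrier_iff
  proof
    fix u assume "u \<in> Poly_Mapping.keys (p * q)"
    then obtain v w where "u = v + w" "v \<in> Poly_Mapping.keys p" "w \<in> Poly_Mapping.keys q"
      using keys_mult[of p q] by blast
    with that show "letters u \<in> lists V"
      unfolding carrier_iff by (simp add: plus_free_mon_def)
  qed
  show "abelian_group (free_algebra V)"
  proof (rule abelian_groupI)
    fix p assume "p \<in> carrier (free_algebra V)"
    then show "\<exists>q\<in>carrier (free_algebra V).
            q \<oplus>\<^bsub>free_algebra V\<^esub> p = \<zero>\<^bsub>free_algebra V\<^esub>"
      using uminus_closed by (intro bexI[of _ "- p"]) simp_all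
  qed (simp_all add: add_closed zero_closed add.assoc add.commute)
  show "monoid (free_algebra V)"
    by (rule monoidI) (simp_all add: mult_closed one_closed mult.assoc)
qed (simp_all add: distrib_left distrib_right)


section \<open>The noncrossing algebra\<close>

definition nc_relations ::
    "('a, 'm) monoid_scheme \<Rightarrow> 'a set \<Rightarrow> 'a \<Rightarrow> ('a free_mon \<Rightarrow>\<^sub>0 int) set" where
  "nc_relations W S \<gamma> =
     {word_monom [t, t] | t. t \<in> reflections W S} \<union>
     {word_monom [t1, t2] | t1 t2. t1 \<in> reflections W S \<and> t2 \<in> reflections W S \<and>
        \<not> abs_le W S (t1 \<otimes>\<^bsub>W\<^esub> t2) \<gamma>} \<union>
     {\<Sum>ts\<in>Rex W S w. word_monom ts | w. w \<in> nc_level W S \<gamma> 2}"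

definition nc_algebra ::
    "('a, 'm) monoid_scheme \<Rightarrow> 'a set \<Rightarrow> 'a \<Rightarrow> ('a free_mon \<Rightarrow>\<^sub>0 int) set ring" where
  "nc_algebra W S \<gamma> =
     (let F = free_algebra (reflections W S) in F Quot (Idl\<^bsub>F\<^esub> (nc_relations W S \<gamma>)))"

definition nc_gen ::
    "('a, 'm) monoid_scheme \<Rightarrow> 'a set \<Rightarrow> 'a \<Rightarrow> 'a \<Rightarrow> ('a free_mon \<Rightarrow>\<^sub>0 int) set" where
  "nc_gen W S \<gamma> t =
     (let F = free_algebra (reflections W S) in Idl\<^bsub>F\<^esub> (nc_relations W S \<gamma>) +>\<^bsub>F\<^esub> word_monom [t])"

definition nc_monom ::
    "('a, 'm) monoid_scheme \<Rightarrow> 'a set \<Rightarrow> 'a \<Rightarrow> 'a list \<Rightarrow> ('a free_mon \<Rightarrow>\<^sub>0 int) set" where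
  "nc_monom W S \<gamma> ts = list_prod (nc_algebra W S \<gamma>) (map (nc_gen W S \<gamma>) ts)"

definition nc_graded ::
    "('a, 'm) monoid_scheme \<Rightarrow> 'a set \<Rightarrow> 'a \<Rightarrow> nat \<Rightarrow> ('a free_mon \<Rightarrow>\<^sub>0 int) set set" where
  "nc_graded W S \<gamma> k =
     generate (add_monoid (nc_algebra W S \<gamma>))
       {nc_monom W S \<gamma> ts | ts. ts \<in> lists (reflections W S) \<and> length ts = k}"

text \<open>
  Maps between carriers are determined only up to their values outside the carrier; these are
  fixed by \<^const>\<open>extensional\<close>, so that the descriptions below can determine a unique map.
\<close>

definition is_nc_delta ::
    "('a, 'm) monoid_scheme \<Rightarrow> 'a set \<Rightarrow> 'a \<Rightarrow> 'a \<Rightarrow>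
     (('a free_mon \<Rightarrow>\<^sub>0 int) set \<Rightarrow> ('a free_mon \<Rightarrow>\<^sub>0 int) set) \<Rightarrow> bool" where
  "is_nc_delta W S \<gamma> t d \<longleftrightarrow>
     (let A = nc_algebra W S \<gamma> in
       d \<in> hom (add_monoid A) (add_monoid A) \<and> d \<in> extensional (carrier A) \<and>
       (\<forall>k. \<forall>w \<in> nc_level W S \<gamma> k. \<forall>ts \<in> Rex W S w.
          d (nc_monom W S \<gamma> ts) =
            (\<Oplus>\<^bsub>A\<^esub> i \<in> {..<k}.
               if ts ! i = t
               then [((- 1) ^ i :: int)] \<cdot>\<^bsub>A\<^esub>
                 nc_monom W S \<gamma> (map (\<lambda>u. conj_by W u (ts ! i)) (take i ts) @ drop (Suc i) ts)
               else \<zero>\<^bsub>A\<^esub>)))"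

definition nc_delta ::
    "('a, 'm) monoid_scheme \<Rightarrow> 'a set \<Rightarrow> 'a \<Rightarrow> 'a \<Rightarrow>
     ('a free_mon \<Rightarrow>\<^sub>0 int) set \<Rightarrow> ('a free_mon \<Rightarrow>\<^sub>0 int) set" where
  "nc_delta W S \<gamma> t = (THE d. is_nc_delta W S \<gamma> t d)"

definition int_dual :: "('b, 'm) ring_scheme \<Rightarrow> ('b \<Rightarrow> int) monoid" where
  "int_dual A =
     \<lparr>carrier = hom (add_monoid A) integer_group \<inter> extensional (carrier A),
      monoid.mult = (\<lambda>f g. \<lambda>x\<in>carrier A. f x + g x),
      one = (\<lambda>x\<in>carrier A. 0)\<rparr>"

definition int_bilinear :: "('b, 'm) ring_scheme \<Rightarrow> ('b \<Rightarrow> 'b \<Rightarrow> int) \<Rightarrow> bool" where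
  "int_bilinear A B \<longleftrightarrow>
     (\<forall>x\<in>carrier A. \<forall>y\<in>carrier A. \<forall>z\<in>carrier A.
        B (x \<oplus>\<^bsub>A\<^esub> y) z = B x z + B y z \<and> B x (y \<oplus>\<^bsub>A\<^esub> z) = B x y + B x z)"

text \<open>
  In the last clause \<open>fold\<close> applies \<open>\<delta>\<close> of the first letter first, giving
  \<open>\<delta>\<^bsub>t\<^sub>k\<^esub> \<dots> \<delta>\<^bsub>t\<^sub>1\<^esub> x\<close>; an integer \<open>c\<close> is identified
  with \<open>c \<cdot> \<one>\<close> in degree \<open>0\<close>. Off the carrier the form is \<open>0\<close> by convention.
\<close>

definition is_nc_form ::
    "('a, 'm) monoid_scheme \<Rightarrow> 'a set \<Rightarrow> 'a \<Rightarrow>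
     (('a free_mon \<Rightarrow>\<^sub>0 int) set \<Rightarrow> ('a free_mon \<Rightarrow>\<^sub>0 int) set \<Rightarrow> int) \<Rightarrow> bool" where
  "is_nc_form W S \<gamma> B \<longleftrightarrow>
     (let A = nc_algebra W S \<gamma> in
       int_bilinear A B \<and>
       (\<forall>x y. x \<notin> carrier A \<or> y \<notin> carrier A \<longrightarrow> B x y = 0) \<and>
       B \<one>\<^bsub>A\<^esub> \<one>\<^bsub>A\<^esub> = 1 \<and>
       (\<forall>k l. k \<noteq> l \<longrightarrow>
          (\<forall>x \<in> nc_graded W S \<gamma> k. \<forall>y \<in> nc_graded W S \<gamma> l. B x y = 0)) \<and>
       (\<forall>k. \<forall>ts \<in> lists (reflections W S). length ts = k \<longrightarrow>
          (\<forall>x \<in> nc_graded W S \<gamma> k.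
             [B (nc_monom W S \<gamma> ts) x] \<cdot>\<^bsub>A\<^esub> \<one>\<^bsub>A\<^esub> = fold (nc_delta W S \<gamma>) ts x)))"

definition nc_form ::
    "('a, 'm) monoid_scheme \<Rightarrow> 'a set \<Rightarrow> 'a \<Rightarrow>
     ('a free_mon \<Rightarrow>\<^sub>0 int) set \<Rightarrow> ('a free_mon \<Rightarrow>\<^sub>0 int) set \<Rightarrow> int" where
  "nc_form W S \<gamma> = (THE B. is_nc_form W S \<gamma> B)"

definition unimodular :: "('b, 'm) ring_scheme \<Rightarrow> ('b \<Rightarrow> 'b \<Rightarrow> int) \<Rightarrow> bool" where
  "unimodular A B \<longleftrightarrow>
     int_bilinear A B \<and> (\<lambda>x. \<lambda>y\<in>carrier A. B x y) \<in> iso (add_monoid A) (int_dual A)"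

end

theory Submission
  imports Defs
begin

text \<open>
  A word in the reflections is called noncrossing (\<open>ncw\<close>) if it extends to a shortest factorization of
  \<open>\<gamma>\<close>; these are the reduced words of the elements below \<open>\<gamma>\<close>. All other words vanish in \<open>\<A>\<close>, and the
  relations are compatible with the operators \<open>\<delta>\<^sub>t\<close>, which are twisted derivations of the free algebra.

  Order the reflections by their first occurrence in \<open>s\<^sub>1, s\<^sub>1 s\<^sub>2 s\<^sub>1, \<dots>\<close> for the periodic word \<open>\<gamma> \<gamma> \<gamma> \<dots>\<close>.
  Every element of rank two has at most one increasing factorization, so the relations straighten
  every monomial into decreasing ones. On the other hand, \<open>\<langle>a\<^sub>t, a\<^sub>x\<rangle> \<noteq> 0\<close> for words \<open>t \<noteq> x\<close> forces the first
  letter of \<open>t\<close> that differs from \<open>x\<close> to occur further right in \<open>x\<close>. Hence the Gram matrix of the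
  decreasing monomials is unitriangular for the lexicographic order, and the form is unimodular.

  The two facts about \<open>\<gamma>\<close> used here, uniqueness of increasing factorizations and the join property
  \<open>ncw_join\<close>, come from the bilinear form \<open>E(u,v) = 2 \<langle>(1 - \<gamma>)\<^sup>-\<^sup>1 u, v\<rangle>\<close> on the geometric
  representation: \<open>E(\<beta>\<^sub>i, \<beta>\<^sub>j) = 0\<close> for \<open>i < j\<close> whenever \<open>\<beta>\<^sub>1, \<dots>, \<beta>\<^sub>n\<close> are the roots of a shortest
  factorization of \<open>\<gamma>\<close>.
\<close>

text \<open>\<open>E\<close> is a Seifert (or Euler) form with monodromy \<open>\<gamma>\<close>,
  and shortest factorizations are its exceptional sequences. Two features carry the proof. Its
  symmetrization is twice the invariant form, so \<open>E(d,d) = 0\<close> forces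
  \<open>d = 0\<close>; this replaces lattice arguments in \<open>ncw_join\<close>. And in a
  conjugate where a reflection becomes the initial simple reflection \<open>s\<close>, pairing with
  the root of \<open>s\<close> on the left reads off the coefficient at \<open>s\<close>. Positivity
  of roots thereby becomes sign information about \<open>E\<close>, which is why the geometric
  representation is developed up to positive roots.

  The join property is needed because a word that is not noncrossing may have only noncrossing pairs
  of neighbours: if \<open>a b = b c = c a = \<gamma>\<close> in rank two, then \<open>a b c\<close>
  is such a word. Its vanishing is not a single relation.

  Independence of the decreasing monomials is not shown beforehand; the Gram matrix yields it along
  with unimodularity. Since \<open>nc_delta\<close> and \<open>nc_form\<close> are definite
  descriptions, existence and uniqueness of both are proved as well.\<close>

text \<open>Functions are not an instance of \<^class>\<open>real_vector\<close>, hence the wrapper.\<close>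

datatype 'a rvec = RVec (coord: "'a \<Rightarrow> real")

notation coord (infixl "$" 90)

lemma rvec_eqI: "(\<And>x. f $ x = g $ x) \<Longrightarrow> f = g"
  by (rule rvec.expand) auto

lemma rvec_eq_iff: "f = g \<longleftrightarrow> (\<forall>x. f $ x = g $ x)"
  by (auto intro: rvec_eqI)

instantiation rvec :: (type) real_vector
begin

definition zero_rvec :: "'a rvec" where "zero_rvec = RVec (\<lambda>x. 0)"
definition plus_rvec :: "'a rvec \<Rightarrow> 'a rvec \<Rightarrow> 'a rvec" where
  "plus_rvec f g = RVec (\<lambda>x. f $ x + g $ x)"
definition uminus_rvec :: "'a rvec \<Rightarrow> 'a rvec" where "uminus_rvec f = RVec (\<lambda>x. - (f $ x))"
definition minus_rvec :: "'a rvec \<Rightarrow> 'a rvec \<Rightarrow> 'a rvec" where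
  "minus_rvec f g = RVec (\<lambda>x. f $ x - g $ x)"
definition scaleR_rvec :: "real \<Rightarrow> 'a rvec \<Rightarrow> 'a rvec" where
  "scaleR_rvec c f = RVec (\<lambda>x. c * f $ x)"

instance
  by standard
    (simp_all add: zero_rvec_def plus_rvec_def uminus_rvec_def minus_rvec_def scaleR_rvec_def
      rvec_eq_iff algebra_simps)

end

lemma coord_simps [simp]:
  "0 $ x = 0" "(f + g) $ x = f $ x + g $ x" "(- f) $ x = - (f $ x)" "(f - g) $ x = f $ x - g $ x"
  "(c *\<^sub>R f) $ x = c * f $ x"
  by (simp_all add: zero_rvec_def plus_rvec_def uminus_rvec_def minus_rvec_def scaleR_rvec_def)

lemma coord_sum: "(\<Sum>i\<in>A. f i) $ x = (\<Sum>i\<in>A. f i $ x)"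
  by (induction A rule: infinite_finite_induct) simp_all

lemma list_prod_Nil [simp]: "list_prod G [] = \<one>\<^bsub>G\<^esub>"
  and list_prod_Cons [simp]: "list_prod G (x # xs) = x \<otimes>\<^bsub>G\<^esub> list_prod G xs"
  by (simp_all add: list_prod_def)

context monoid
begin

lemma list_prod_closed [simp]: "xs \<in> lists (carrier G) \<Longrightarrow> list_prod G xs \<in> carrier G"
  by (induction xs) auto

lemma list_prod_append:
  "\<lbrakk>xs \<in> lists (carrier G); ys \<in> lists (carrier G)\<rbrakk>
     \<Longrightarrow> list_prod G (xs @ ys) = list_prod G xs \<otimes> list_prod G ys"
  by (induction xs) (auto simp: m_assoc)

end

section \<open>The geometric representation\<close>

locale coxeter = group W for W :: "('a, 'm) monoid_scheme" (structure) +
  fixes S :: "'a set" and m :: "'a \<Rightarrow> 'a \<Rightarrow> nat"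
  assumes S_carrier: "S \<subseteq> carrier W"
    and generators: "generate W S = carrier W"
    and matrix: "coxeter_matrix S m"
    and presentation: "\<lbrakk>u \<in> lists S; v \<in> lists S\<rbrakk> \<Longrightarrow>
          list_prod W u = list_prod W v \<longleftrightarrow> equivclp (coxeter_step S m) u v"
    and finite_carrier: "finite (carrier W)"
begin

abbreviation lp :: "'a list \<Rightarrow> 'a" where "lp \<equiv> list_prod W"

lemma finite_S: "finite S"
  using S_carrier finite_carrier finite_subset by blast

lemma lists_S_carrier: "u \<in> lists S \<Longrightarrow> u \<in> lists (carrier W)"
  using S_carrier by auto

lemma lp_S_closed [simp]: "u \<in> lists S \<Longrightarrow> lp u \<in> carrier W"
  using lists_S_carrier by auto

lemma lp_S_append: "\<lbrakk>u \<in> lists S; v \<in> lists S\<rbrakk> \<Longrightarrow> lp (u @ v) = lp u \<otimes> lp v"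
  using lists_S_carrier list_prod_append by auto

lemma m_diag: "s \<in> S \<Longrightarrow> m s s = 1"
  and m_sym: "\<lbrakk>s \<in> S; t \<in> S\<rbrakk> \<Longrightarrow> m s t = m t s"
  and m_neq_1: "\<lbrakk>s \<in> S; t \<in> S; s \<noteq> t\<rbrakk> \<Longrightarrow> m s t \<noteq> 1"
  using matrix unfolding coxeter_matrix_def by metis+

lemma lp_relation:
  assumes "s \<in> S" "t \<in> S"
  shows "lp (concat (replicate (m s t) [s, t])) = \<one>"
proof -
  have "coxeter_step S m ([] @ concat (replicate (m s t) [s, t]) @ []) ([] @ [])"
    by (rule coxeter_step.intros) (use assms in auto)
  then have "equivclp (coxeter_step S m) (concat (replicate (m s t) [s, t])) []"
    by (auto intro: r_into_equivclp)
  moreover have "concat (replicate (m s t) [s, t]) \<in> lists S"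
    using assms by (auto split: if_splits)
  ultimately show ?thesis using presentation[of "concat (replicate (m s t) [s, t])" "[]"] by simp
qed

lemma S_square: "s \<in> S \<Longrightarrow> s \<otimes> s = \<one>"
  using lp_relation[of s s] m_diag[of s] S_carrier by auto

lemma S_cancel: "\<lbrakk>s \<in> S; x \<in> carrier W\<rbrakk> \<Longrightarrow> s \<otimes> (s \<otimes> x) = x"
  using S_square[of s] S_carrier by (auto simp flip: m_assoc)

lemma S_inv: "s \<in> S \<Longrightarrow> inv s = s"
  using S_square S_carrier by (metis inv_equality subsetD)

lemma word_exists: "w \<in> carrier W \<Longrightarrow> \<exists>u \<in> lists S. lp u = w"
proof -
  assume "w \<in> carrier W"
  then have "w \<in> generate W S" by (simp add: generators)
  then show ?thesis
  proof (induction rule: generate.induct)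
    case one
    then show ?case by (intro bexI[of _ "[]"]) auto
  next
    case (incl h)
    then show ?case using S_carrier by (intro bexI[of _ "[h]"]) auto
  next
    case (inv h)
    then show ?case using S_carrier S_inv by (intro bexI[of _ "[h]"]) auto
  next
    case (eng h1 h2)
    then obtain u v where "u \<in> lists S" "lp u = h1" "v \<in> lists S" "lp v = h2" by blast
    then show ?case by (intro bexI[of _ "u @ v"]) (auto simp: lp_S_append)
  qed
qed

text \<open>For \<open>m s t = 0\<close>, which encodes infinity, division by zero gives
  \<open>- cos 0 = -1\<close>, the usual entry for infinite order. \<open>m_pos\<close> relies on
  this value.\<close>

definition cb :: "'a \<Rightarrow> 'a \<Rightarrow> real" where
  "cb s t = (if s = t then 1 else - cos (pi / real (m s t)))"

definition bl :: "'a rvec \<Rightarrow> 'a rvec \<Rightarrow> real" where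
  "bl f g = (\<Sum>s\<in>S. \<Sum>t\<in>S. f $ s * g $ t * cb s t)"

definition al :: "'a \<Rightarrow> 'a rvec" where
  "al s = RVec (\<lambda>x. if x = s then 1 else 0)"

definition rfl :: "'a rvec \<Rightarrow> 'a rvec \<Rightarrow> 'a rvec" where
  "rfl r v = v - (2 * bl r v) *\<^sub>R r"

lemma cb_sym: "\<lbrakk>s \<in> S; t \<in> S\<rbrakk> \<Longrightarrow> cb s t = cb t s"
  using m_sym by (simp add: cb_def)

lemma bl_sym: "bl f g = bl g f"
  unfolding bl_def
  by (subst sum.swap) (auto intro!: sum.cong simp: cb_sym)

lemma bl_add_left: "bl (f + g) h = bl f h + bl g h"
  by (simp add: bl_def sum.distrib algebra_simps)

lemma bl_scale_left: "bl (c *\<^sub>R f) h = c * bl f h"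
  by (simp add: bl_def sum_distrib_left algebra_simps)

lemma bl_add_right: "bl h (f + g) = bl h f + bl h g"
  using bl_add_left bl_sym by metis

lemma bl_scale_right: "bl h (c *\<^sub>R f) = c * bl h f"
  using bl_scale_left bl_sym by metis

lemma bl_minus_left: "bl (- f) h = - bl f h"
  using bl_scale_left[of "-1" f h] by simp

lemma bl_minus_right: "bl h (- f) = - bl h f"
  using bl_minus_left bl_sym by metis

lemma bl_diff_left: "bl (f - g) h = bl f h - bl g h"
  using bl_add_left[of f "- g" h] by (simp add: bl_minus_left)

lemma bl_diff_right: "bl h (f - g) = bl h f - bl h g"
  using bl_diff_left bl_sym by metis

lemma bl_zero_left [simp]: "bl 0 h = 0" and bl_zero_right [simp]: "bl h 0 = 0"
  by (simp_all add: bl_def)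

lemmas bl_lin = bl_add_left bl_add_right bl_scale_left bl_scale_right bl_minus_left bl_minus_right
  bl_diff_left bl_diff_right

lemma bl_al_left: "s \<in> S \<Longrightarrow> bl (al s) g = (\<Sum>t\<in>S. g $ t * cb s t)"
proof -
  assume "s \<in> S"
  have "bl (al s) g = (\<Sum>x\<in>S. if x = s then (\<Sum>t\<in>S. g $ t * cb s t) else 0)"
    unfolding bl_def by (rule sum.cong) (auto simp: al_def)
  with \<open>s \<in> S\<close> finite_S show ?thesis by simp
qed

lemma bl_al_al: "\<lbrakk>s \<in> S; t \<in> S\<rbrakk> \<Longrightarrow> bl (al s) (al t) = cb s t"
proof -
  assume "s \<in> S" "t \<in> S"
  then have "bl (al s) (al t) = (\<Sum>x\<in>S. if x = t then cb s t else 0)"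
    unfolding bl_al_left[OF \<open>s \<in> S\<close>] by (intro sum.cong) (auto simp: al_def)
  with \<open>t \<in> S\<close> finite_S show ?thesis by simp
qed

lemma bl_al_self: "s \<in> S \<Longrightarrow> bl (al s) (al s) = 1"
  by (simp add: bl_al_al cb_def)

lemma rfl_add: "rfl r (v + w) = rfl r v + rfl r w"
  by (simp add: rfl_def bl_lin algebra_simps)

lemma rfl_scale: "rfl r (c *\<^sub>R v) = c *\<^sub>R rfl r v"
  by (simp add: rfl_def bl_lin algebra_simps)

lemma rfl_bl: "bl r r = 1 \<Longrightarrow> bl (rfl r v) (rfl r w) = bl v w"
  by (simp add: rfl_def bl_lin bl_sym[of v r] algebra_simps)

lemma rfl_rfl: "bl r r = 1 \<Longrightarrow> rfl r (rfl r v) = v"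
  by (simp add: rfl_def bl_lin algebra_simps flip: scaleR_add_left)

definition wact :: "'a list \<Rightarrow> 'a rvec \<Rightarrow> 'a rvec" where
  "wact u = foldr (\<lambda>s. rfl (al s)) u"

lemma wact_simps [simp]: "wact [] v = v" "wact (s # u) v = rfl (al s) (wact u v)"
  "wact (u @ u') v = wact u (wact u' v)"
  by (simp_all add: wact_def)

lemma wact_add: "wact u (v + w) = wact u v + wact u w"
  by (induction u) (simp_all only: wact_simps rfl_add)

lemma wact_scale: "wact u (c *\<^sub>R v) = c *\<^sub>R wact u v"
  by (induction u) (simp_all only: wact_simps rfl_scale)

section \<open>Dihedral relations and the action of the group\<close>

lemma sin_step: "sin (x + h) = 2 * cos h * sin x - sin (x - h)" for x h :: real
  by (simp add: sin_add sin_diff)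

lemma two_term_recurrence:
  fixes c :: real
  assumes "x2 = c * x1 - x0" "y2 = c * y1 - y0"
  shows "c * (a * x1 - b * y1) - (a * x0 - b * y0) = a * x2 - b * y2"
  unfolding assms by (simp add: algebra_simps)

lemma rfl_al_plane:
  assumes "s \<in> S" "t \<in> S" "s \<noteq> t"
  shows "rfl (al s) (a *\<^sub>R al s + b *\<^sub>R al t) = (2 * cos (pi / m s t) * b - a) *\<^sub>R al s + b *\<^sub>R al t"
  using assms by (intro rvec_eqI) (simp add: rfl_def bl_lin bl_al_al cb_def algebra_simps)

text \<open>The product \<open>s t\<close> rotates the plane of the two simple roots by
  \<open>2 h\<close>. In the basis of simple roots the coefficients of its powers are quotients of
  the form \<open>sin (i h) / sin h\<close>; both sides obey the same two-term recurrence.\<close>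

lemma wact_plane:
  assumes st: "s \<in> S" "t \<in> S" "s \<noteq> t"
  defines "h \<equiv> pi / real (m s t)"
  assumes h_nz: "sin h \<noteq> 0"
  shows "wact (concat (replicate j [s, t])) (a *\<^sub>R al s + b *\<^sub>R al t) =
     ((a * sin ((2 * real j + 1) * h) - b * sin (2 * real j * h)) / sin h) *\<^sub>R al s +
     ((a * sin (2 * real j * h) - b * sin ((2 * real j - 1) * h)) / sin h) *\<^sub>R al t"
proof (induction j)
  case 0
  show ?case using h_nz by (intro rvec_eqI) (simp add: h_nz)
next
  case (Suc j)
  have h': "pi / real (m t s) = h" using m_sym st by (simp add: h_def)
  let ?x = "a * sin ((2 * real j + 1) * h) - b * sin (2 * real j * h)"
  let ?y = "a * sin (2 * real j * h) - b * sin ((2 * real j - 1) * h)"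
  have e1: "sin ((2 * real j + 2) * h) = 2 * cos h * sin ((2 * real j + 1) * h) - sin (2 * real j * h)"
    using sin_step[of "(2 * real j + 1) * h" h] by (simp add: algebra_simps)
  have e2: "sin ((2 * real j + 3) * h) = 2 * cos h * sin ((2 * real j + 2) * h) - sin ((2 * real j + 1) * h)"
    using sin_step[of "(2 * real j + 2) * h" h] by (simp add: algebra_simps)
  have e3: "sin ((2 * real j + 1) * h) = 2 * cos h * sin (2 * real j * h) - sin ((2 * real j - 1) * h)"
    using sin_step[of "2 * real j * h" h] by (simp add: algebra_simps)
  have "wact (concat (replicate (Suc j) [s, t])) (a *\<^sub>R al s + b *\<^sub>R al t)
     = rfl (al s) (rfl (al t) ((?x / sin h) *\<^sub>R al s + (?y / sin h) *\<^sub>R al t))"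
    by (simp only: replicate_Suc concat.simps append_Cons append_Nil wact_simps Suc)
  also have "\<dots> = rfl (al s) ((?x / sin h) *\<^sub>R al s + (2 * cos h * (?x / sin h) - ?y / sin h) *\<^sub>R al t)"
    using rfl_al_plane[of t s "?y / sin h" "?x / sin h"] st h' by (simp add: add.commute)
  also have "2 * cos h * (?x / sin h) - ?y / sin h
      = (a * sin ((2 * real j + 2) * h) - b * sin ((2 * real j + 1) * h)) / sin h" (is "_ = ?y'")
  proof -
    have "2 * cos h * ?x - ?y = a * sin ((2 * real j + 2) * h) - b * sin ((2 * real j + 1) * h)"
      by (rule two_term_recurrence[OF e1 e3])
    then show ?thesis by (simp only: times_divide_eq_right diff_divide_distrib[symmetric])
  qed
  also have "rfl (al s) ((?x / sin h) *\<^sub>R al s + ?y' *\<^sub>R al t) = (2 * cos h * ?y' - ?x / sin h) *\<^sub>R al s + ?y' *\<^sub>R al t"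
    using rfl_al_plane[of s t] st by (simp add: h_def)
  also have "2 * cos h * ?y' - ?x / sin h = (a * sin ((2 * real j + 3) * h) - b * sin ((2 * real j + 2) * h)) / sin h"
  proof -
    have "2 * cos h * (a * sin ((2 * real j + 2) * h) - b * sin ((2 * real j + 1) * h)) - ?x
        = a * sin ((2 * real j + 3) * h) - b * sin ((2 * real j + 2) * h)"
      by (rule two_term_recurrence[OF e2 e1])
    then show ?thesis by (simp only: times_divide_eq_right diff_divide_distrib[symmetric])
  qed
  finally show ?case by (simp add: algebra_simps)
qed

lemma wact_relation:
  assumes st: "s \<in> S" "t \<in> S"
  shows "wact (concat (replicate (m s t) [s, t])) v = v"
proof (cases "s = t")
  case True
  then show ?thesis using st m_diag rfl_rfl bl_al_self by simp
next
  case False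
  show ?thesis
  proof (cases "m s t = 0")
    case False
    define k where "k = m s t"
    define h where "h = pi / real k"
    have k2: "k \<ge> 2" using False m_neq_1[OF st \<open>s \<noteq> t\<close>] by (simp add: k_def)
    have sinh: "sin h > 0"
      unfolding h_def by (rule sin_gt_zero) (use k2 in \<open>simp_all add: field_simps\<close>)
    define p where "p = bl (al s) v"
    define q where "q = bl (al t) v"
    have b: "bl (al s) (al t) = - cos h" "bl (al t) (al s) = - cos h"
      using st \<open>s \<noteq> t\<close> m_sym[of s t] by (simp_all add: bl_al_al cb_def h_def k_def)
    \<comment> \<open>The coefficients \<open>x\<close> and \<open>y\<close> solve the linear system
      whose Gram matrix has determinant \<open>(sin h)^2\<close>. They make \<open>v0\<close>
      orthogonal to both simple roots, hence fixed, and leave only the plane to be checked.\<close>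
    define x where "x = (p + cos h * q) / (sin h)\<^sup>2"
    define y where "y = (q + cos h * p) / (sin h)\<^sup>2"
    define v0 where "v0 = v - x *\<^sub>R al s - y *\<^sub>R al t"
    have sq: "(cos h)\<^sup>2 = 1 - (sin h)\<^sup>2" by (simp add: cos_squared_eq)
    have "x - cos h * y = (p + cos h * q - cos h * (q + cos h * p)) / (sin h)\<^sup>2"
      by (simp add: x_def y_def diff_divide_distrib)
    also have "p + cos h * q - cos h * (q + cos h * p) = p * (1 - (cos h)\<^sup>2)"
      by (simp add: algebra_simps power2_eq_square)
    finally have xp: "x - cos h * y = p" using sinh by (simp add: sq)
    have "y - cos h * x = (q + cos h * p - cos h * (p + cos h * q)) / (sin h)\<^sup>2"
      by (simp add: x_def y_def diff_divide_distrib)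
    also have "q + cos h * p - cos h * (p + cos h * q) = q * (1 - (cos h)\<^sup>2)"
      by (simp add: algebra_simps power2_eq_square)
    finally have yq: "y - cos h * x = q" using sinh by (simp add: sq)
    have "bl (al s) v0 = 0" "bl (al t) v0 = 0"
      using xp yq st by (simp_all add: v0_def bl_lin b bl_al_self p_def q_def algebra_simps)
    then have "rfl (al s) v0 = v0" "rfl (al t) v0 = v0" by (simp_all add: rfl_def)
    then have v0: "wact (concat (replicate j [s, t])) v0 = v0" for j
      by (induction j) simp_all
    have "(2 * real k + 1) * h = h + 2 * pi" "real k * h = pi" "(2 * real k - 1) * h = - h + 2 * pi"
      using k2 by (simp_all add: h_def field_simps)
    then have s1: "sin ((2 * real k + 1) * h) = sin h" "sin (2 * real k * h) = 0" "sin ((2 * real k - 1) * h) = - sin h"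
      using sin_two_pi by (simp_all add: sin_add sin_diff mult.assoc)
    have "wact (concat (replicate k [s, t])) (x *\<^sub>R al s + y *\<^sub>R al t) = x *\<^sub>R al s + y *\<^sub>R al t"
      using wact_plane[OF st \<open>s \<noteq> t\<close>, folded k_def, folded h_def, of k x y] sinh by (simp add: s1)
    then have "wact (concat (replicate k [s, t])) (v0 + (x *\<^sub>R al s + y *\<^sub>R al t)) = v0 + (x *\<^sub>R al s + y *\<^sub>R al t)"
      using v0 by (simp only: wact_add)
    moreover have "v0 + (x *\<^sub>R al s + y *\<^sub>R al t) = v" by (simp add: v0_def)
    ultimately show ?thesis by (simp add: k_def)
  qed simp
qed

lemma wact_cong:
  assumes "u \<in> lists S" "u' \<in> lists S" "lp u = lp u'"
  shows "wact u = wact u'"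
proof -
  have "equivclp (coxeter_step S m) u u'" using presentation assms by blast
  then show ?thesis
  proof (induction rule: equivclp_induct)
    case (step y z)
    have "wact a = wact b" if "coxeter_step S m a b" for a b
      using that by (cases) (auto simp: fun_eq_iff wact_relation)
    with step show ?case by metis
  qed simp
qed

text \<open>Every relator has even length \<open>2 m(s,t)\<close>. This is the sign character
  without determinants; it separates \<open>len (w s)\<close> from \<open>len w\<close>, and
  products of two reflections from reflections.\<close>

lemma length_parity:
  assumes "u \<in> lists S" "u' \<in> lists S" "lp u = lp u'"
  shows "even (length u) \<longleftrightarrow> even (length u')"
proof -
  have "equivclp (coxeter_step S m) u u'" using presentation assms by blast
  then show ?thesis
  proof (induction rule: equivclp_induct)
    case (step y z)
    have "even (length a) \<longleftrightarrow> even (length b)" if "coxeter_step S m a b" for a b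
      using that by cases (simp add: length_concat sum_list_replicate)
    with step show ?case by metis
  qed simp
qed

text \<open>Outside the group the chosen list is arbitrary. Linearity of \<open>wact\<close> holds
  for every list, so the linearity rules for \<open>act\<close> carry no hypothesis.\<close>

definition act :: "'a \<Rightarrow> 'a rvec \<Rightarrow> 'a rvec" where
  "act w = wact (SOME u. u \<in> lists S \<and> lp u = w)"

lemma act_lp: "u \<in> lists S \<Longrightarrow> act (lp u) = wact u"
  unfolding act_def
  by (rule someI2[of _ u]) (auto intro: wact_cong)

lemma carrier_word: "w \<in> carrier W \<Longrightarrow> (\<And>u. u \<in> lists S \<Longrightarrow> w = lp u \<Longrightarrow> P) \<Longrightarrow> P"
  using word_exists by blast

lemma act_mult:
  assumes "w \<in> carrier W" "w' \<in> carrier W"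
  shows "act (w \<otimes> w') v = act w (act w' v)"
proof -
  obtain u u' where "u \<in> lists S" "w = lp u" "u' \<in> lists S" "w' = lp u'"
    using assms carrier_word by metis
  then show ?thesis
    using act_lp[of u] act_lp[of u'] act_lp[of "u @ u'"] lp_S_append[of u u'] by simp
qed

lemma act_one [simp]: "act \<one> v = v"
  using act_lp[of "[]"] by simp

lemma act_S: "s \<in> S \<Longrightarrow> act s = rfl (al s)"
  using act_lp[of "[s]"] S_carrier by (auto simp: fun_eq_iff)

lemma act_inv [simp]:
  "w \<in> carrier W \<Longrightarrow> act (inv w) (act w v) = v" "w \<in> carrier W \<Longrightarrow> act w (act (inv w) v) = v"
  using act_mult[of "inv w" w v] act_mult[of w "inv w" v] by simp_all

lemma act_add: "act w (v + v') = act w v + act w v'"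
  by (simp add: act_def wact_add)

lemma act_scale: "act w (c *\<^sub>R v) = c *\<^sub>R act w v"
  by (simp add: act_def wact_scale)

lemma linear_act: "linear (act w)"
  by (rule linearI) (simp_all only: act_add act_scale)

lemmas act_lin = act_add act_scale linear_neg[OF linear_act] linear_diff[OF linear_act]

lemma act_zero [simp]: "act w 0 = 0"
  by (rule linear_0[OF linear_act])

lemma act_sum: "act w (\<Sum>i\<in>A. f i) = (\<Sum>i\<in>A. act w (f i))"
  by (rule linear_sum[OF linear_act])

lemma act_bl: "w \<in> carrier W \<Longrightarrow> bl (act w v) (act w v') = bl v v'"
proof (elim carrier_word)
  fix u assume u: "u \<in> lists S" "w = lp u"
  have "bl (wact u v) (wact u v') = bl v v'"
    using u(1) by (induction u) (auto simp: rfl_bl bl_al_self)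
  then show ?thesis using u act_lp by simp
qed

lemma act_bl_inv: "w \<in> carrier W \<Longrightarrow> bl (act w v) v' = bl v (act (inv w) v')"
  using act_bl[of w v "act (inv w) v'"] by simp

text \<open>Vectors have a coordinate for every element of the type, whereas \<open>bl\<close> sees
  only those in \<open>S\<close>. Definiteness and expansion in simple roots therefore require
  support in \<open>S\<close>; smaller sets describe parabolic subspaces.\<close>

definition spt :: "'a set \<Rightarrow> 'a rvec \<Rightarrow> bool" where
  "spt J f \<longleftrightarrow> (\<forall>x. x \<notin> J \<longrightarrow> f $ x = 0)"

lemma spt_add: "spt J f \<Longrightarrow> spt J g \<Longrightarrow> spt J (f + g)"
  and spt_diff: "spt J f \<Longrightarrow> spt J g \<Longrightarrow> spt J (f - g)"
  and spt_minus: "spt J f \<Longrightarrow> spt J (- f)"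
  and spt_scale: "spt J f \<Longrightarrow> spt J (c *\<^sub>R f)"
  and spt_zero [simp]: "spt J 0"
  and spt_al: "s \<in> J \<Longrightarrow> spt J (al s)"
  by (auto simp: spt_def al_def)

lemma spt_mono: "spt J f \<Longrightarrow> J \<subseteq> J' \<Longrightarrow> spt J' f"
  by (auto simp: spt_def)

lemma spt_sum: "(\<And>i. i \<in> A \<Longrightarrow> spt J (f i)) \<Longrightarrow> spt J (\<Sum>i\<in>A. f i)"
  by (auto simp: spt_def coord_sum)

lemma spt_wact: "\<lbrakk>u \<in> lists J; spt J v\<rbrakk> \<Longrightarrow> spt J (wact u v)"
  by (induction u) (auto simp: rfl_def intro: spt_diff spt_scale spt_al)

lemma spt_act_lp: "\<lbrakk>u \<in> lists J; J \<subseteq> S; spt J v\<rbrakk> \<Longrightarrow> spt J (act (lp u) v)"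
  using act_lp[of u] spt_wact[of u J v] lists_mono[of J S] by (metis subsetD)

lemma spt_act: "\<lbrakk>w \<in> carrier W; spt S v\<rbrakk> \<Longrightarrow> spt S (act w v)"
  using spt_act_lp carrier_word by (metis order_refl)

lemma spt_expand: "finite J \<Longrightarrow> spt J f \<Longrightarrow> f = (\<Sum>s\<in>J. f $ s *\<^sub>R al s)"
  by (rule rvec_eqI) (auto simp: spt_def coord_sum al_def if_distrib cong: if_cong)

subsection \<open>Positive definiteness\<close>

text \<open>The standard inner product averaged over the finite group: invariant and visibly
  positive, whereas \<open>bl\<close> is at first known only to be invariant.\<close>

definition Q :: "'a rvec \<Rightarrow> 'a rvec \<Rightarrow> real" where
  "Q f g = (\<Sum>w\<in>carrier W. \<Sum>x\<in>S. act w f $ x * act w g $ x)"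

lemma Q_act:
  assumes "g \<in> carrier W"
  shows "Q (act g f) (act g h) = Q f h"
proof -
  have "Q f h = (\<Sum>w\<in>carrier W. \<Sum>x\<in>S. act (w \<otimes> g) f $ x * act (w \<otimes> g) h $ x)"
    unfolding Q_def
    by (rule sum.reindex_bij_witness[where i = "\<lambda>w. w \<otimes> g" and j = "\<lambda>w. w \<otimes> inv g"])
      (use assms in \<open>auto simp: m_assoc\<close>)
  also have "\<dots> = Q (act g f) (act g h)"
    unfolding Q_def using assms by (intro sum.cong) (simp_all add: act_mult)
  finally show ?thesis ..
qed

lemma Q_sym: "Q f g = Q g f"
  by (simp add: Q_def mult.commute)

lemma Q_add_right: "Q f (g + h) = Q f g + Q f h"
  by (simp add: Q_def act_lin algebra_simps sum.distrib)

lemma Q_scale_right: "Q f (c *\<^sub>R g) = c * Q f g"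
  by (simp add: Q_def act_lin sum_distrib_left algebra_simps)

lemma Q_scale_left: "Q (c *\<^sub>R f) g = c * Q f g"
  using Q_scale_right Q_sym by metis

lemma Q_sum_right: "Q f (\<Sum>i\<in>A. g i) = (\<Sum>i\<in>A. Q f (g i))"
proof (induction A rule: infinite_finite_induct)
  case (insert x A)
  then show ?case by (simp add: Q_add_right)
qed (simp_all add: Q_def)

lemma Q_sum_left: "Q (\<Sum>i\<in>A. g i) f = (\<Sum>i\<in>A. Q (g i) f)"
  unfolding Q_sym[of _ f] by (rule Q_sum_right)

lemma Q_pos:
  assumes "spt S f" "f \<noteq> 0"
  shows "Q f f > 0"
proof -
  obtain x where x: "f $ x \<noteq> 0" "x \<in> S" using assms by (auto simp: rvec_eq_iff spt_def)
  have "0 < f $ x * f $ x" using x by (auto simp: zero_less_mult_iff linorder_neq_iff)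
  also have "\<dots> \<le> (\<Sum>x\<in>S. f $ x * f $ x)"
    using x finite_S by (intro member_le_sum) auto
  also have "\<dots> = (\<Sum>x\<in>S. act \<one> f $ x * act \<one> f $ x)" by simp
  also have "\<dots> \<le> Q f f"
    unfolding Q_def using finite_carrier
    by (intro member_le_sum[of \<one> "carrier W" "\<lambda>w. \<Sum>x\<in>S. act w f $ x * act w f $ x"]) (auto intro: sum_nonneg)
  finally show ?thesis .
qed

text \<open>As \<open>s\<close> negates \<open>al s\<close>, invariance gives
  \<open>Q (al s) v = - Q (al s) (s v)\<close>; expanding \<open>s v\<close> and solving for
  \<open>Q (al s) v\<close> gives the claim.\<close>

lemma Q_al:
  assumes "s \<in> S"
  shows "Q (al s) v = Q (al s) (al s) * bl (al s) v"
proof -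
  have "rfl (al s) (al s) = (-1) *\<^sub>R al s"
    using assms by (intro rvec_eqI) (simp add: rfl_def bl_al_self)
  moreover have "s \<in> carrier W" using assms S_carrier by auto
  ultimately have "Q (al s) v = Q ((-1) *\<^sub>R al s) (v + (- (2 * bl (al s) v)) *\<^sub>R al s)"
    using Q_act[of s "al s" v] assms by (simp add: act_S rfl_def)
  also have "\<dots> = - (Q (al s) v - 2 * bl (al s) v * Q (al s) (al s))"
    unfolding Q_add_right Q_scale_right Q_scale_left by simp
  finally show ?thesis by simp
qed

text \<open>
  Each generator acts as a reflection in the invariant inner product \<^const>\<open>Q\<close> too, so the two forms differ
  by a rescaling of the simple roots.
\<close>

lemma bl_pos:
  assumes "spt S f" "f \<noteq> 0"
  shows "bl f f > 0"
proof -
  define k where "k s = Q (al s) (al s)" for s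
  have k_pos: "k s > 0" if "s \<in> S" for s
    unfolding k_def using that by (intro Q_pos spt_al) (auto simp: al_def rvec_eq_iff)
  have kk: "k s * cb s t = k t * cb s t" if "s \<in> S" "t \<in> S" for s t
    using Q_al[of s "al t"] Q_al[of t "al s"] that Q_sym[of "al s" "al t"] cb_sym
    unfolding k_def by (metis bl_al_al)
  \<comment> \<open>By \<open>kk\<close>, \<open>k\<close> agrees on any two generators with
    \<open>cb s t\<close> nonzero. Dividing by \<open>sqrt (k x)\<close> therefore turns the Gram
    matrix \<open>k s * cb s t\<close> of \<open>Q\<close> into \<open>cb s t\<close>, so that
    \<open>Q g g = bl f f\<close>.\<close>
  define g where "g = RVec (\<lambda>x. f $ x / sqrt (k x))"
  have "spt S g" using assms by (auto simp: g_def spt_def)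
  moreover have "g \<noteq> 0"
  proof
    assume "g = 0"
    then have *: "f $ x / sqrt (k x) = 0" for x by (simp add: g_def rvec_eq_iff)
    have "f $ x = 0" for x
      using assms(1) k_pos[of x] *[of x] by (cases "x \<in> S") (simp_all add: spt_def)
    with assms(2) show False by (simp add: rvec_eq_iff)
  qed
  ultimately have "0 < Q g g" by (rule Q_pos)
  also have "g = (\<Sum>s\<in>S. g $ s *\<^sub>R al s)"
    using finite_S \<open>spt S g\<close> by (rule spt_expand)
  then have "Q g g = Q (\<Sum>s\<in>S. g $ s *\<^sub>R al s) (\<Sum>s\<in>S. g $ s *\<^sub>R al s)" by metis
  also have "\<dots> = (\<Sum>s\<in>S. \<Sum>t\<in>S. g $ s * g $ t * Q (al s) (al t))"
    by (simp add: Q_sum_right Q_sum_left Q_scale_right Q_scale_left sum_distrib_left mult_ac Q_sym)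
  also have "\<dots> = (\<Sum>s\<in>S. \<Sum>t\<in>S. f $ s * f $ t * cb s t)"
  proof (intro sum.cong refl)
    fix s t assume st: "s \<in> S" "t \<in> S"
    have "Q (al s) (al t) = k s * cb s t" using Q_al[of s "al t"] st by (simp add: bl_al_al k_def)
    moreover have "cb s t = 0 \<or> k s = k t" using kk[OF st] by auto
    ultimately show "g $ s * g $ t * Q (al s) (al t) = f $ s * f $ t * cb s t"
      using k_pos[OF st(1)] k_pos[OF st(2)] by (auto simp: g_def)
  qed
  finally show ?thesis by (simp add: bl_def)
qed

lemma bl_eq_0: "spt S f \<Longrightarrow> bl f f = 0 \<Longrightarrow> f = 0"
  using bl_pos by fastforce

text \<open>For infinite order the sum of the two simple roots would be isotropic, contradicting
  definiteness.\<close>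

lemma m_pos:
  assumes "s \<in> S" "t \<in> S"
  shows "m s t > 0"
proof (rule ccontr)
  assume "\<not> m s t > 0"
  then have ne: "s \<noteq> t" and "m s t = 0" "m t s = 0" using assms m_diag m_sym by auto
  then have "bl (al s + al t) (al s + al t) = 0"
    using assms by (simp add: bl_lin bl_al_al cb_def)
  moreover have "spt S (al s + al t)" using assms by (intro spt_add spt_al)
  ultimately have "(al s + al t) $ s = 0 $ s" using bl_eq_0 by metis
  then show False using ne by (simp add: al_def)
qed

subsection \<open>Positivity of roots\<close>

definition len :: "'a \<Rightarrow> nat" where
  "len w = (LEAST k. \<exists>u\<in>lists S. length u = k \<and> lp u = w)"

lemma len_le: "u \<in> lists S \<Longrightarrow> len (lp u) \<le> length u"
  unfolding len_def by (rule Least_le) auto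

lemma reduced_word:
  assumes "w \<in> carrier W"
  obtains u where "u \<in> lists S" "w = lp u" "length u = len w"
proof -
  have "\<exists>u\<in>lists S. length u = len w \<and> lp u = w"
    unfolding len_def by (rule LeastI_ex) (use word_exists assms in blast)
  then show ?thesis using that by blast
qed

lemma len_mult_lp:
  assumes "w \<in> carrier W" "u \<in> lists S"
  shows "len (w \<otimes> lp u) \<le> len w + length u"
proof -
  obtain u' where "u' \<in> lists S" "w = lp u'" "length u' = len w" using reduced_word assms by blast
  then show ?thesis using len_le[of "u' @ u"] assms by (simp add: lp_S_append)
qed

lemma len_mult_S:
  assumes "w \<in> carrier W" "s \<in> S"
  shows "len (w \<otimes> s) \<noteq> len w" "len (w \<otimes> s) \<le> len w + 1" "len w \<le> len (w \<otimes> s) + 1"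
proof -
  have s: "s \<in> carrier W" using assms S_carrier by auto
  obtain u where u: "u \<in> lists S" "w = lp u" "length u = len w" using reduced_word assms by blast
  obtain u' where u': "u' \<in> lists S" "w \<otimes> s = lp u'" "length u' = len (w \<otimes> s)"
    using reduced_word[of "w \<otimes> s"] assms s by auto
  have "lp (u @ [s]) = lp u'" using u u' assms s by (simp add: lp_S_append)
  then have "even (length (u @ [s])) \<longleftrightarrow> even (length u')"
    using u u' assms by (intro length_parity) auto
  then show "len (w \<otimes> s) \<noteq> len w" using u u' by auto
  show "len (w \<otimes> s) \<le> len w + 1" using len_mult_lp[of w "[s]"] assms s by simp
  have "w = (w \<otimes> s) \<otimes> s" using assms s S_square by (simp add: m_assoc)
  then show "len w \<le> len (w \<otimes> s) + 1"
    using len_mult_lp[of "w \<otimes> s" "[s]"] assms s by simp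
qed

lemma lp_rev:
  assumes "u \<in> lists S"
  shows "lp (rev u) = inv (lp u)"
  using assms
proof (induction u)
  case (Cons s u)
  then have "s \<in> carrier W" "rev u \<in> lists S" "[s] \<in> lists S" using S_carrier by auto
  with Cons show ?case using S_inv by (simp add: lp_S_append inv_mult_group del: in_lists_conv_set)
qed simp

lemma nth_concat_pair:
  "i < 2 * j \<Longrightarrow> concat (replicate j [s, t]) ! i = (if even i then s else t)"
proof (induction j arbitrary: i)
  case (Suc j)
  then show ?case by (cases i; cases "i - 1") auto
qed simp

lemma length_concat_pair: "length (concat (replicate j [s, t])) = 2 * j"
  by (induction j) auto

text \<open>Without equal neighbours the word alternates, and it cannot end in \<open>s\<close>; so
  each letter is determined by its distance from the end.\<close>

lemma alternating_nth:
  assumes "xs \<in> lists {s, t}" "\<And>a r b. xs \<noteq> a @ [r, r] @ b" "\<And>a. xs \<noteq> a @ [s]" "i < length xs"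
  shows "xs ! i = (if even (length xs - i) then s else t)"
  using assms
proof (induction xs arbitrary: i rule: list.induct)
  case (Cons x xs)
  have ys: "xs ! j = (if even (length xs - j) then s else t)" if "j < length xs" for j
  proof (rule Cons.IH)
    show "xs \<in> lists {s, t}" using Cons.prems(1) by (metis Cons_in_lists_iff)
    show "xs \<noteq> a @ [r, r] @ b" for a r b using Cons.prems(2)[of "x # a" r b] by auto
    show "j < length xs" by fact
    show "xs \<noteq> a @ [s]" for a using Cons.prems(3)[of "x # a"] by auto
  qed
  show ?case
  proof (cases i)
    case 0
    have x: "x \<in> {s, t}" using Cons.prems by auto
    show ?thesis
    proof (cases xs)
      case Nil
      then show ?thesis using x Cons.prems(3)[of "[]"] 0 by auto
    next
      case (Cons y zs)
      then have "x \<noteq> y" using Cons.prems(2)[of "[]" x zs] by auto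
      moreover have "y = (if even (length xs) then s else t)" using ys[of 0] Cons by simp
      ultimately show ?thesis using x 0 by (auto split: if_splits)
    qed
  next
    case (Suc j)
    then show ?thesis using ys[of j] Cons.prems by auto
  qed
qed simp

definition nng :: "'a rvec \<Rightarrow> bool" where
  "nng f \<longleftrightarrow> (\<forall>x. 0 \<le> f $ x)"

lemma nng_add: "nng f \<Longrightarrow> nng g \<Longrightarrow> nng (f + g)"
  and nng_scale: "0 \<le> c \<Longrightarrow> nng f \<Longrightarrow> nng (c *\<^sub>R f)"
  and nng_al: "nng (al s)"
  by (auto simp: nng_def al_def)

text \<open>The coefficients are \<open>sin (i h) / sin h\<close> with
  \<open>h = pi / m(s,t)\<close>; the bound on the length keeps \<open>i \<le> m(s,t)\<close>, so no
  angle exceeds \<open>pi\<close>.\<close>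

lemma alternating_coefficients:
  assumes st: "s \<in> S" "t \<in> S" "s \<noteq> t" and k: "length xs < m s t"
    and xs: "\<And>i. i < length xs \<Longrightarrow> xs ! i = (if even (length xs - i) then s else t)"
  shows "\<exists>a b. 0 \<le> a \<and> 0 \<le> b \<and> wact xs (al s) = a *\<^sub>R al s + b *\<^sub>R al t"
proof -
  define h where "h = pi / real (m s t)"
  have "m s t \<ge> 2" using m_pos[OF st(1,2)] m_neq_1[OF st] by simp
  then have sinh: "sin h > 0"
    unfolding h_def by (intro sin_gt_zero) (simp_all add: field_simps)
  have sin_nn: "0 \<le> sin (real i * h)" if "i \<le> m s t" for i
    unfolding h_def using that m_pos[OF st(1,2)] by (intro sin_ge_zero) (auto simp: field_simps)
  define j where "j = length xs div 2"
  have ev: "wact (concat (replicate j [s, t])) (al s) =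
       (sin ((2 * real j + 1) * h) / sin h) *\<^sub>R al s + (sin (2 * real j * h) / sin h) *\<^sub>R al t"
    using wact_plane[OF st, folded h_def, of j 1 0] sinh by simp
  show ?thesis
  proof (cases "even (length xs)")
    case True
    then have l: "length xs = 2 * j" by (simp add: j_def)
    then have "xs = concat (replicate j [s, t])"
      using xs by (intro nth_equalityI) (auto simp: length_concat_pair nth_concat_pair)
    moreover have "0 \<le> sin ((2 * real j + 1) * h)" "0 \<le> sin (2 * real j * h)"
      using sin_nn[of "2 * j + 1"] sin_nn[of "2 * j"] k l by (simp_all add: add.commute)
    ultimately show ?thesis using ev sinh by (intro exI conjI) auto
  next
    case False
    then have l: "length xs = 2 * j + 1" by (simp add: j_def)
    then have "xs = t # concat (replicate j [s, t])"
      using xs by (intro nth_equalityI) (auto simp: length_concat_pair nth_concat_pair nth_Cons split: nat.splits)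
    then have "wact xs (al s) = rfl (al t) ((sin (2 * real j * h) / sin h) *\<^sub>R al t + (sin ((2 * real j + 1) * h) / sin h) *\<^sub>R al s)"
      by (simp only: wact_simps ev add.commute)
    also have "\<dots> = (2 * cos h * (sin ((2 * real j + 1) * h) / sin h) - sin (2 * real j * h) / sin h) *\<^sub>R al t
          + (sin ((2 * real j + 1) * h) / sin h) *\<^sub>R al s"
      unfolding h_def m_sym[OF st(1,2)] by (rule rfl_al_plane) (use st in auto)
    also have "2 * cos h * (sin ((2 * real j + 1) * h) / sin h) - sin (2 * real j * h) / sin h
        = sin ((2 * real j + 2) * h) / sin h"
    proof -
      have "sin ((2 * real j + 2) * h) = 2 * cos h * sin ((2 * real j + 1) * h) - sin (2 * real j * h)"
        using sin_step[of "(2 * real j + 1) * h" h] by (simp add: algebra_simps)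
      then show ?thesis by (simp only: times_divide_eq_right diff_divide_distrib[symmetric])
    qed
    finally have "wact xs (al s) = (sin ((2 * real j + 1) * h) / sin h) *\<^sub>R al s + (sin ((2 * real j + 2) * h) / sin h) *\<^sub>R al t"
      by (simp only: add.commute)
    moreover have "0 \<le> sin ((2 * real j + 1) * h)" "0 \<le> sin ((2 * real j + 2) * h)"
      using sin_nn[of "2 * j + 1"] sin_nn[of "2 * j + 2"] k l by (simp_all add: add.commute)
    ultimately show ?thesis using sinh by (intro exI conjI) auto
  qed
qed

text \<open>
  Write \<open>w = v x\<close> with \<open>x\<close> in the dihedral group of \<open>s\<close> and the last letter \<open>t\<close> of a reduced word of \<open>w\<close>,
  lengths adding up and \<open>v\<close> as short as possible; the claim then holds for \<open>v\<close> by induction, and \<open>x\<close> is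
  an alternating word shorter than \<open>m(s,t)\<close>.
\<close>

lemma act_al_nng:
  assumes "w \<in> carrier W" "s \<in> S" "\<not> len (w \<otimes> s) < len w"
  shows "nng (act w (al s))"
  using assms
proof (induction "len w" arbitrary: w s rule: less_induct)
  case less
  note w = less.prems(1) and s = less.prems(2)
  have sc: "s \<in> carrier W" using s S_carrier by auto
  obtain u where u: "u \<in> lists S" "w = lp u" "length u = len w" using reduced_word w by blast
  show ?case
  proof (cases u rule: rev_cases)
    case Nil
    then show ?thesis using u nng_al by simp
  next
    case (snoc u' t)
    then have t: "t \<in> S" "t \<in> carrier W" and u': "u' \<in> lists S" using u S_carrier by auto
    have w_u': "w = lp u' \<otimes> t" using u snoc t u' by (simp add: lp_S_append)
    have len_u': "len (lp u') + 1 = len w"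
      using len_le[OF u'] len_mult_S(2)[of "lp u'" t] w_u' u' t u snoc by simp
    have "w \<otimes> t = lp u'" using w_u' t u' S_square by (simp add: m_assoc)
    then have st: "s \<noteq> t" using len_u' less.prems by auto
    define P where "P v xs \<longleftrightarrow> v \<in> carrier W \<and> xs \<in> lists {s, t} \<and> w = v \<otimes> lp xs \<and> len v + length xs = len w"
      for v xs
    have "P (lp u') [t]" using u' t w_u' len_u' by (simp add: P_def)
    then obtain v where v: "\<exists>xs. P v xs" and v_min: "\<And>v' xs. P v' xs \<Longrightarrow> len v \<le> len v'"
      using ex_has_least_nat[of "\<lambda>v. \<exists>xs. P v xs" "lp u'" len] by blast
    then obtain xs where P: "P v xs" by blast
    have vc: "v \<in> carrier W" and xs: "xs \<in> lists {s, t}" and w_v: "w = v \<otimes> lp xs" and len_v: "len v + length xs = len w"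
      using P by (auto simp: P_def)
    have sub: "lists {s, t} \<subseteq> lists S" using s t by (intro lists_mono) auto
    have xsS: "xs \<in> lists S" using xs sub by blast
    have lw: "len v < len w" using v_min[OF \<open>P (lp u') [t]\<close>] len_u' by simp
    have short: "len w \<le> len v + length ys" if "w = v \<otimes> lp ys" "ys \<in> lists {s, t}" for ys
      using len_mult_lp[OF vc, of ys] that sub by auto
    \<comment> \<open>A descent letter of \<open>v\<close> could be moved to the front of
      \<open>xs\<close>, contradicting the minimality of \<open>v\<close>. Hence the induction
      hypothesis applies to \<open>v\<close> for both \<open>s\<close> and \<open>t\<close>.\<close>
    have up: "\<not> len (v \<otimes> r) < len v" if r: "r \<in> {s, t}" for r
    proof
      assume *: "len (v \<otimes> r) < len v"
      have rc: "r \<in> carrier W" "r \<in> S" using r s sc t by auto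
      have eq: "w = (v \<otimes> r) \<otimes> lp (r # xs)"
        using rc vc lp_S_closed[of xs] xs sub w_v S_cancel by (simp add: m_assoc subsetD del: in_lists_conv_set)
      have "len w \<le> len (v \<otimes> r) + length (r # xs)"
        unfolding eq using rc vc xs sub by (intro len_mult_lp) auto
      then have "P (v \<otimes> r) (r # xs)"
        using * len_v rc vc xs r eq len_mult_S[OF vc rc(2)] by (auto simp: P_def)
      then show False using v_min * by fastforce
    qed
    have nng: "nng (act v (al r))" if "r \<in> {s, t}" for r
      using less.hyps[OF lw vc _ up[OF that]] that s t by auto
    have alt1: "xs \<noteq> a @ [r, r] @ b" for a r b
    proof
      assume e: "xs = a @ [r, r] @ b"
      then have ab: "a \<in> lists S" "b \<in> lists S" "r \<in> S" "r \<in> carrier W" using xs s t sc by auto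
      have "lp xs = lp (a @ b)"
        using ab S_square by (simp add: e lp_S_append m_assoc S_cancel)
      then have "len w \<le> len v + length (a @ b)" using w_v e xs by (intro short) auto
      then show False using len_v e by simp
    qed
    have alt2: "xs \<noteq> a @ [s]" for a
    proof
      assume e: "xs = a @ [s]"
      then have a: "a \<in> lists S" using xs s t by auto
      have "w \<otimes> s = v \<otimes> lp a"
        using a vc sc S_square s by (simp add: w_v e lp_S_append m_assoc)
      then have "len (w \<otimes> s) \<le> len v + length a" using len_mult_lp[OF vc a] by simp
      then show False using less.prems(3) len_v e by simp
    qed
    have alt: "xs ! i = (if even (length xs - i) then s else t)" if "i < length xs" for i
      using alternating_nth[OF xs alt1 alt2 that] .
    \<comment> \<open>Otherwise the braid relation rewrites the last \<open>m(s,t)\<close> letters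
      of \<open>xs\<close> into a word ending in \<open>s\<close>, and cancelling that
      \<open>s\<close> makes \<open>w s\<close> shorter than \<open>w\<close>.\<close>
    have k: "length xs < m s t"
    proof (rule ccontr)
      define k where "k = m s t"
      have "k > 0" using m_pos s t by (simp add: k_def)
      assume "\<not> length xs < m s t"
      then have kl: "k \<le> length xs" by (simp add: k_def)
      define z where "z = concat (replicate k [s, t])"
      have z: "z \<in> lists S" using s t by (auto simp: z_def split: if_splits)
      define A B where "A = take k z" and "B = drop k z"
      have AB: "A \<in> lists S" "B \<in> lists S" "z = A @ B"
        using z set_take_subset[of k z] set_drop_subset[of k z] by (auto simp: A_def B_def)
      have "lp A \<otimes> lp B = \<one>"
        using lp_relation[OF s t(1)] AB lp_S_append by (simp add: z_def k_def)
      then have "lp B = inv (lp A)" using AB by (metis inv_equality inv_inv lp_S_closed)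
      also have "\<dots> = lp (rev A)" using AB lp_rev by simp
      finally have BA: "lp B = lp (rev A)" .
      have lenz: "length z = 2 * k" by (simp add: z_def length_concat_pair)
      have lenA: "length A = k" and "A ! 0 = s" using \<open>k > 0\<close> lenz nth_concat_pair[of 0 k s t] by (simp_all add: A_def z_def)
      then obtain y where y: "A = s # y" using \<open>k > 0\<close> by (cases A) auto
      have "drop (length xs - k) xs = B"
      proof (rule nth_equalityI)
        show "length (drop (length xs - k) xs) = length B" using kl lenz by (simp add: B_def)
        fix i assume i: "i < length (drop (length xs - k) xs)"
        then have "drop (length xs - k) xs ! i = xs ! (length xs - k + i)" using kl by simp
        also have "\<dots> = (if even (k - i) then s else t)" using alt[of "length xs - k + i"] i kl by simp
        also have "\<dots> = (if even (k + i) then s else t)" using i kl by simp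
        also have "\<dots> = B ! i" using i kl lenz nth_concat_pair[of "k + i" k s t] by (simp add: B_def z_def)
        finally show "drop (length xs - k) xs ! i = B ! i" .
      qed
      then have xsB: "xs = take (length xs - k) xs @ B" by (metis append_take_drop_id)
      define p where "p = take (length xs - k) xs"
      have p: "p \<in> lists S" using xs sub set_take_subset[of "length xs - k" xs] by (auto simp: p_def)
      have lenp: "length p + k = length xs" using kl by (simp add: p_def)
      have yS: "rev y \<in> lists S" using y AB by auto
      have "lp xs = lp p \<otimes> lp (rev y @ [s])"
        using xsB p AB BA y by (metis lp_S_append p_def rev.simps(2))
      then have "w \<otimes> s = v \<otimes> lp (p @ rev y)"
        using p yS vc sc S_square[OF s] s by (simp add: w_v lp_S_append m_assoc)
      then have "len (w \<otimes> s) \<le> len v + length (p @ rev y)" using len_mult_lp[OF vc, of "p @ rev y"] p yS by simp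
      then show False using less.prems(3) len_v lenp lenA y by simp
    qed
    obtain a b where ab: "0 \<le> a" "0 \<le> b" "wact xs (al s) = a *\<^sub>R al s + b *\<^sub>R al t"
      using alternating_coefficients[OF s t(1) st k alt] by blast
    have "act w (al s) = act v (a *\<^sub>R al s + b *\<^sub>R al t)"
      using ab w_v vc xsS act_mult[of v "lp xs"] act_lp[of xs] lp_S_closed[of xs] by metis
    also have "\<dots> = a *\<^sub>R act v (al s) + b *\<^sub>R act v (al t)" by (simp only: act_lin)
    finally show ?thesis using ab nng by (auto intro!: nng_add nng_scale)
  qed
qed

lemma act_al_sign:
  assumes "w \<in> carrier W" "s \<in> S"
  shows "nng (act w (al s)) \<or> nng (- act w (al s))"
proof (cases "len (w \<otimes> s) < len w")
  case True
  have s: "s \<in> carrier W" using assms S_carrier by auto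
  have "(w \<otimes> s) \<otimes> s = w" using assms s S_square by (simp add: m_assoc)
  then have "nng (act (w \<otimes> s) (al s))" using True assms s by (intro act_al_nng) auto
  also have "act (w \<otimes> s) (al s) = act w (- al s)"
    using assms s by (simp add: act_mult act_S) (simp add: rfl_def bl_al_self scaleR_2)
  finally show ?thesis by (simp add: act_lin)
qed (use act_al_nng assms in auto)

text \<open>The last letter \<open>s\<close> of a reduced word of a nontrivial \<open>w\<close>
  shortens it, so \<open>w\<close> sends \<open>al s\<close> to a nonpositive vector and cannot fix
  it.\<close>

lemma act_faithful:
  assumes "w \<in> carrier W" "\<And>s. s \<in> S \<Longrightarrow> act w (al s) = al s"
  shows "w = \<one>"
proof (rule ccontr)
  assume "w \<noteq> \<one>"
  obtain u where u: "u \<in> lists S" "w = lp u" "length u = len w" using reduced_word assms by blast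
  then obtain u' s where u': "u = u' @ [s]" using \<open>w \<noteq> \<one>\<close> by (cases u rule: rev_cases) auto
  then have s: "s \<in> S" "s \<in> carrier W" "u' \<in> lists S" using u S_carrier by auto
  have ws: "w \<otimes> s = lp u'" using s S_square u u' by (simp add: lp_S_append m_assoc)
  have "(w \<otimes> s) \<otimes> s = w" using assms s S_square by (simp add: m_assoc)
  moreover have "len (w \<otimes> s) < len w" using ws len_le[of u'] s u u' by simp
  ultimately have "nng (act (w \<otimes> s) (al s))" using assms s by (intro act_al_nng) auto
  also have "act (w \<otimes> s) (al s) = act w (- al s)"
    using assms s by (simp add: act_mult act_S) (simp add: rfl_def bl_al_self scaleR_2)
  also have "\<dots> = - al s" using assms s by (simp add: act_lin)
  finally show False by (auto simp: nng_def al_def dest: spec[of _ s])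
qed

end

section \<open>Reflections and their roots\<close>

context group
begin

lemma inv_cancel:
  "\<lbrakk>g \<in> carrier G; x \<in> carrier G\<rbrakk> \<Longrightarrow> inv g \<otimes> (g \<otimes> x) = x"
  "\<lbrakk>g \<in> carrier G; x \<in> carrier G\<rbrakk> \<Longrightarrow> g \<otimes> (inv g \<otimes> x) = x"
  by (simp_all flip: m_assoc)

lemma list_prod_conj:
  "\<lbrakk>g \<in> carrier G; xs \<in> lists (carrier G)\<rbrakk>
     \<Longrightarrow> list_prod G (map (\<lambda>u. g \<otimes> u \<otimes> inv g) xs) = g \<otimes> list_prod G xs \<otimes> inv g"
proof (induction xs rule: list.induct)
  case (Cons a xs)
  then have xs: "list_prod G xs \<in> carrier G" "a \<in> carrier G" by auto
  have "inv g \<otimes> (g \<otimes> (list_prod G xs \<otimes> inv g)) = list_prod G xs \<otimes> inv g"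
    using Cons.prems xs by (simp add: m_assoc[symmetric])
  then show ?case using Cons xs by (simp add: m_assoc)
qed simp

text \<open>A Hurwitz move: \<open>a\<close> travels to the front and conjugates the letters it
  passes. This is the conjugation that occurs in the operators \<open>\<delta>\<close>.\<close>

lemma list_prod_hurwitz:
  "\<lbrakk>a \<in> carrier G; xs \<in> lists (carrier G); ys \<in> lists (carrier G)\<rbrakk>
     \<Longrightarrow> list_prod G (xs @ a # ys) = list_prod G (a # map (\<lambda>u. conj_by G u a) xs @ ys)"
proof (induction xs rule: list.induct)
  case (Cons b xs)
  have *: "list_prod G (map (\<lambda>u. conj_by G u a) xs @ ys) \<in> carrier G"
    using Cons.prems by (intro list_prod_closed) (auto simp: conj_by_def)
  have "a \<otimes> (inv a \<otimes> (b \<otimes> (a \<otimes> list_prod G (map (\<lambda>u. conj_by G u a) xs @ ys))))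
      = b \<otimes> (a \<otimes> list_prod G (map (\<lambda>u. conj_by G u a) xs @ ys))"
    using Cons.prems * by (simp add: m_assoc[symmetric])
  then show ?case using Cons * by (simp add: conj_by_def m_assoc)
qed simp

end

context coxeter
begin

abbreviation T :: "'a set" where "T \<equiv> reflections W S"

lemma T_cases:
  assumes "t \<in> T"
  obtains w s where "w \<in> carrier W" "s \<in> S" "t = w \<otimes> s \<otimes> inv w"
  using assms by (auto simp: reflections_def)

lemma T_carrier: "t \<in> T \<Longrightarrow> t \<in> carrier W"
  using S_carrier by (auto elim!: T_cases)

lemma lists_T_carrier: "ts \<in> lists T \<Longrightarrow> ts \<in> lists (carrier W)"
  using T_carrier by auto

lemma lp_T_closed: "ts \<in> lists T \<Longrightarrow> lp ts \<in> carrier W"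
  using lists_T_carrier by auto

lemma lp_T_append: "\<lbrakk>u \<in> lists T; v \<in> lists T\<rbrakk> \<Longrightarrow> lp (u @ v) = lp u \<otimes> lp v"
  using lists_T_carrier list_prod_append by auto

lemma finite_T: "finite T"
  using T_carrier finite_carrier by (meson finite_subset subsetI)

lemma T_conj: "\<lbrakk>t \<in> T; g \<in> carrier W\<rbrakk> \<Longrightarrow> g \<otimes> t \<otimes> inv g \<in> T"
proof (elim T_cases)
  fix w s assume *: "g \<in> carrier W" "w \<in> carrier W" "s \<in> S" "t = w \<otimes> s \<otimes> inv w"
  then have "g \<otimes> t \<otimes> inv g = (g \<otimes> w) \<otimes> s \<otimes> inv (g \<otimes> w)"
    using S_carrier by (auto simp: m_assoc inv_mult_group)
  then show ?thesis using * by (auto simp: reflections_def)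
qed

lemma T_conj': "\<lbrakk>t \<in> T; g \<in> carrier W\<rbrakk> \<Longrightarrow> inv g \<otimes> t \<otimes> g \<in> T"
  using T_conj[of t "inv g"] by simp

lemma S_T: "S \<subseteq> T"
proof
  fix s assume "s \<in> S"
  then have "s = \<one> \<otimes> s \<otimes> inv \<one>" "\<one> \<in> carrier W" using S_carrier by auto
  then show "s \<in> T" using \<open>s \<in> S\<close> unfolding reflections_def by blast
qed

lemma T_square:
  assumes "t \<in> T"
  shows "t \<otimes> t = \<one>"
proof -
  obtain w s where *: "w \<in> carrier W" "s \<in> S" "t = w \<otimes> s \<otimes> inv w" using assms T_cases by blast
  then have s: "s \<in> carrier W" using S_carrier by auto
  have "t \<otimes> t = w \<otimes> (s \<otimes> ((inv w \<otimes> w) \<otimes> (s \<otimes> inv w)))"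
    unfolding * using * s by (simp only: m_assoc m_closed inv_closed)
  then show ?thesis using * s S_cancel by simp
qed

lemma T_inv: "t \<in> T \<Longrightarrow> inv t = t"
  using T_square T_carrier inv_equality by metis

lemma T_cancel: "\<lbrakk>t \<in> T; x \<in> carrier W\<rbrakk> \<Longrightarrow> t \<otimes> (t \<otimes> x) = x"
  using T_square[of t] T_carrier[of t] by (simp flip: m_assoc)

lemma conj_by_T: "\<lbrakk>u \<in> T; t \<in> T\<rbrakk> \<Longrightarrow> conj_by W u t \<in> T"
  unfolding conj_by_def using T_conj' T_carrier by blast

lemma map_conj_by_T: "\<lbrakk>us \<in> lists T; t \<in> T\<rbrakk> \<Longrightarrow> map (\<lambda>u. conj_by W u t) us \<in> lists T"
  using conj_by_T by auto

lemma map_conj_T: "\<lbrakk>us \<in> lists T; g \<in> carrier W\<rbrakk> \<Longrightarrow> map (\<lambda>u. g \<otimes> u \<otimes> inv g) us \<in> lists T"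
  using T_conj by auto

lemma act_conj_reflection:
  assumes "w \<in> carrier W" "s \<in> S"
  shows "act (w \<otimes> s \<otimes> inv w) v = rfl (act w (al s)) v"
proof -
  have s: "s \<in> carrier W" using assms S_carrier by auto
  have "act (w \<otimes> s \<otimes> inv w) v = act w (rfl (al s) (act (inv w) v))"
    using assms s by (simp add: act_mult act_S)
  also have "\<dots> = v - (2 * bl (al s) (act (inv w) v)) *\<^sub>R act w (al s)"
    using assms by (simp add: rfl_def act_lin)
  also have "bl (al s) (act (inv w) v) = bl (act w (al s)) v"
    using assms act_bl_inv by simp
  finally show ?thesis by (simp add: rfl_def)
qed

section \<open>Positive unit roots of reflections\<close>

definition root_of :: "'a \<Rightarrow> 'a rvec \<Rightarrow> bool" where
  "root_of t r \<longleftrightarrow> spt S r \<and> nng r \<and> bl r r = 1 \<and> (\<forall>v. act t v = rfl r v)"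

definition root :: "'a \<Rightarrow> 'a rvec" where
  "root t = (SOME r. root_of t r)"

lemma rfl_minus: "rfl (- r) v = rfl r v"
  by (simp add: rfl_def bl_lin)

lemma nng_both: "nng f \<Longrightarrow> nng (- f) \<Longrightarrow> f = 0"
  by (auto simp: nng_def rvec_eq_iff intro: antisym)

lemma root_of_conj:
  assumes "w \<in> carrier W" "s \<in> S"
  shows "root_of (w \<otimes> s \<otimes> inv w) (act w (al s)) \<or> root_of (w \<otimes> s \<otimes> inv w) (- act w (al s))"
proof -
  have "spt S (act w (al s))" using assms by (intro spt_act spt_al) auto
  moreover have "bl (act w (al s)) (act w (al s)) = 1" using assms by (simp add: act_bl bl_al_self)
  ultimately show ?thesis
    using act_al_sign[OF assms] act_conj_reflection[OF assms]
    by (auto simp: root_of_def rfl_minus bl_lin spt_minus)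
qed

lemma root_of_proportional:
  assumes "spt S r" "nng r" "bl r r = 1" "nng r'" "bl r' r' = 1" "r = c *\<^sub>R r'"
  shows "r = r'"
proof -
  have "c * c = 1" using assms by (simp add: bl_lin)
  then have "c = 1 \<or> c = -1" by (simp add: square_eq_1_iff)
  moreover have "c \<noteq> -1"
  proof
    assume "c = -1"
    then have "nng (- r')" using assms by simp
    then have "r' = 0" using assms nng_both by blast
    then show False using assms by simp
  qed
  ultimately show ?thesis using assms by auto
qed

lemma root_of_unique:
  assumes "root_of t r" "root_of t r'"
  shows "r = r'"
proof (rule root_of_proportional)
  have "rfl r r = rfl r' r" using assms by (simp add: root_of_def)
  then have "2 *\<^sub>R r = 2 *\<^sub>R (bl r' r *\<^sub>R r')"
    using assms(1) by (simp add: rfl_def root_of_def)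
  then show "r = bl r' r *\<^sub>R r'" by (metis scaleR_cancel_left zero_neq_numeral)
qed (use assms in \<open>auto simp: root_of_def\<close>)

lemma root_of_root:
  assumes "t \<in> T"
  shows "root_of t (root t)"
proof -
  obtain w s where "w \<in> carrier W" "s \<in> S" "t = w \<otimes> s \<otimes> inv w" using assms T_cases by blast
  then have "\<exists>r. root_of t r" using root_of_conj by blast
  then show ?thesis unfolding root_def by (rule someI_ex)
qed

lemma root_eqI: "root_of t r \<Longrightarrow> t \<in> T \<Longrightarrow> root t = r"
  using root_of_unique root_of_root by blast

lemma
  assumes "t \<in> T"
  shows spt_root: "spt S (root t)" and nng_root: "nng (root t)"
    and bl_root: "bl (root t) (root t) = 1" and act_T: "act t v = rfl (root t) v"
  using root_of_root[OF assms] by (auto simp: root_of_def)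

lemma root_nz: "t \<in> T \<Longrightarrow> root t \<noteq> 0"
  using bl_root by fastforce

lemma root_S: "s \<in> S \<Longrightarrow> root s = al s"
  by (rule root_eqI) (use S_T in \<open>auto simp: root_of_def spt_al nng_al bl_al_self act_S\<close>)

lemma act_root:
  assumes "g \<in> carrier W" "t \<in> T"
  shows "act g (root t) = root (g \<otimes> t \<otimes> inv g) \<or> act g (root t) = - root (g \<otimes> t \<otimes> inv g)"
proof -
  obtain w s where ws: "w \<in> carrier W" "s \<in> S" "t = w \<otimes> s \<otimes> inv w" using assms T_cases by blast
  have "root t = act w (al s) \<or> root t = - act w (al s)"
    using root_of_conj[OF ws(1,2)] root_eqI[OF _ assms(2)] ws(3) by auto
  then have 1: "act g (root t) = act (g \<otimes> w) (al s) \<or> act g (root t) = - act (g \<otimes> w) (al s)"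
    using assms ws by (auto simp: act_mult act_lin)
  have eq: "g \<otimes> t \<otimes> inv g = (g \<otimes> w) \<otimes> s \<otimes> inv (g \<otimes> w)"
    using assms ws S_carrier by (auto simp: m_assoc inv_mult_group)
  have "root (g \<otimes> t \<otimes> inv g) = act (g \<otimes> w) (al s) \<or> root (g \<otimes> t \<otimes> inv g) = - act (g \<otimes> w) (al s)"
    using root_of_conj[of "g \<otimes> w" s] root_eqI[OF _ T_conj[OF assms(2,1)]] assms ws eq by auto
  with 1 show ?thesis by auto
qed

lemma act_eq_imp_eq:
  assumes "w \<in> carrier W" "w' \<in> carrier W" "\<And>v. act w v = act w' v"
  shows "w = w'"
proof -
  have "inv w' \<otimes> w = \<one>"
    using assms by (intro act_faithful) (auto simp: act_mult)
  then show ?thesis using assms by (metis inv_closed inv_equality inv_inv)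
qed

lemma root_inj:
  assumes "t \<in> T" "t' \<in> T" "root t = root t'"
  shows "t = t'"
  using assms act_T by (intro act_eq_imp_eq) (auto simp: T_carrier)

lemma root_proportional:
  assumes "t \<in> T" "t' \<in> T" "root t = c *\<^sub>R root t'"
  shows "t = t'"
  using root_inj[OF assms(1,2)] root_of_proportional[OF _ _ _ _ _ assms(3)]
    spt_root[OF assms(1)] nng_root[OF assms(1)] bl_root[OF assms(1)] nng_root[OF assms(2)] bl_root[OF assms(2)]
  by blast

text \<open>Since \<open>s\<close> changes only the coordinate at \<open>s\<close>, a negative image
  would leave no other nonzero coordinate, making \<open>root t\<close> proportional to
  \<open>al s\<close>.\<close>

lemma simple_reflection_root:
  assumes "s \<in> S" "t \<in> T" "t \<noteq> s"
  shows "act s (root t) = root (s \<otimes> t \<otimes> s)"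
proof (rule ccontr)
  have s: "s \<in> carrier W" "s \<in> T" "inv s = s" using assms S_carrier S_T S_inv by auto
  assume "act s (root t) \<noteq> root (s \<otimes> t \<otimes> s)"
  then have "act s (root t) = - root (s \<otimes> t \<otimes> s)" using act_root[OF s(1) assms(2)] s by auto
  moreover have "nng (root (s \<otimes> t \<otimes> s))" using T_conj[OF assms(2) s(1)] s nng_root by simp
  ultimately have *: "act s (root t) $ x \<le> 0" for x by (simp add: nng_def)
  have "root t $ x = 0" if "x \<noteq> s" for x
  proof (rule antisym)
    show "root t $ x \<le> 0" using *[of x] that assms(1) by (simp add: act_S rfl_def al_def)
    show "0 \<le> root t $ x" using nng_root[OF assms(2)] by (simp add: nng_def)
  qed
  then have "root t = (root t $ s) *\<^sub>R root s"
    using assms(1) by (intro rvec_eqI) (simp add: root_S al_def)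
  then show False using root_proportional[OF assms(2) s(2)] assms(3) by blast
qed

text \<open>Each reflection changes a vector by a multiple of its root, and the changes telescope.
  This bounds the image of \<open>1 - w\<close>, as in Carter's lemma on reflection length.\<close>

lemma diff_act_span:
  "ts \<in> lists T \<Longrightarrow> v - act (lp ts) v \<in> span (root ` set ts)"
proof (induction ts arbitrary: v rule: list.induct)
  case (Cons t ts)
  let ?u = "act (lp ts) v"
  have t: "t \<in> T" "ts \<in> lists T" using Cons.prems by auto
  have "act (lp (t # ts)) v = ?u - (2 * bl (root t) ?u) *\<^sub>R root t"
    using t by (simp add: act_mult T_carrier lp_T_closed act_T rfl_def del: in_lists_conv_set)
  then have "v - act (lp (t # ts)) v = (v - ?u) + (2 * bl (root t) ?u) *\<^sub>R root t"
    by (simp add: algebra_simps)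
  moreover have "v - ?u \<in> span (root ` set (t # ts))"
    using Cons.IH[OF t(2)] span_mono[of "root ` set ts" "root ` set (t # ts)"] by auto
  moreover have "(2 * bl (root t) ?u) *\<^sub>R root t \<in> span (root ` set (t # ts))"
    by (intro span_scale span_base) simp
  ultimately show ?case by (metis span_add)
qed (simp add: span_zero)

text \<open>A property of lists rather than sets: repetitions count as dependence, and peeling off
  the head matches induction on words.\<close>

fun lin_indep_list :: "'a rvec list \<Rightarrow> bool" where
  "lin_indep_list [] \<longleftrightarrow> True"
| "lin_indep_list (b # bs) \<longleftrightarrow> b \<notin> span (set bs) \<and> lin_indep_list bs"

text \<open>Peel off the first letter \<open>t\<close>: the change of \<open>u\<close> under the
  other letters is a multiple of \<open>root t\<close> and lies in the span of their roots.
  Independence makes it zero, so \<open>u\<close> is orthogonal to \<open>root t\<close> and fixed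
  by the rest.\<close>

lemma fixed_imp_orthogonal:
  assumes "ts \<in> lists T" "lin_indep_list (map root ts)" "act (lp ts) u = u" "r \<in> set ts"
  shows "bl (root r) u = 0"
  using assms
proof (induction ts rule: list.induct)
  case (Cons t ts)
  have t: "t \<in> T" "ts \<in> lists T" using Cons.prems by auto
  have "act (lp (t # ts)) u = rfl (root t) (act (lp ts) u)"
    using t by (simp add: act_mult T_carrier lp_T_closed act_T del: in_lists_conv_set)
  then have "act (lp ts) u = rfl (root t) u"
    using Cons.prems(3) rfl_rfl[OF bl_root[OF t(1)]] by metis
  then have *: "u - act (lp ts) u = (2 * bl (root t) u) *\<^sub>R root t" by (simp add: rfl_def)
  have "bl (root t) u = 0"
  proof (rule ccontr)
    assume "bl (root t) u \<noteq> 0"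
    then have "root t = (1 / (2 * bl (root t) u)) *\<^sub>R (u - act (lp ts) u)" by (simp add: *)
    also have "\<dots> \<in> span (root ` set ts)" by (intro span_scale diff_act_span t)
    finally show False using Cons.prems(2) by simp
  qed
  with * have "act (lp ts) u = u" by simp
  then show ?case using Cons t \<open>bl (root t) u = 0\<close> by auto
qed simp

lemma span_spt: "span (al ` J) \<subseteq> {f. spt J f}"
  by (rule span_minimal) (auto simp: spt_al subspace_def spt_add spt_scale)

lemma lin_indep_al: "distinct js \<Longrightarrow> lin_indep_list (map al js)"
proof (induction js)
  case (Cons s js)
  have "al s \<notin> span (al ` set js)"
  proof
    assume "al s \<in> span (al ` set js)"
    then have "spt (set js) (al s)" using span_spt by auto
    then show False using Cons.prems by (auto simp: spt_def al_def)
  qed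
  then show ?case using Cons by simp
qed simp

lemma map_root_S: "js \<in> lists S \<Longrightarrow> map root js = map al js"
  using root_S by auto

lemma lists_S_T: "js \<in> lists S \<Longrightarrow> js \<in> lists T"
  using S_T by auto

text \<open>A fixed vector is orthogonal to the simple roots of \<open>js\<close> and also a
  combination of them; it has norm zero, and definiteness applies.\<close>

lemma parabolic_coxeter_fixed_point_free:
  assumes "distinct js" "js \<in> lists S" "spt (set js) u" "act (lp js) u = u"
  shows "u = 0"
proof -
  have orth: "bl (al s) u = 0" if "s \<in> set js" for s
    using fixed_imp_orthogonal[OF lists_S_T[OF assms(2)] _ assms(4) that] map_root_S[OF assms(2)]
      lin_indep_al[OF assms(1)] root_S[of s] that assms(2) by auto
  have "bl u u = bl (\<Sum>s\<in>set js. u $ s *\<^sub>R al s) u"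
    using spt_expand[OF _ assms(3)] by simp
  also have "\<dots> = (\<Sum>s\<in>set js. u $ s * bl (al s) u)"
    by (induction "set js" rule: infinite_finite_induct)
      (simp_all add: linear_sum[OF linearI[of "\<lambda>f. bl f u"]] bl_lin)
  also have "\<dots> = 0" using orth by simp
  finally show ?thesis using bl_eq_0 assms spt_mono[of "set js" u S] by auto
qed

lemma coxeter_fixed_point_free:
  assumes "distinct ss" "set ss = S" "spt S u" "act (lp ss) u = u"
  shows "u = 0"
  using parabolic_coxeter_fixed_point_free[of ss u] assms by auto

subsection \<open>Rotations of Coxeter words\<close>

text \<open>The product of the first \<open>k\<close> letters of the periodic word
  \<open>js js js ...\<close>; \<open>hd (rotate k js)\<close> is its letter at position
  \<open>k\<close>, counted from 0.\<close>

fun prefix_prod :: "'a list \<Rightarrow> nat \<Rightarrow> 'a" where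
  "prefix_prod js 0 = \<one>"
| "prefix_prod js (Suc k) = prefix_prod js k \<otimes> hd (rotate k js)"

lemma hd_rotate_S: "js \<in> lists S \<Longrightarrow> js \<noteq> [] \<Longrightarrow> hd (rotate k js) \<in> S"
  by (metis hd_in_set in_listsD rotate_is_Nil_conv set_rotate)

lemma prefix_prod_closed [simp]:
  "js \<in> lists S \<Longrightarrow> js \<noteq> [] \<Longrightarrow> prefix_prod js k \<in> carrier W"
proof (induction k)
  case (Suc k)
  then show ?case using hd_rotate_S[of js k] S_carrier by auto
qed simp

lemma prefix_prod_rotate:
  assumes "js \<in> lists S" "js \<noteq> []"
  shows "inv (prefix_prod js k) \<otimes> lp js \<otimes> prefix_prod js k = lp (rotate k js)"
proof (induction k)
  case (Suc k)
  obtain s r where sr: "rotate k js = s # r" using assms by (metis list.exhaust rotate_is_Nil_conv)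
  then have "set (s # r) \<subseteq> S" using assms set_rotate[of k js] by (auto simp del: set_rotate)
  then have s: "s \<in> S" "r \<in> lists S" "s \<in> carrier W" using S_carrier by auto
  have P: "prefix_prod js k \<in> carrier W" using assms by simp
  have js: "lp js \<in> carrier W" using assms by simp
  have "inv (prefix_prod js (Suc k)) \<otimes> lp js \<otimes> prefix_prod js (Suc k)
      = s \<otimes> (inv (prefix_prod js k) \<otimes> lp js \<otimes> prefix_prod js k) \<otimes> s"
    using P s js S_inv by (simp add: sr inv_mult_group m_assoc)
  also have "\<dots> = lp r \<otimes> s"
    unfolding Suc.IH sr using s S_cancel by (simp add: m_assoc)
  also have "\<dots> = lp (rotate (Suc k) js)"
    using s sr by (simp add: lp_S_append)
  finally show ?case .
qed (use assms in simp)

lemma prefix_prod_take: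
  "js \<in> lists S \<Longrightarrow> k \<le> length js \<Longrightarrow> prefix_prod js k = lp (take k js)"
proof (induction k)
  case (Suc k)
  then have k: "k < length js" by simp
  have S: "take k js \<in> lists S" "js ! k \<in> S" "js ! k \<in> carrier W"
    using Suc.prems k S_carrier set_take_subset[of k js] nth_mem[of k js] by auto
  have "hd (rotate k js) = js ! k" using k hd_rotate_conv_nth[of js k] by (metis length_0_conv mod_less not_less_zero)
  then show ?case using Suc k S by (simp add: take_Suc_conv_app_nth lp_S_append)
qed simp

lemma prefix_prod_add_length:
  assumes "js \<in> lists S" "js \<noteq> []"
  shows "prefix_prod js (k + length js) = lp js \<otimes> prefix_prod js k"
proof (induction k)
  case 0
  then show ?case using prefix_prod_take[of js "length js"] assms by simp
next
  case (Suc k)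
  have "rotate (k + length js) js = rotate k js"
    by (metis mod_add_self2 rotate_conv_mod)
  then show ?case using Suc assms hd_rotate_S[OF assms, of k] S_carrier lp_S_closed[OF assms(1)]
      prefix_prod_closed[OF assms, of k] by (simp add: m_assoc subsetD)
qed

lemma prefix_prod_power:
  assumes "js \<in> lists S" "js \<noteq> []"
  shows "prefix_prod js (j * length js) = lp js [^] (j :: nat)"
proof (induction j)
  case (Suc j)
  then show ?case
    using assms prefix_prod_add_length[OF assms, of "j * length js"] nat_pow_Suc2[of "lp js" j]
    by (simp add: add.commute)
qed simp

text \<open>By \<open>simple_reflection_root\<close> a letter of the periodic word can turn the
  transported root negative only if that root is its own simple root. As long as this does not
  happen, no sign appears.\<close>

lemma act_prefix_prod_root:
  assumes "js \<in> lists S" "js \<noteq> []" "t \<in> T"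
    and "\<And>i. i < k \<Longrightarrow> inv (prefix_prod js i) \<otimes> t \<otimes> prefix_prod js i \<noteq> hd (rotate i js)"
  shows "act (inv (prefix_prod js k)) (root t) = root (inv (prefix_prod js k) \<otimes> t \<otimes> prefix_prod js k)"
  using assms(4)
proof (induction k)
  case 0
  then show ?case using assms T_carrier by simp
next
  case (Suc k)
  let ?P = "prefix_prod js k" and ?s = "hd (rotate k js)"
  have s: "?s \<in> S" "?s \<in> carrier W" using hd_rotate_S[OF assms(1,2)] S_carrier by auto
  have P: "?P \<in> carrier W" using assms by simp
  have t: "t \<in> carrier W" using assms T_carrier by simp
  have "act (inv (prefix_prod js (Suc k))) (root t) = act ?s (act (inv ?P) (root t))"
    using s P S_inv by (simp add: inv_mult_group act_mult)
  also have "\<dots> = act ?s (root (inv ?P \<otimes> t \<otimes> ?P))" using Suc by simp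
  also have "\<dots> = root (?s \<otimes> (inv ?P \<otimes> t \<otimes> ?P) \<otimes> ?s)"
    using Suc.prems[of k] s P assms T_conj' by (intro simple_reflection_root) auto
  also have "?s \<otimes> (inv ?P \<otimes> t \<otimes> ?P) \<otimes> ?s = inv (prefix_prod js (Suc k)) \<otimes> t \<otimes> prefix_prod js (Suc k)"
    using s P t S_inv by (simp add: inv_mult_group m_assoc)
  finally show ?case .
qed

text \<open>
  If the root stayed positive along all rotations, its orbit sum under the Coxeter element would be a
  nonzero fixed vector.
\<close>

lemma reflection_reached:
  assumes "js \<in> lists S" "distinct js" "t \<in> T" "spt (set js) (root t)"
  shows "js \<noteq> []" "\<exists>k. inv (prefix_prod js k) \<otimes> t \<otimes> prefix_prod js k = hd (rotate k js)"
proof -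
  show ne: "js \<noteq> []" using assms root_nz[OF assms(3)] by (auto simp: spt_def rvec_eq_iff)
  let ?P = "prefix_prod js"
  show "\<exists>k. inv (?P k) \<otimes> t \<otimes> ?P k = hd (rotate k js)"
  proof (rule ccontr)
    assume *: "\<not> ?thesis"
    define c where "c = lp js"
    have c: "c \<in> carrier W" using assms by (simp add: c_def)
    define h where "h = order W"
    have h: "h > 0" "c [^] h = \<one>"
      using finite_carrier c order_gt_0_iff_finite pow_order_eq_1 by (auto simp: h_def)
    define f where "f j = act (inv (c [^] j)) (root t)" for j :: nat
    have nng: "nng (f j)" for j
    proof -
      have "f j = act (inv (?P (j * length js))) (root t)"
        using prefix_prod_power[OF assms(1) ne, of j] by (simp add: f_def c_def)
      also have "\<dots> = root (inv (?P (j * length js)) \<otimes> t \<otimes> ?P (j * length js))"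
        using * assms ne by (intro act_prefix_prod_root) auto
      finally show ?thesis using assms ne nng_root T_conj' by simp
    qed
    have shift: "act (inv c) (f j) = f (Suc j)" for j
      using c by (simp add: f_def act_mult inv_mult_group)
    define z where "z = (\<Sum>j<h. f j)"
    have "act (inv c) z = (\<Sum>j<h. f (Suc j))" by (simp add: z_def act_sum shift)
    also have "\<dots> = z"
      using sum.lessThan_Suc_shift[of f h] sum.lessThan_Suc[of f h] h c by (simp add: z_def f_def)
    finally have "act c z = z" using c act_inv(2)[of c z] by simp
    have sptf: "spt (set js) (f j)" for j
    proof (induction j)
      case (Suc j)
      have "inv c = lp (rev js)" using assms lp_rev by (simp add: c_def)
      moreover have "spt (set js) (act (lp (rev js)) (f j))"
        using assms by (intro spt_act_lp Suc) auto
      ultimately show ?case using shift by simp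
    qed (use assms c in \<open>simp add: f_def\<close>)
    have "z = 0"
      using parabolic_coxeter_fixed_point_free[OF assms(2,1)] \<open>act c z = z\<close> spt_sum[of "{..<h}" "set js" f] sptf
      by (simp add: z_def c_def)
    have "root t $ x \<le> 0" for x
    proof -
      have "f 0 $ x \<le> (\<Sum>j<h. f j $ x)"
        using h nng by (intro member_le_sum) (auto simp: nng_def)
      also have "\<dots> = z $ x" by (simp add: z_def coord_sum)
      finally show ?thesis using \<open>z = 0\<close> by (simp add: f_def)
    qed
    then have "nng (- root t)" by (simp add: nng_def)
    then show False using nng_both nng_root root_nz assms by blast
  qed
qed

end

lemma sum_Suc_shift:
  fixes g :: "nat \<Rightarrow> 'b :: ab_group_add"
  shows "(\<Sum>k<h. g (Suc k)) = (\<Sum>k<h. g k) + g h - g 0"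
  by (induction h) (simp_all add: algebra_simps)

context coxeter
begin

subsection \<open>The Seifert form of a fixed point free element\<close>

text \<open>Equivalently, \<open>1 - c\<close> is invertible on the span of the simple roots. Unlike
  being the product of a word in \<open>S\<close> that uses each generator once, this property
  passes visibly to conjugates.\<close>

definition fpf :: "'a \<Rightarrow> bool" where
  "fpf c \<longleftrightarrow> c \<in> carrier W \<and> (\<forall>u. spt S u \<longrightarrow> act c u = u \<longrightarrow> u = 0)"

lemma fpf_coxeter:
  assumes "distinct ss" "set ss = S"
  shows "fpf (lp ss)"
proof -
  have "lp ss \<in> carrier W" using assms by (intro lp_S_closed) auto
  then show ?thesis using coxeter_fixed_point_free[OF assms] by (simp add: fpf_def)
qed

lemma fpf_conj:
  assumes "fpf c" "g \<in> carrier W"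
  shows "fpf (g \<otimes> c \<otimes> inv g)"
  unfolding fpf_def
proof (intro conjI allI impI)
  show "g \<otimes> c \<otimes> inv g \<in> carrier W" using assms by (simp add: fpf_def)
  fix u assume u: "spt S u" "act (g \<otimes> c \<otimes> inv g) u = u"
  then have "act c (act (inv g) u) = act (inv g) u"
    using assms by (metis act_inv(1) act_mult fpf_def inv_closed m_closed)
  then have "act (inv g) u = 0" using assms u spt_act by (simp add: fpf_def)
  then show "u = 0" using assms by (metis act_inv(2) act_zero)
qed

text \<open>The inverse of \<open>1 - c\<close> as a polynomial in \<open>c\<close>; any positive
  multiple of the order of \<open>c\<close> could serve as the period, and the group order works for
  all \<open>c\<close> at once.\<close>

definition nu :: "'a \<Rightarrow> 'a rvec \<Rightarrow> 'a rvec" where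
  "nu c v = (- 1 / real (order W)) *\<^sub>R (\<Sum>k<(order W). real k *\<^sub>R act (c [^] k) v)"

lemma nu_add: "nu c (v + w) = nu c v + nu c w"
  by (simp add: nu_def act_add sum.distrib scaleR_add_right)

lemma nu_scale: "nu c (a *\<^sub>R v) = a *\<^sub>R nu c v"
  by (simp add: nu_def act_scale scaleR_sum_right mult_ac)

lemma spt_nu: "c \<in> carrier W \<Longrightarrow> spt S v \<Longrightarrow> spt S (nu c v)"
  unfolding nu_def by (intro spt_scale spt_sum spt_act) auto

text \<open>The orbit sum of \<open>v\<close> vanishes, so summation by parts inverts \<open>1 - c\<close>.\<close>

lemma nu_inverse:
  assumes "fpf c" "spt S v"
  shows "nu c v - act c (nu c v) = v"
proof -
  have c: "c \<in> carrier W" using assms by (simp add: fpf_def)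
  define h where "h = order W"
  have h: "h > 0" "c [^] h = \<one>"
    using finite_carrier c order_gt_0_iff_finite pow_order_eq_1 by (auto simp: h_def)
  define f where "f k = act (c [^] k) v" for k :: nat
  have shift: "act c (f k) = f (Suc k)" for k
    using c nat_pow_Suc2[of c k] by (simp add: f_def act_mult del: nat_pow_Suc)
  have fh: "f h = v" "f 0 = v" using h by (simp_all add: f_def)
  have "act c (\<Sum>k<h. f k) = (\<Sum>k<h. f k)"
    by (simp add: act_sum shift fh sum_Suc_shift)
  moreover have "spt S (\<Sum>k<h. f k)" using assms c by (auto simp: f_def intro: spt_sum spt_act)
  ultimately have 0: "(\<Sum>k<h. f k) = 0" using assms by (simp add: fpf_def)
  define z where "z = (\<Sum>k<h. real k *\<^sub>R f k)"
  have "act c z = (\<Sum>k<h. real k *\<^sub>R f (Suc k))" by (simp add: z_def act_sum act_scale shift)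
  also have "\<dots> = (\<Sum>k<h. real (Suc k) *\<^sub>R f (Suc k)) - (\<Sum>k<h. f (Suc k))"
    by (simp add: sum_subtractf[symmetric] scaleR_add_left)
  also have "(\<Sum>k<h. f (Suc k)) = 0"
    by (simp add: fh 0 sum_Suc_shift)
  also have "(\<Sum>k<h. real (Suc k) *\<^sub>R f (Suc k)) = z + real h *\<^sub>R v"
    using sum_Suc_shift[of "\<lambda>k. real k *\<^sub>R f k" h] by (simp add: fh z_def)
  finally have "z - act c z = - (real h *\<^sub>R v)" by simp
  moreover have "nu c v = (- 1 / real h) *\<^sub>R z" by (simp add: nu_def z_def f_def h_def)
  ultimately have "nu c v - act c (nu c v) = (- 1 / real h) *\<^sub>R (- (real h *\<^sub>R v))"
    by (metis act_scale scaleR_diff_right)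
  then show ?thesis using h by simp
qed

lemma nu_unique:
  assumes "fpf c" "spt S a" "a - act c a = v"
  shows "nu c v = a"
proof -
  have c: "c \<in> carrier W" using assms by (simp add: fpf_def)
  have v: "spt S v" using assms c spt_act spt_diff by blast
  have "act c (nu c v - a) = nu c v - a"
  proof -
    have "nu c v - act c (nu c v) = a - act c a" using nu_inverse[OF assms(1) v] assms(3) by simp
    then show ?thesis by (simp add: act_lin algebra_simps)
  qed
  moreover have "spt S (nu c v - a)" using spt_nu[OF c v] assms spt_diff by blast
  ultimately have "nu c v - a = 0" using assms(1) unfolding fpf_def by blast
  then show ?thesis by simp
qed

text \<open>The form \<open>E\<close> of the overview. With the factor 2 unit roots have value 1 on
  the diagonal, see \<open>seif_root_self\<close>.\<close>

definition seif :: "'a \<Rightarrow> 'a rvec \<Rightarrow> 'a rvec \<Rightarrow> real" where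
  "seif c u v = 2 * bl (nu c u) v"

lemma seif_lin:
  "seif c (u + u') v = seif c u v + seif c u' v" "seif c u (v + v') = seif c u v + seif c u v'"
  "seif c (a *\<^sub>R u) v = a * seif c u v" "seif c u (a *\<^sub>R v) = a * seif c u v"
  by (simp_all add: seif_def nu_add nu_scale bl_lin algebra_simps)

text \<open>Substitute \<open>u = a - c a\<close> and \<open>v = b - c b\<close> and use that
  \<open>c\<close> is an isometry. In particular \<open>seif c d d = bl d d\<close>, so the form is
  anisotropic.\<close>

lemma seif_symmetrize:
  assumes "fpf c" "spt S u" "spt S v"
  shows "seif c u v + seif c v u = 2 * bl u v"
proof -
  have c: "c \<in> carrier W" using assms by (simp add: fpf_def)
  define a where "a = nu c u"
  define b where "b = nu c v"
  have ab: "u = a - act c a" "v = b - act c b"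
    using nu_inverse assms by (simp_all add: a_def b_def)
  have "seif c u v = 2 * bl a v" "seif c v u = 2 * bl b u" by (simp_all add: seif_def a_def b_def)
  then show ?thesis
    using act_bl[OF c, of a b] bl_sym[of "act c a" b] bl_sym[of b a] by (simp add: ab bl_lin)
qed

lemma seif_conj:
  assumes "fpf c" "g \<in> carrier W" "spt S u"
  shows "seif (g \<otimes> c \<otimes> inv g) (act g u) (act g v) = seif c u v"
proof -
  have c: "c \<in> carrier W" using assms by (simp add: fpf_def)
  have "nu (g \<otimes> c \<otimes> inv g) (act g u) = act g (nu c u)"
  proof (rule nu_unique[OF fpf_conj[OF assms(1,2)]])
    show "spt S (act g (nu c u))" using assms c spt_act spt_nu by simp
    have "act (g \<otimes> c \<otimes> inv g) (act g (nu c u)) = act g (act c (nu c u))"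
      using assms c by (simp add: act_mult)
    then show "act g (nu c u) - act (g \<otimes> c \<otimes> inv g) (act g (nu c u)) = act g u"
      using nu_inverse[OF assms(1,3)] by (metis linear_act linear_diff)
  qed
  then show ?thesis using assms act_bl by (simp add: seif_def)
qed

section \<open>Independence and orthogonality of the roots of a shortest factorization\<close>

lemma dependent_list_shrink:
  "\<not> lin_indep_list bs \<Longrightarrow> \<exists>B. finite B \<and> card B < length bs \<and> span (set bs) \<subseteq> span B"
proof (induction bs)
  case (Cons b bs)
  show ?case
  proof (cases "b \<in> span (set bs)")
    case True
    then have "span (set (b # bs)) \<subseteq> span (set bs)" by (simp add: span_redundant)
    then show ?thesis using card_length[of bs] by (intro exI[of _ "set bs"]) simp
  next
    case False
    then obtain B where B: "finite B" "card B < length bs" "span (set bs) \<subseteq> span B" using Cons by auto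
    have "set (b # bs) \<subseteq> span (insert b B)"
      using B(3) span_superset[of "set bs"] span_mono[of B "insert b B"] span_base[of b "insert b B"] by auto
    then have "span (set (b # bs)) \<subseteq> span (insert b B)" by (simp add: span_minimal)
    moreover have "card (insert b B) < length (b # bs)" using B card_insert_le_m1[of "length bs" B b] by (simp add: card_insert_if)
    ultimately show ?thesis using B by blast
  qed
qed simp

lemma independent_al: "independent (al ` S)"
proof (rule independent_if_scalars_zero)
  show "finite (al ` S)" using finite_S by simp
  fix f x assume *: "(\<Sum>x\<in>al ` S. f x *\<^sub>R x) = 0" "x \<in> al ` S"
  have inj: "inj_on al S" by (rule inj_onI) (auto simp: al_def fun_eq_iff split: if_splits)
  obtain s where s: "s \<in> S" "x = al s" using * by auto
  have "0 = (\<Sum>x\<in>al ` S. f x *\<^sub>R x) $ s" using * by simp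
  also have "\<dots> = (\<Sum>t\<in>S. f (al t) * al t $ s)" by (simp add: sum.reindex[OF inj] coord_sum)
  also have "\<dots> = (\<Sum>t\<in>S. if t = s then f (al s) else 0)"
    by (intro sum.cong) (auto simp: al_def)
  also have "\<dots> = f x" using s finite_S by simp
  finally show "f x = 0" ..
qed

text \<open>By \<open>nu_inverse\<close> every simple root lies in the image of
  \<open>1 - c\<close>, so a set spanning that image has at least as many elements as there are
  simple roots.\<close>

lemma card_S_le_of_span:
  assumes "fpf c" "finite B" "\<And>a. a - act c a \<in> span B"
  shows "card S \<le> card B"
proof -
  have "al ` S \<subseteq> span B"
  proof
    fix x assume "x \<in> al ` S"
    then have "spt S x" using spt_al by auto
    then show "x \<in> span B" using nu_inverse[OF assms(1)] assms(3) by metis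
  qed
  then have "card (al ` S) \<le> card B" using independent_span_bound[OF assms(2) independent_al] by simp
  moreover have "inj_on al S" by (rule inj_onI) (auto simp: al_def fun_eq_iff split: if_splits)
  ultimately show ?thesis by (simp add: card_image)
qed

lemma fpf_length:
  assumes "fpf c" "ts \<in> lists T" "lp ts = c"
  shows "card S \<le> length ts"
proof -
  have "card S \<le> card (root ` set ts)"
    using assms diff_act_span by (intro card_S_le_of_span) auto
  also have "\<dots> \<le> length ts" using card_image_le[of "set ts" root] card_length[of ts] by simp
  finally show ?thesis .
qed

lemma fpf_lin_indep:
  assumes "fpf c" "ts \<in> lists T" "lp ts = c" "length ts = card S"
  shows "lin_indep_list (map root ts)"
proof (rule ccontr)
  assume "\<not> ?thesis"
  then obtain B where B: "finite B" "card B < length (map root ts)" "span (set (map root ts)) \<subseteq> span B"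
    using dependent_list_shrink by blast
  have "card S \<le> card B"
    using assms B diff_act_span[of ts] by (intro card_S_le_of_span[OF assms(1)]) auto
  with B assms show False by simp
qed

text \<open>
  With \<open>u = (1 - c)\<^sup>-\<^sup>1 \<beta>\<close> for the root \<open>\<beta>\<close> of \<open>t\<close>, the isometry \<open>t c\<close> maps \<open>u\<close> to \<open>u + d \<beta>\<close>
  with \<open>d = 1 - 2 \<langle>\<beta>, u\<rangle>\<close>; comparing norms gives \<open>d = 0\<close>.
\<close>

lemma nu_root:
  assumes "fpf c" "t \<in> T" "rs \<in> lists T" "c = lp (t # rs)"
  shows "2 * bl (nu c (root t)) (root t) = 1" "act (lp rs) (nu c (root t)) = nu c (root t)"
proof -
  define r where "r = root t"
  define u where "u = nu c r"
  define d where "d = 1 - 2 * bl r u"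
  have r1: "bl r r = 1" using assms by (simp add: r_def bl_root)
  have rs: "lp rs \<in> carrier W" "t \<in> carrier W" using assms lp_T_closed T_carrier by auto
  have "u - act c u = r" using assms nu_inverse spt_root by (simp add: u_def r_def)
  then have "act c u = u - r" by (simp add: algebra_simps)
  then have "rfl r (act (lp rs) u) = u - r"
    using assms rs by (simp add: act_mult act_T r_def)
  then have "act (lp rs) u = rfl r (u - r)" using rfl_rfl[OF r1] by metis
  also have "\<dots> = u + d *\<^sub>R r" by (rule rvec_eqI) (simp add: rfl_def d_def bl_lin r1 algebra_simps)
  finally have e: "act (lp rs) u = u + d *\<^sub>R r" .
  have "bl u u = bl (u + d *\<^sub>R r) (u + d *\<^sub>R r)" using act_bl[OF rs(1), of u u] e by simp
  also have "\<dots> = bl u u + d * (2 * bl r u + d)" using r1 bl_sym[of u r] by (simp add: bl_lin algebra_simps)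
  finally have "d = 0" by (simp add: d_def)
  then show "act (lp rs) (nu c (root t)) = nu c (root t)" "2 * bl (nu c (root t)) (root t) = 1"
    using e bl_sym[of u r] by (simp_all add: u_def r_def d_def)
qed

text \<open>By \<open>nu_root\<close> this vector is fixed by the product of the remaining letters,
  whose roots are independent; \<open>fixed_imp_orthogonal\<close> applies.\<close>

lemma nu_root_orthogonal:
  assumes "fpf c" "t \<in> T" "rs \<in> lists T" "c = lp (t # rs)" "length rs + 1 = card S" "r \<in> set rs"
  shows "bl (nu c (root t)) (root r) = 0"
proof -
  have "lin_indep_list (map root (t # rs))" using assms by (intro fpf_lin_indep) auto
  then show ?thesis
    using fixed_imp_orthogonal[OF assms(3) _ nu_root(2)[OF assms(1-4)] assms(6)] bl_sym by simp
qed

lemma seif_root_self: "fpf c \<Longrightarrow> t \<in> T \<Longrightarrow> seif c (root t) (root t) = 1"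
  using seif_symmetrize[of c "root t" "root t"] by (simp add: spt_root bl_root)

text \<open>A Hurwitz move brings \<open>t\<close> to the front and conjugates only the letters
  before it, so \<open>ys\<close> survives unchanged among the remaining letters.\<close>

lemma seif_root_orthogonal:
  assumes "fpf c" "t \<in> T" "xs \<in> lists T" "ys \<in> lists T" "c = lp (xs @ t # ys)"
    "length xs + length ys + 1 = card S" "r \<in> set ys"
  shows "seif c (root t) (root r) = 0"
proof -
  have "c = lp (t # map (\<lambda>u. conj_by W u t) xs @ ys)"
    using assms list_prod_hurwitz[of t xs ys] lists_T_carrier T_carrier by auto
  then show ?thesis
    unfolding seif_def
    using assms map_conj_by_T[OF assms(3,2)] nu_root_orthogonal[of c t "map (\<lambda>u. conj_by W u t) xs @ ys" r] by simp
qed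

text \<open>
  In a shortest factorization of \<open>c\<close>, the roots of a block span the image of \<open>1 - v\<close> for the product \<open>v\<close>
  of the block; hence they lie in the span of the roots of any other factorization of \<open>v\<close>.
\<close>

lemma block_roots_span:
  assumes "fpf c" "pre \<in> lists T" "as \<in> lists T" "post \<in> lists T" "bs \<in> lists T"
    and c: "c = lp (pre @ as @ post)" and len: "length (pre @ as @ post) = card S"
    and eq: "lp bs = lp as" and a: "a \<in> set as"
  shows "root a \<in> span (root ` set bs)"
proof -
  obtain A B where AB: "as = A @ a # B" using a split_list by metis
  have T: "A \<in> lists T" "a \<in> T" "B \<in> lists T" using assms AB by auto
  let ?c = "map (\<lambda>u. conj_by W u a)"
  define rs where "rs = ?c (pre @ A) @ B @ post"
  have rs: "rs \<in> lists T" using T assms map_conj_by_T by (auto simp: rs_def conj_by_T)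
  have "c = lp ((pre @ A) @ a # (B @ post))" using c AB by simp
  also have "\<dots> = lp (a # rs)"
    unfolding rs_def using T assms lists_T_carrier T_carrier by (intro list_prod_hurwitz) auto
  finally have c': "c = lp (a # rs)" .
  have len': "length rs + 1 = card S" using len AB by (simp add: rs_def)
  \<comment> \<open>All letters other than \<open>a\<close> fix \<open>u\<close>, and
    \<open>a\<close> subtracts \<open>root a\<close> from it. With \<open>v\<close> the product of
    the block this gives \<open>root a = u - v u\<close>, and \<open>v\<close> may be expanded along
    \<open>bs\<close>.\<close>
  define u where "u = nu c (root a)"
  have orth: "bl (root r) u = 0" if "r \<in> set rs" for r
    using nu_root_orthogonal[OF assms(1) T(2) rs c' len' that] bl_sym by (simp add: u_def)
  have fixed: "act (lp zs) u = u" if "zs \<in> lists T" "\<And>z. z \<in> set zs \<Longrightarrow> bl (root z) u = 0" for zs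
    using that
  proof (induction zs rule: list.induct)
    case (Cons z zs)
    then have "act (lp (z # zs)) u = act z (act (lp zs) u)"
      using lp_T_closed[of zs] T_carrier[of z] by (auto simp: act_mult)
    then show ?case using Cons by (auto simp: act_T rfl_def)
  qed simp
  have "lp as = lp (a # ?c A @ B)"
    unfolding AB using T lists_T_carrier T_carrier by (intro list_prod_hurwitz) auto
  then have "act (lp as) u = act a (act (lp (?c A @ B)) u)"
    using T lp_T_closed[of "?c A @ B"] map_conj_by_T[OF T(1,2)] T_carrier by (simp add: act_mult)
  also have "act (lp (?c A @ B)) u = u"
    using T map_conj_by_T[OF T(1,2)] by (intro fixed orth) (auto simp: rs_def)
  also have "act a u = u - root a"
    using nu_root(1)[OF assms(1) T(2) rs c'] bl_sym[of u] T by (simp add: act_T rfl_def u_def)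
  finally have "root a = u - act (lp bs) u" by (simp add: eq)
  then show ?thesis using diff_act_span[OF assms(5)] by simp
qed

section \<open>Parabolic factors of Coxeter elements\<close>

lemma root_conj_span:
  assumes "g \<in> carrier W" "t \<in> T" "ks \<in> lists T" "root t \<in> span (root ` set ks)"
  shows "root (g \<otimes> t \<otimes> inv g) \<in> span (root ` set (map (\<lambda>u. g \<otimes> u \<otimes> inv g) ks))"
proof -
  let ?K = "root ` set (map (\<lambda>u. g \<otimes> u \<otimes> inv g) ks)"
  have "act g (root t) \<in> span (act g ` root ` set ks)"
    using assms(4) by (simp add: linear_span_image[OF linear_act])
  moreover have "act g ` root ` set ks \<subseteq> span ?K"
  proof safe
    fix k assume "k \<in> set ks"
    then have "root (g \<otimes> k \<otimes> inv g) \<in> span ?K" "k \<in> T" using assms by (auto intro: span_base)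
    then show "act g (root k) \<in> span ?K" using act_root[OF assms(1), of k] span_neg by metis
  qed
  ultimately have "act g (root t) \<in> span ?K" using span_minimal[OF _ subspace_span] by blast
  then show ?thesis using act_root[OF assms(1,2)] span_neg by (metis minus_minus)
qed

text \<open>Completing \<open>js\<close> by the other simple reflections makes \<open>ks\<close> a
  block of a shortest factorization of a Coxeter element. \<open>block_roots_span\<close>, with
  \<open>js\<close> as the competing factorization, then confines its roots.\<close>

lemma parabolic_root_support:
  assumes "distinct js" "js \<in> lists S" "ks \<in> lists T" "lp ks = lp js" "length ks = length js"
    "k \<in> set ks"
  shows "spt (set js) (root k)"
proof -
  obtain os where os: "set os = S - set js" "distinct os"
    using finite_distinct_list[of "S - set js"] finite_S by auto
  have js: "distinct (js @ os)" "set (js @ os) = S" using os assms by auto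
  have osT: "os \<in> lists T" "js \<in> lists T" using os S_T assms by auto
  have "root k \<in> span (root ` set js)"
  proof (rule block_roots_span[where pre = "[]" and as = ks and post = os])
    show "fpf (lp (js @ os))" using js by (intro fpf_coxeter)
    show "lp (js @ os) = lp ([] @ ks @ os)"
      using assms osT lp_T_append[of ks os] lp_T_append[of js os] by simp
    show "length ([] @ ks @ os) = card S"
      using assms js distinct_card[of "js @ os"] by simp
  qed (use assms osT in auto)
  also have "root ` set js = al ` set js" using assms root_S by (auto simp: image_iff)
  finally show ?thesis using span_spt by auto
qed

text \<open>Rotate the word until \<open>t\<close> has become its first letter, which
  \<open>reflection_reached\<close> guarantees to happen.\<close>

lemma reflection_dvd_parabolic:
  assumes "distinct js" "js \<in> lists S" "t \<in> T" "spt (set js) (root t)"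
  obtains g s rest where "g \<in> carrier W" "s \<in> S" "rest \<in> lists S" "distinct rest"
    "length rest + 1 = length js" "inv g \<otimes> t \<otimes> g = s" "inv g \<otimes> lp js \<otimes> g = lp (s # rest)"
proof -
  obtain k where k: "js \<noteq> []" "inv (prefix_prod js k) \<otimes> t \<otimes> prefix_prod js k = hd (rotate k js)"
    using reflection_reached[OF assms(2,1,3,4)] by blast
  define g where "g = prefix_prod js k"
  obtain s rest where sr: "rotate k js = s # rest" using k(1) by (metis list.exhaust rotate_is_Nil_conv)
  show ?thesis
  proof (rule that[of g s rest])
    show "g \<in> carrier W" using assms k by (simp add: g_def)
    have "set (s # rest) = set js" "distinct (s # rest)" "length (s # rest) = length js"
      using sr assms(1) by (metis set_rotate, metis distinct_rotate, metis length_rotate)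
    then show "s \<in> S" "rest \<in> lists S" "distinct rest" "length rest + 1 = length js"
      using assms(2) by auto
    show "inv g \<otimes> t \<otimes> g = s" using k sr by (simp add: g_def)
    show "inv g \<otimes> lp js \<otimes> g = lp (s # rest)"
      using prefix_prod_rotate[OF assms(2) k(1), of k] sr by (simp add: g_def)
  qed
qed

text \<open>
  Up to conjugation, every suffix of a shortest factorization of a Coxeter element is itself a Coxeter
  element of a standard parabolic subgroup: rotate until the first letter becomes simple, and drop it.
\<close>

lemma reflection_in_suffix_span:
  assumes "distinct js" "js \<in> lists S" "pre \<in> lists T" "ks \<in> lists T" "lp (pre @ ks) = lp js"
    "length pre + length ks = length js" "t \<in> T" "root t \<in> span (root ` set ks)"
  shows "\<exists>rs \<in> lists T. lp (t # rs) = lp ks \<and> length rs + 1 = length ks"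
  using assms
proof (induction "length pre" arbitrary: pre js ks t)
  case 0
  then have pre: "pre = []" by simp
  \<comment> \<open>With \<open>pre\<close> empty, \<open>ks\<close> factors \<open>lp js\<close>
    itself, so the span hypothesis says that \<open>root t\<close> is supported in
    \<open>js\<close>.\<close>
  have "root ` set ks \<subseteq> {f. spt (set js) f}"
    using parabolic_root_support[of js ks] 0(2-) pre by auto
  then have "span (root ` set ks) \<subseteq> {f. spt (set js) f}"
    by (rule span_minimal) (auto simp: subspace_def spt_add spt_scale)
  then have "spt (set js) (root t)" using 0(2-) pre by auto
  then obtain g s rest where g: "g \<in> carrier W" "s \<in> S" "rest \<in> lists S" "distinct rest"
    "length rest + 1 = length js" "inv g \<otimes> t \<otimes> g = s" "inv g \<otimes> lp js \<otimes> g = lp (s # rest)"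
    by (rule reflection_dvd_parabolic[OF 0(2,3,8)])
  let ?rs = "map (\<lambda>u. g \<otimes> u \<otimes> inv g) rest"
  have cl: "lp js \<in> carrier W" "t \<in> carrier W" "s \<in> carrier W" "lp rest \<in> carrier W"
    using 0(2-) pre T_carrier g S_carrier by auto
  have "lp js = g \<otimes> (inv g \<otimes> lp js \<otimes> g) \<otimes> inv g" using g(1) cl by (simp add: m_assoc inv_cancel)
  also have "\<dots> = (g \<otimes> (inv g \<otimes> t \<otimes> g) \<otimes> inv g) \<otimes> (g \<otimes> lp rest \<otimes> inv g)"
    unfolding g(6,7) using g(1) cl by (simp add: m_assoc inv_cancel)
  also have "g \<otimes> (inv g \<otimes> t \<otimes> g) \<otimes> inv g = t" using g(1) cl by (simp add: m_assoc inv_cancel)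
  also have "g \<otimes> lp rest \<otimes> inv g = lp ?rs"
    using g lists_S_carrier by (intro list_prod_conj[symmetric]) auto
  finally have "lp (t # ?rs) = lp ks" using 0(2-) pre by simp
  moreover have "?rs \<in> lists T" using g lists_S_T by (intro map_conj_T) auto
  ultimately show ?case using g 0(2-) pre by (intro bexI[of _ ?rs]) auto
next
  case (Suc n pre0)
  then obtain p pre where pre0: "pre0 = p # pre" "n = length pre" by (cases pre0) auto
  note prems = Suc.prems[unfolded pre0]
  have p: "p \<in> T" "pre \<in> lists T" "p \<in> carrier W" using prems T_carrier by auto
  have "spt (set js) (root p)"
    using parabolic_root_support[of js "(p # pre) @ ks" p] prems by auto
  then obtain g s rest where g: "g \<in> carrier W" "s \<in> S" "rest \<in> lists S" "distinct rest"
    "length rest + 1 = length js" "inv g \<otimes> p \<otimes> g = s" "inv g \<otimes> lp js \<otimes> g = lp (s # rest)"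
    by (rule reflection_dvd_parabolic[OF prems(1,2) p(1)])
  define h where "h = inv g"
  have h: "h \<in> carrier W" "inv h = g" using g by (simp_all add: h_def)
  let ?c = "\<lambda>u. h \<otimes> u \<otimes> inv h"
  have cl: "lp (pre @ ks) \<in> carrier W" "lp rest \<in> carrier W" "s \<in> carrier W"
    using prems p g S_carrier lp_T_closed[of "pre @ ks"] by auto
  have "s \<otimes> lp rest = h \<otimes> (p \<otimes> lp (pre @ ks)) \<otimes> g"
    using g(7) prems(5) by (simp add: h_def)
  also have "\<dots> = (h \<otimes> p \<otimes> g) \<otimes> (h \<otimes> lp (pre @ ks) \<otimes> g)"
    using g(1) p(3) cl by (simp add: h_def m_assoc inv_cancel)
  finally have "s \<otimes> lp rest = s \<otimes> (h \<otimes> lp (pre @ ks) \<otimes> g)"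
    using g(6) by (simp add: h_def)
  then have "lp rest = h \<otimes> lp (pre @ ks) \<otimes> inv h"
    using cl g(1) h by (simp del: list_prod_Cons)
  also have "\<dots> = lp (map ?c (pre @ ks))"
    using h prems p lists_T_carrier by (intro list_prod_conj[symmetric]) auto
  finally have prod: "lp (map ?c pre @ map ?c ks) = lp rest" by simp
  have "\<exists>rs \<in> lists T. lp (?c t # rs) = lp (map ?c ks) \<and> length rs + 1 = length (map ?c ks)"
  proof (rule Suc.hyps(1)[OF _ g(4,3) _ _ prod])
    show "n = length (map ?c pre)" using pre0 by simp
    show "map ?c pre \<in> lists T" "map ?c ks \<in> lists T" using h p prems by (intro map_conj_T; simp)+
    show "length (map ?c pre) + length (map ?c ks) = length rest" using g prems by simp
    show "?c t \<in> T" using h prems by (intro T_conj)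
    show "root (?c t) \<in> span (root ` set (map ?c ks))" using h prems by (intro root_conj_span)
  qed
  then obtain rs where rs: "rs \<in> lists T" "lp (?c t # rs) = lp (map ?c ks)" "length rs + 1 = length ks"
    by auto
  let ?rs = "map (\<lambda>u. g \<otimes> u \<otimes> inv g) rs"
  have cl2: "lp ks \<in> carrier W" "t \<in> carrier W" "lp rs \<in> carrier W"
    using prems T_carrier lp_T_closed rs by auto
  have "lp (map ?c ks) = h \<otimes> lp ks \<otimes> inv h"
    using h prems lists_T_carrier by (intro list_prod_conj) auto
  then have e: "inv g \<otimes> t \<otimes> g \<otimes> lp rs = inv g \<otimes> lp ks \<otimes> g"
    using rs(2) by (simp add: h_def g(1))
  have "lp ks = g \<otimes> (inv g \<otimes> lp ks \<otimes> g) \<otimes> inv g" using g(1) cl2 by (simp add: m_assoc inv_cancel)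
  also have "\<dots> = t \<otimes> (g \<otimes> lp rs \<otimes> inv g)"
    unfolding e[symmetric] using g(1) cl2 by (simp add: m_assoc inv_cancel)
  also have "g \<otimes> lp rs \<otimes> inv g = lp ?rs"
    using g rs lists_T_carrier by (intro list_prod_conj[symmetric]) auto
  finally have "lp (t # ?rs) = lp ks" by simp
  moreover have "?rs \<in> lists T" using g rs by (intro map_conj_T) auto
  ultimately show ?case using rs by (intro bexI[of _ ?rs]) auto
qed

end

section \<open>Coxeter elements\<close>

locale coxeter_element = coxeter +
  fixes ss :: "'a list"
  assumes distinct_ss: "distinct ss" and set_ss: "set ss = S"
begin

abbreviation cx :: 'a where "cx \<equiv> lp ss"

lemma fpf_cx: "fpf cx"
  using fpf_coxeter distinct_ss set_ss .

lemma ss_S: "ss \<in> lists S"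
  using set_ss by auto

lemma length_ss: "length ss = card S"
  using distinct_card[OF distinct_ss] set_ss by simp

lemma cx_closed [simp]: "cx \<in> carrier W"
  using ss_S by simp

lemma ss_ne: "t \<in> T \<Longrightarrow> ss \<noteq> []"
  using set_ss by (auto simp: reflections_def)

subsection \<open>The reflection order\<close>

definition idx :: "'a \<Rightarrow> nat" where
  "idx t = (LEAST k. inv (prefix_prod ss k) \<otimes> t \<otimes> prefix_prod ss k = hd (rotate k ss))"

lemma idx:
  assumes "t \<in> T"
  shows "inv (prefix_prod ss (idx t)) \<otimes> t \<otimes> prefix_prod ss (idx t) = hd (rotate (idx t) ss)"
  unfolding idx_def
  by (rule LeastI_ex) (use reflection_reached(2)[OF ss_S distinct_ss assms] spt_root[OF assms] set_ss in auto)

lemma idx_inj: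
  assumes "t \<in> T" "t' \<in> T" "idx t = idx t'"
  shows "t = t'"
proof -
  define g where "g = prefix_prod ss (idx t)"
  have "g \<in> carrier W" using ss_S ss_ne[OF assms(1)] by (simp add: g_def)
  moreover have "inv g \<otimes> t \<otimes> g = inv g \<otimes> t' \<otimes> g" using idx[OF assms(1)] idx[OF assms(2)] assms(3) by (simp add: g_def)
  ultimately show ?thesis using assms T_carrier by (simp add: m_assoc)
qed

lemma act_root_before_idx:
  assumes "t \<in> T" "k \<le> idx t"
  defines "g \<equiv> inv (prefix_prod ss k)"
  shows "act g (root t) = root (g \<otimes> t \<otimes> inv g)"
proof -
  have "inv (prefix_prod ss i) \<otimes> t \<otimes> prefix_prod ss i \<noteq> hd (rotate i ss)" if "i < k" for i
    using not_less_Least[of i "\<lambda>k. inv (prefix_prod ss k) \<otimes> t \<otimes> prefix_prod ss k = hd (rotate k ss)"]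
      that assms(2) by (simp add: idx_def)
  then show ?thesis
    using act_prefix_prod_root[OF ss_S ss_ne[OF assms(1)] assms(1)] ss_S ss_ne[OF assms(1)] by (simp add: g_def)
qed

text \<open>The initial letter is orthogonal from the left to all later ones, so pairing with
  \<open>al s\<close> is the coordinate functional at \<open>s\<close>. Positivity of roots thus
  controls the sign of the form.\<close>

lemma seif_initial:
  assumes "distinct (s # rest)" "set (s # rest) = S" "spt S f"
  shows "seif (lp (s # rest)) (al s) f = f $ s"
proof -
  let ?c = "lp (s # rest)"
  have fpf: "fpf ?c" using assms by (intro fpf_coxeter)
  have S: "s \<in> S" "rest \<in> lists S" using assms by auto
  have len: "length rest + 1 = card S" using assms distinct_card[of "s # rest"] by simp
  have r: "seif ?c (al s) (al t) = (if t = s then 1 else 0)" if "t \<in> S" for t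
    using seif_root_self[OF fpf, of s] seif_root_orthogonal[OF fpf, of s "[]" rest t] that S S_T len assms lists_S_T[OF S(2)]
    by (auto simp: root_S)
  have lin: "linear (seif ?c (al s))" by (rule linearI) (simp_all add: seif_lin)
  have "seif ?c (al s) f = seif ?c (al s) (\<Sum>t\<in>S. f $ t *\<^sub>R al t)"
    using spt_expand[OF finite_S assms(3)] by simp
  also have "\<dots> = (\<Sum>t\<in>S. f $ t * seif ?c (al s) (al t))"
    by (simp only: linear_sum[OF lin] seif_lin)
  also have "\<dots> = (\<Sum>t\<in>S. if t = s then f $ s else 0)"
    by (intro sum.cong refl) (simp add: r del: list_prod_Cons)
  finally show ?thesis using S finite_S by simp
qed

text \<open>Distinct simple roots meet at non-acute angles, so all coordinates other than the one at
  \<open>s\<close> contribute at most zero.\<close>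

lemma bl_al_le:
  assumes "s \<in> S" "nng f"
  shows "bl (al s) f \<le> f $ s"
proof -
  have "cb s t \<le> 0" if "t \<in> S" "t \<noteq> s" for t
  proof -
    have "m s t \<ge> 2" using m_pos[of s t] m_neq_1[of s t] assms that by auto
    then have "0 \<le> pi / m s t" "pi / m s t \<le> pi / 2" using frac_le[of pi pi 2 "real (m s t)"] by simp_all
    then have "0 \<le> cos (pi / m s t)" using pi_ge_zero by (intro cos_ge_zero) linarith+
    then show ?thesis using that by (simp add: cb_def)
  qed
  then have "bl (al s) f \<le> (\<Sum>t\<in>S. if t = s then f $ s else 0)"
    unfolding bl_al_left[OF assms(1)] using assms(2)
    by (intro sum_mono) (auto simp: nng_def cb_def mult_nonneg_nonpos)
  then show ?thesis using assms finite_S by simp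
qed

lemma rotated_frame:
  assumes "t \<in> T"
  defines "g \<equiv> inv (prefix_prod ss (idx t))"
  obtains s rest where "g \<in> carrier W" "distinct (s # rest)" "set (s # rest) = S"
    "g \<otimes> cx \<otimes> inv g = lp (s # rest)" "g \<otimes> t \<otimes> inv g = s" "act g (root t) = al s"
proof -
  have P: "prefix_prod ss (idx t) \<in> carrier W" using ss_S ss_ne[OF assms(1)] by simp
  obtain s rest where sr: "rotate (idx t) ss = s # rest"
    using ss_ne[OF assms(1)] by (metis list.exhaust rotate_is_Nil_conv)
  have *: "set (s # rest) = S" "distinct (s # rest)"
    using sr distinct_ss set_ss by (metis set_rotate, metis distinct_rotate)
  show ?thesis
  proof (rule that[OF _ *(2,1)])
    show "g \<in> carrier W" using P by (simp add: g_def)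
    show "g \<otimes> cx \<otimes> inv g = lp (s # rest)"
      using prefix_prod_rotate[OF ss_S ss_ne[OF assms(1)], of "idx t"] P sr by (simp add: g_def)
    show gs: "g \<otimes> t \<otimes> inv g = s" using idx[OF assms(1)] P sr by (simp add: g_def)
    show "act g (root t) = al s"
      using act_root_before_idx[OF assms(1) order_refl] gs root_S[of s] * unfolding g_def by auto
  qed
qed

text \<open>In the frame where \<open>t\<close> is initial, the root \<open>f\<close> of
  \<open>t'\<close> is still positive. The two values are \<open>f $ s\<close> and
  \<open>2 * bl (al s) f - f $ s\<close>, and \<open>bl_al_le\<close> compares them.\<close>

lemma seif_idx_mono:
  assumes "t \<in> T" "t' \<in> T" "idx t \<le> idx t'"
  shows "seif cx (root t') (root t) \<le> seif cx (root t) (root t')"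
proof -
  define g where "g = inv (prefix_prod ss (idx t))"
  obtain s rest where g: "g \<in> carrier W" "distinct (s # rest)" "set (s # rest) = S"
    "g \<otimes> cx \<otimes> inv g = lp (s # rest)" "g \<otimes> t \<otimes> inv g = s" "act g (root t) = al s"
    using rotated_frame[OF assms(1)] unfolding g_def by metis
  define f where "f = act g (root t')"
  have "f = root (g \<otimes> t' \<otimes> inv g)"
    using act_root_before_idx[OF assms(2,3)] by (simp add: f_def g_def)
  then have f: "nng f" "spt S f" using T_conj[OF assms(2) g(1)] nng_root spt_root by auto
  have s: "s \<in> S" using g by auto
  have fpf: "fpf (lp (s # rest))" using fpf_conj[OF fpf_cx g(1)] g by simp
  have 1: "seif cx (root t) (root t') = f $ s"
    using seif_conj[OF fpf_cx g(1) spt_root[OF assms(1)], of "root t'"] g(4,6)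
      seif_initial[OF g(2,3) f(2)] by (simp add: f_def)
  have "seif cx (root t') (root t) = seif (lp (s # rest)) f (al s)"
    using seif_conj[OF fpf_cx g(1) spt_root[OF assms(2)], of "root t"] g(4,6) by (simp add: f_def)
  also have "\<dots> = 2 * bl (al s) f - f $ s"
    using seif_symmetrize[OF fpf f(2) spt_al[OF s]] seif_initial[OF g(2,3) f(2)] bl_sym[of f] by simp
  also have "\<dots> \<le> f $ s" using bl_al_le[OF s f(1)] by simp
  finally show ?thesis using 1 by simp
qed

text \<open>
  The core of the uniqueness of increasing factorizations: in the plane spanned by the roots
  \<open>\<alpha>, \<beta>\<close> of the increasing factorization starting at the initial reflection, the Seifert form has
  \<open>E(\<alpha>,\<alpha>) = E(\<beta>,\<beta>) = 1\<close>, \<open>E(\<alpha>,\<beta>) = 0\<close>, \<open>E(\<beta>,\<alpha>) = - k\<close>, and \<open>a \<alpha> + b \<beta>\<close>, \<open>a' \<alpha> + b' \<beta>\<close> are the roots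
  of another one.
\<close>

lemma plane_rigidity:
  fixes a b a' b' k :: real
  assumes nn: "0 \<le> a" "0 \<le> b" "0 \<le> a'" "0 \<le> b'" "0 \<le> k"
    and orth: "a * a' + b * b' - k * (b * a') = 0"
    and unit: "a' * a' + b' * b' - k * (a' * b') = 1"
    and orient: "0 \<le> k * (a * b' - a' * b)"
  shows "b = 0 \<or> b' = 0"
proof (cases "k = 0")
  case True
  then have "b * b' = 0" using orth nn by (simp add: add_nonneg_eq_0_iff)
  then show ?thesis by simp
next
  case False
  then have D: "0 \<le> a * b' - a' * b" using orient nn by (simp add: zero_le_mult_iff)
  \<comment> \<open>Inserting \<open>unit\<close> and eliminating \<open>b * b'\<close> by
    \<open>orth\<close> turns \<open>b\<close> into \<open>- a'\<close> times the determinant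
    \<open>a * b' - a' * b\<close>, which is nonnegative.\<close>
  have "b = b * (a' * a' + b' * b' - k * (a' * b'))" by (simp add: unit)
  also have "\<dots> = a' * (a' * b) + b' * (b * b' - k * (b * a'))" by (simp add: algebra_simps)
  also have "b * b' - k * (b * a') = - (a * a')" using orth by simp
  also have "a' * (a' * b) + b' * - (a * a') = - (a' * (a * b' - a' * b))" by (simp add: algebra_simps)
  also have "\<dots> \<le> 0" using D nn by simp
  finally show ?thesis using nn by simp
qed

text \<open>All four reflections have index at least \<open>idx x\<close>, so in the frame of
  \<open>x\<close> their roots are nonnegative and \<open>plane_rigidity\<close> applies. A
  vanishing coefficient means \<open>x' = x\<close> or \<open>y' = x\<close>; the indices exclude
  the latter.\<close>

lemma increasing_unique_aux:
  assumes T: "x \<in> T" "y \<in> T" "x' \<in> T" "y' \<in> T" "rs \<in> lists T"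
    and eq: "x \<otimes> y = x' \<otimes> y'" and c: "lp (x # y # rs) = cx" and len: "length rs + 2 = card S"
    and inc: "idx x < idx y" "idx x' < idx y'" "idx x \<le> idx x'"
  shows "x = x'"
proof -
  define g where "g = inv (prefix_prod ss (idx x))"
  obtain s rest where g: "g \<in> carrier W" "distinct (s # rest)" "set (s # rest) = S"
    "g \<otimes> cx \<otimes> inv g = lp (s # rest)" "g \<otimes> x \<otimes> inv g = s" "act g (root x) = al s"
    using rotated_frame[OF T(1)] unfolding g_def by metis
  have s: "s \<in> S" using g by auto
  have pos: "nng (act g (root z))" "spt S (act g (root z))" if "z \<in> T" "idx x \<le> idx z" for z
    using act_root_before_idx[OF that] T_conj[OF that(1) g(1)] nng_root spt_root by (simp_all add: g_def)
  let ?E = "seif (g \<otimes> cx \<otimes> inv g)"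
  have E: "?E (act g (root z)) (act g (root z')) = seif cx (root z) (root z')" if "z \<in> T" for z z'
    using seif_conj[OF fpf_cx g(1) spt_root[OF that]] .
  have cl: "lp rs \<in> carrier W" "x \<in> carrier W" "y \<in> carrier W" "x' \<in> carrier W" "y' \<in> carrier W"
    using T T_carrier lp_T_closed by auto
  have c': "lp (x' # y' # rs) = cx" using c eq cl by (simp flip: m_assoc)
  define f where "f = act g (root y)"
  define u where "u = act g (root x')"
  define v where "v = act g (root y')"
  have f: "nng f" "spt S f" "f \<noteq> 0" "?E f f = 1"
    using pos[OF T(2)] inc E[OF T(2)] seif_root_self[OF fpf_cx T(2)] root_nz[OF T(2)] act_inv(1)[OF g(1), of "root y"]
    by (auto simp: f_def)
  have u: "nng u" "spt S u" "?E u u = 1" "?E (al s) (al s) = 1"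
    using pos[OF T(3)] inc E[OF T(3)] seif_root_self[OF fpf_cx T(3)]
      E[OF T(1), of x] seif_root_self[OF fpf_cx T(1)] g(6) by (auto simp: u_def)
  have v: "nng v" "spt S v" "?E v v = 1"
    using pos[OF T(4)] inc E[OF T(4)] seif_root_self[OF fpf_cx T(4)] by (auto simp: v_def)
  have "seif cx (root x) (root y) = 0" "seif cx (root x') (root y') = 0"
    using seif_root_orthogonal[OF fpf_cx T(1), of "[]" "y # rs" y]
      seif_root_orthogonal[OF fpf_cx T(3), of "[]" "y' # rs" y'] T c c' len by auto
  then have sf: "?E (al s) f = 0" and uv: "?E u v = 0"
    using E[OF T(1), of y] E[OF T(3), of y'] g(6) by (simp_all add: f_def u_def v_def)
  define k where "k = - ?E f (al s)"
  have k: "k \<ge> 0"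
    using seif_idx_mono[OF T(1,2)] inc(1) sf E[OF T(1), of y] E[OF T(2), of x] g(6) by (simp add: f_def k_def)
  have vu: "?E v u \<le> 0"
    using seif_idx_mono[OF T(3,4)] inc(2) uv E[OF T(3), of y'] E[OF T(4), of x'] by (simp add: u_def v_def)
  have fs: "f $ s = 0"
    using seif_initial[OF g(2,3) f(2)] sf g(4) by simp
  have "act g (root z) \<in> span {al s, f}" if "z \<in> {x', y'}" for z
  proof -
    have "root z \<in> span (root ` set [x, y])"
      by (rule block_roots_span[OF fpf_cx, of "[]" "[x', y']" rs]) (use T c' len that eq cl in auto)
    then have "act g (root z) \<in> act g ` span (root ` set [x, y])" by blast
    then show ?thesis by (simp add: linear_span_image[OF linear_act, symmetric] g(6) f_def)
  qed
  then obtain a b a' b' where ab: "u = a *\<^sub>R al s + b *\<^sub>R f" "v = a' *\<^sub>R al s + b' *\<^sub>R f"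
    by (force simp: u_def v_def span_insert span_singleton algebra_simps)
  \<comment> \<open>As \<open>f\<close> vanishes at \<open>s\<close>, the coordinates at
    \<open>s\<close> and \<open>r\<close> separate the two coefficients of a vector in the plane, so
    both inherit its nonnegativity.\<close>
  obtain r where r: "f $ r > 0" "r \<noteq> s"
  proof -
    obtain r where "f $ r \<noteq> 0" using f by (auto simp: rvec_eq_iff)
    then have "f $ r > 0" using f(1) by (metis nng_def order_le_less)
    then show ?thesis using that fs by fastforce
  qed
  have coef: "0 \<le> p \<and> 0 \<le> q" if "nng (p *\<^sub>R al s + q *\<^sub>R f)" for p q
  proof -
    have "0 \<le> (p *\<^sub>R al s + q *\<^sub>R f) $ s" "0 \<le> (p *\<^sub>R al s + q *\<^sub>R f) $ r"
      using that unfolding nng_def by blast+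
    then show ?thesis using fs r by (simp add: al_def zero_le_mult_iff)
  qed
  have nn: "0 \<le> a" "0 \<le> b" "0 \<le> a'" "0 \<le> b'" using coef u(1) v(1) ab by auto
  have Eab: "?E (p *\<^sub>R al s + q *\<^sub>R f) (p' *\<^sub>R al s + q' *\<^sub>R f) = p * p' + q * q' - k * (q * p')" for p q p' q'
    by (simp add: seif_lin sf f(4) u(4) k_def algebra_simps)
  have "b = 0 \<or> b' = 0"
  proof (rule plane_rigidity[OF nn k])
    show "a * a' + b * b' - k * (b * a') = 0" using uv Eab ab by simp
    show "a' * a' + b' * b' - k * (a' * b') = 1" using v(3) Eab ab by (simp add: mult.commute)
    have "?E v u = a' * a + b' * b - k * (b' * a)" "?E u v = a * a' + b * b' - k * (b * a')"
      by (simp_all only: ab Eab)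
    then show "0 \<le> k * (a * b' - a' * b)" using vu uv by (simp add: algebra_simps)
  qed
  moreover have "z = x" if "act g (root z) = p *\<^sub>R al s" "z \<in> T" for z p
  proof -
    have "act g (root z) = act g (p *\<^sub>R root x)" using that g(6) by (simp add: act_lin)
    then have "root z = p *\<^sub>R root x" using g(1) by (metis act_inv(1))
    then show ?thesis using root_proportional T that by blast
  qed
  ultimately consider "x' = x" | "y' = x" using ab T by (auto simp: u_def v_def)
  then show ?thesis using inc by cases auto
qed

lemma increasing_unique:
  assumes "x \<in> T" "y \<in> T" "x' \<in> T" "y' \<in> T" "rs \<in> lists T"
    and "x \<otimes> y = x' \<otimes> y'" "lp (x # y # rs) = cx" "length rs + 2 = card S"
    and "idx x < idx y" "idx x' < idx y'"
  shows "x = x'"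
proof (cases "idx x \<le> idx x'")
  case True
  then show ?thesis using increasing_unique_aux[of x y x' y' rs] assms by simp
next
  case False
  have "lp (x' # y' # rs) = cx"
    using assms T_carrier lp_T_closed by (simp flip: m_assoc del: in_lists_conv_set)
  then show ?thesis using increasing_unique_aux[of x' y' x y rs] assms False by simp
qed

subsection \<open>Noncrossing words\<close>

definition ncw :: "'a list \<Rightarrow> bool" where
  "ncw ts \<longleftrightarrow> ts \<in> lists T \<and> (\<exists>rs\<in>lists T. lp (ts @ rs) = cx \<and> length ts + length rs = card S)"

lemma ncw_T: "ncw ts \<Longrightarrow> ts \<in> lists T"
  by (simp add: ncw_def)

lemma ncw_Nil [simp]: "ncw []"
  using lists_S_T[OF ss_S] length_ss by (auto simp: ncw_def)

lemma ncw_prefix: "ncw (a @ b) \<Longrightarrow> ncw a"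
  unfolding ncw_def by (metis append.assoc append_in_lists_conv length_append add.assoc)

lemma ncw_hurwitz:
  assumes "ncw (A @ t # C)"
  shows "ncw (t # map (\<lambda>u. conj_by W u t) A @ C)"
proof -
  have T: "A \<in> lists T" "t \<in> T" "C \<in> lists T" using ncw_T[OF assms] by auto
  obtain rs where rs: "rs \<in> lists T" "lp ((A @ t # C) @ rs) = cx" "length (A @ t # C) + length rs = card S"
    using assms by (auto simp: ncw_def)
  have "lp (A @ t # (C @ rs)) = lp (t # map (\<lambda>u. conj_by W u t) A @ (C @ rs))"
    using T rs lists_T_carrier T_carrier by (intro list_prod_hurwitz) auto
  moreover have "map (\<lambda>u. conj_by W u t) A \<in> lists T" using T map_conj_by_T by blast
  ultimately show ?thesis unfolding ncw_def using rs T by (intro conjI bexI[of _ rs]) auto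
qed

text \<open>The deleted first letter reappears, conjugated, at the end of the complementary
  word.\<close>

lemma ncw_tl:
  assumes "ncw (t # ts)"
  shows "ncw ts"
proof -
  have T: "t \<in> T" "ts \<in> lists T" using ncw_T[OF assms] by auto
  obtain rs where rs: "rs \<in> lists T" "lp (t # ts @ rs) = cx" "length ts + length rs + 1 = card S"
    using assms by (auto simp: ncw_def)
  define q where "q = inv (lp (ts @ rs)) \<otimes> t \<otimes> lp (ts @ rs)"
  have cl: "lp (ts @ rs) \<in> carrier W" "t \<in> carrier W" using T rs lp_T_closed[of "ts @ rs"] T_carrier by auto
  have q: "q \<in> T" using T_conj'[OF T(1) cl(1)] by (simp add: q_def)
  have "lp (ts @ rs @ [q]) = lp (ts @ rs) \<otimes> q"
    using lp_T_append[of "ts @ rs" "[q]"] T rs q T_carrier by simp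
  also have "\<dots> = cx" using cl rs by (simp add: q_def m_assoc inv_cancel)
  finally show ?thesis unfolding ncw_def using T rs q by (intro conjI bexI[of _ "rs @ [q]"]) auto
qed

lemma ncw_suffix: "ncw (a @ b) \<Longrightarrow> ncw b"
  by (induction a) (auto dest: ncw_tl)

lemma ncw_infix: "ncw (a @ b @ d) \<Longrightarrow> ncw b"
  using ncw_suffix ncw_prefix by blast

lemma ncw_replace:
  assumes "ncw (a @ xs @ b)" "ys \<in> lists T" "lp ys = lp xs" "length ys = length xs"
  shows "ncw (a @ ys @ b)"
proof -
  have T: "a \<in> lists T" "xs \<in> lists T" "b \<in> lists T" using ncw_T[OF assms(1)] by auto
  obtain rs where rs: "rs \<in> lists T" "lp ((a @ xs @ b) @ rs) = cx" "length (a @ xs @ b) + length rs = card S"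
    using assms by (auto simp: ncw_def)
  have "lp (a @ ys @ b @ rs) = lp (a @ xs @ b @ rs)"
    using T rs(1) assms lp_T_append[of a "xs @ b @ rs"] lp_T_append[of xs "b @ rs"]
      lp_T_append[of a "ys @ b @ rs"] lp_T_append[of ys "b @ rs"] by simp
  then show ?thesis unfolding ncw_def using rs T assms by (intro conjI bexI[of _ rs]) auto
qed

text \<open>Cancelling the square would factor \<open>cx\<close> into fewer than
  \<open>card S\<close> reflections.\<close>

lemma ncw_no_square: "\<not> ncw (a @ [t, t] @ b)"
proof
  assume *: "ncw (a @ [t, t] @ b)"
  then have T: "a \<in> lists T" "t \<in> T" "b \<in> lists T" using ncw_T[OF *] by auto
  obtain rs where rs: "rs \<in> lists T" "lp ((a @ [t, t] @ b) @ rs) = cx" "length (a @ [t, t] @ b) + length rs = card S"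
    using * by (auto simp: ncw_def)
  have "lp (a @ b @ rs) = cx"
    using rs T T_cancel[of t "lp (b @ rs)"] lp_T_closed[of "b @ rs"] lp_T_append[of a "b @ rs"]
      lp_T_append[of a "t # t # b @ rs"] by simp
  moreover have "a @ b @ rs \<in> lists T" using T rs by auto
  ultimately have "card S \<le> length (a @ b @ rs)" using fpf_length fpf_cx by blast
  then show False using rs by simp
qed

lemma ncw_suffix_reflection:
  assumes "ncw xs" "ks \<in> lists T" "lp (xs @ ks) = cx" "length xs + length ks = card S" "t \<in> T"
    "root t \<in> span (root ` set ks)"
  shows "ncw (xs @ [t])"
proof -
  have xs: "xs \<in> lists T" using assms ncw_T by blast
  obtain rs where rs: "rs \<in> lists T" "lp (t # rs) = lp ks" "length rs + 1 = length ks"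
    using reflection_in_suffix_span[of ss xs ks t] assms xs distinct_ss ss_S length_ss by auto
  have "lp (xs @ t # rs) = cx"
    using assms rs xs lp_T_append[of xs "t # rs"] lp_T_append[of xs ks] by simp
  then show ?thesis unfolding ncw_def using rs xs assms by (intro conjI bexI[of _ rs]) auto
qed

text \<open>The complement of the empty word is \<open>ss\<close>, whose roots span all
  roots.\<close>

lemma ncw_single:
  assumes "t \<in> T"
  shows "ncw [t]"
proof -
  have "root t = (\<Sum>s\<in>S. root t $ s *\<^sub>R al s)" using spt_expand[OF finite_S spt_root[OF assms]] .
  also have "\<dots> \<in> span (root ` set ss)"
    using root_S set_ss by (intro span_sum span_scale span_base) (metis image_eqI)
  finally show ?thesis
    using ncw_suffix_reflection[of "[]" ss t] lists_S_T[OF ss_S] length_ss assms by simp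
qed

text \<open>
  Two distinct coatoms of an element below a common element of the noncrossing partition lattice
  have their join below it as well; this is the only trace of the lattice property that is needed.
\<close>

lemma ncw_join:
  assumes xzs: "ncw (x # zs)" and eq: "lp (x # zs) = lp (x' # zs')" and len: "length zs = length zs'"
    and T': "x' \<in> T" "zs' \<in> lists T" and z: "ncw (zs @ [t])" and z': "ncw (zs' @ [t])" and ne: "x \<noteq> x'"
  shows "ncw (x # zs @ [t])"
proof -
  have T: "x \<in> T" "zs \<in> lists T" "t \<in> T" using ncw_T[OF xzs] ncw_T[OF z] by auto
  obtain ks where ks: "ks \<in> lists T" "lp ((x # zs) @ ks) = cx" "length (x # zs) + length ks = card S"
    using xzs by (auto simp: ncw_def)
  have cl: "x \<in> carrier W" "x' \<in> carrier W" "lp zs \<in> carrier W" "lp zs' \<in> carrier W" "lp ks \<in> carrier W" "t \<in> carrier W"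
    using T T' ks T_carrier lp_T_closed by auto
  define w where "w = lp (x # zs)"
  have w: "w \<in> carrier W" "w = x \<otimes> lp zs" "w = x' \<otimes> lp zs'"
    using cl eq by (simp_all add: w_def)
  have w4: "w \<otimes> lp ks = cx"
    using ks(1,2) lp_T_append[OF ncw_T[OF xzs] ks(1)] by (simp only: w_def)
  \<comment> \<open>If \<open>w = y us\<close> then \<open>w = us (q y)\<close>: the first letter is
    moved behind \<open>us\<close>. So \<open>q x\<close> and \<open>q x'\<close> are the
    reflections that extend the coatoms \<open>zs\<close> and \<open>zs'\<close> to
    \<open>w\<close>.\<close>
  define q where "q y = inv w \<otimes> y \<otimes> w" for y
  have q: "q y \<in> T" "lp us \<otimes> q y = w" if "y \<in> T" "us \<in> lists T" "w = y \<otimes> lp us" for y us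
  proof -
    have y: "y \<in> carrier W" "lp us \<in> carrier W" using that T_carrier lp_T_closed by auto
    show "q y \<in> T" using that w T_conj' by (simp add: q_def)
    have "lp us = y \<otimes> w" using T_cancel[OF that(1) y(2)] that(3) by simp
    then show "lp us \<otimes> q y = w"
      using y w(1) T_cancel[OF that(1) w(1)] T_inv[OF that(1)] by (simp add: q_def m_assoc inv_cancel)
  qed
  have main: "root t \<in> span (root ` set (q y # ks))" "\<And>k. k \<in> set ks \<Longrightarrow> seif cx (root (q y)) (root k) = 0"
    if us: "y \<in> T" "us \<in> lists T" "w = y \<otimes> lp us" "ncw (us @ [t])" "length us = length zs" for y us
  proof -
    note qy = q[OF us(1-3)]
    have qyc: "q y \<in> carrier W" "lp us \<in> carrier W" using qy T_carrier us lp_T_closed by auto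
    have c: "lp (us @ q y # ks) = cx"
      using us ks qy qyc cl w4 lp_T_append[of us "q y # ks"] by (simp flip: m_assoc)
    obtain rs where rs: "rs \<in> lists T" "lp ((us @ [t]) @ rs) = cx" "length (us @ [t]) + length rs = card S"
      using us(4) by (auto simp: ncw_def)
    have "lp us \<otimes> lp (q y # ks) = lp us \<otimes> lp (t # rs)"
      using c rs us T qy ks lp_T_append[of us "q y # ks"] lp_T_append[of us "t # rs"] by simp
    then have "lp (q y # ks) = lp (t # rs)"
      using qyc cl rs lp_T_closed[of rs] by (simp del: list_prod_Cons add: lp_T_closed qy ks T)
    then show "root t \<in> span (root ` set (q y # ks))"
      using block_roots_span[OF fpf_cx us(2), of "t # rs" "[]" "q y # ks" t] rs T qy ks by simp
    show "seif cx (root (q y)) (root k) = 0" if "k \<in> set ks" for k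
      using seif_root_orthogonal[OF fpf_cx qy(1) us(2) ks(1) c[symmetric] _ that] ks us(5) by simp
  qed
  note m1 = main[OF T(1,2) w(2) z refl]
  note m2 = main[OF T' w(3) z' len[symmetric]]
  have qT: "q x \<in> T" "q x' \<in> T" using q[OF T(1,2) w(2)] q[OF T' w(3)] by auto
  let ?K = "span (root ` set ks)"
  obtain a where a: "root t - a *\<^sub>R root (q x) \<in> ?K" using m1(1) by (auto simp: span_insert)
  obtain a' where a': "root t - a' *\<^sub>R root (q x') \<in> ?K" using m2(1) by (auto simp: span_insert)
  \<comment> \<open>Both multiples agree with \<open>root t\<close> modulo \<open>?K\<close>, so
    \<open>d\<close> lies in \<open>?K\<close>. The roots of \<open>q x\<close> and
    \<open>q x'\<close> are left orthogonal to \<open>?K\<close>, hence so is \<open>d\<close>; thus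
    \<open>seif cx d d = 0\<close> and definiteness gives \<open>d = 0\<close>. A nonzero
    \<open>a\<close> would then force \<open>q x = q x'\<close>.\<close>
  define d where "d = a *\<^sub>R root (q x) + (- a') *\<^sub>R root (q x')"
  have "d = (root t - a' *\<^sub>R root (q x')) - (root t - a *\<^sub>R root (q x))" by (simp add: d_def)
  then have dK: "d \<in> ?K" using span_diff[OF a' a] by simp
  have "seif cx d f = 0" if "f \<in> ?K" for f
    using that
  proof (induction f rule: span_induct)
    case base
    show ?case by (auto simp: subspace_def seif_lin) (simp add: seif_def)
  next
    case (step k)
    moreover have "seif cx d k = a * seif cx (root (q x)) k + - a' * seif cx (root (q x')) k"
      unfolding d_def by (simp only: seif_lin)
    ultimately show ?case using m1(2) m2(2) by auto
  qed
  then have "seif cx d d = 0" using dK by blast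
  moreover have spt_d: "spt S d" unfolding d_def using qT spt_root by (intro spt_add spt_scale) auto
  ultimately have "d = 0" using seif_symmetrize[OF fpf_cx spt_d spt_d] bl_eq_0 by simp
  have "a = 0"
  proof (rule ccontr)
    assume "a \<noteq> 0"
    have "a *\<^sub>R root (q x) = a' *\<^sub>R root (q x')" using \<open>d = 0\<close> by (simp add: d_def)
    then have "root (q x) = (a' / a) *\<^sub>R root (q x')"
      using \<open>a \<noteq> 0\<close> by (simp add: rvec_eq_iff field_simps)
    then have "q x = q x'" using root_proportional qT by blast
    then show False using ne w(1) cl by (simp add: q_def m_assoc)
  qed
  then have "root t \<in> ?K" using a by simp
  then show ?thesis using ncw_suffix_reflection[OF xzs ks(1,2,3) T(3)] by simp
qed

subsection \<open>Reflection length and the absolute order\<close>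

lemma refl_length_le: "ts \<in> lists T \<Longrightarrow> refl_length W S (lp ts) \<le> length ts"
  unfolding refl_length_def by (rule Least_le) auto

lemma refl_length_word:
  assumes "w \<in> carrier W"
  obtains ts where "ts \<in> lists T" "lp ts = w" "length ts = refl_length W S w"
proof -
  have "\<exists>k. \<exists>ts\<in>lists T. length ts = k \<and> lp ts = w" using word_exists[OF assms] lists_S_T by blast
  then have "\<exists>ts\<in>lists T. length ts = refl_length W S w \<and> lp ts = w"
    unfolding refl_length_def by (rule LeastI_ex)
  then show ?thesis using that by blast
qed

lemma refl_length_cx: "refl_length W S cx = card S"
proof (rule antisym)
  show "refl_length W S cx \<le> card S" using refl_length_le[OF lists_S_T[OF ss_S]] length_ss by simp
  show "card S \<le> refl_length W S cx" using refl_length_word[OF cx_closed] fpf_length[OF fpf_cx] by metis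
qed

text \<open>Links \<open>ncw\<close> to the absolute order. Shortest words of \<open>w\<close> and
  of its complement have at least \<open>card S\<close> letters together by
  \<open>fpf_length\<close>, so two words with exactly that total are already shortest.\<close>

lemma ncw_iff_Rex: "ncw ts \<and> lp ts = w \<and> length ts = k \<longleftrightarrow> w \<in> nc_level W S cx k \<and> ts \<in> Rex W S w"
proof
  assume *: "ncw ts \<and> lp ts = w \<and> length ts = k"
  then obtain rs where rs: "rs \<in> lists T" "lp (ts @ rs) = cx" "length ts + length rs = card S"
    by (auto simp: ncw_def)
  have ts: "ts \<in> lists T" and cl: "w \<in> carrier W" using * ncw_T lp_T_closed by auto
  have e: "inv w \<otimes> cx = lp rs"
    using rs ts * cl lp_T_append[of ts rs] lp_T_closed[of rs] by (metis inv_cancel(1))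
  obtain us where us: "us \<in> lists T" "lp us = w" "length us = refl_length W S w" using refl_length_word cl by blast
  obtain vs where vs: "vs \<in> lists T" "lp vs = lp rs" "length vs = refl_length W S (lp rs)"
    using refl_length_word[of "lp rs"] lp_T_closed rs by blast
  have "lp (us @ vs) = cx" using us vs * rs ts lp_T_append by simp
  then have "card S \<le> length (us @ vs)" using us vs by (intro fpf_length[OF fpf_cx]) auto
  then have "refl_length W S w = length ts" "refl_length W S (lp rs) = length rs"
    using refl_length_le[OF ts] refl_length_le[OF rs(1)] us vs rs * by auto
  then show "w \<in> nc_level W S cx k \<and> ts \<in> Rex W S w"
    using * ts cl rs e by (simp add: nc_level_def Rex_def abs_le_def refl_length_cx)
next
  assume *: "w \<in> nc_level W S cx k \<and> ts \<in> Rex W S w"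
  then have w: "w \<in> carrier W" "ts \<in> lists T" "lp ts = w" "length ts = k"
    "card S = k + refl_length W S (inv w \<otimes> cx)"
    by (auto simp: nc_level_def Rex_def abs_le_def refl_length_cx)
  obtain rs where rs: "rs \<in> lists T" "lp rs = inv w \<otimes> cx" "length rs = refl_length W S (inv w \<otimes> cx)"
    using refl_length_word[of "inv w \<otimes> cx"] w by auto
  have "lp (ts @ rs) = cx" using w rs lp_T_append[of ts rs] inv_cancel(2)[of w cx] by simp
  then show "ncw ts \<and> lp ts = w \<and> length ts = k" unfolding ncw_def using w rs by auto
qed

lemma T_odd_word:
  assumes "t \<in> T"
  obtains u where "u \<in> lists S" "lp u = t" "odd (length u)"
proof -
  obtain w s where ws: "w \<in> carrier W" "s \<in> S" "t = w \<otimes> s \<otimes> inv w" using assms T_cases by blast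
  obtain u where u: "u \<in> lists S" "w = lp u" using carrier_word ws by blast
  have "rev u \<in> lists S" using u by auto
  then have "lp (u @ [s] @ rev u) = t"
    using u ws S_carrier lp_S_append[of u "[s] @ rev u"] lp_rev[OF u(1)] lp_S_closed[OF u(1)]
    by (simp add: m_assoc subsetD)
  then show ?thesis using u ws by (intro that[of "u @ [s] @ rev u"]) auto
qed

text \<open>The point is that \<open>t1 t2\<close> has reflection length exactly 2: length 0 would
  make the letters equal, and length 1 is excluded by parity.\<close>

lemma ncw_pair_iff:
  assumes "t1 \<in> T" "t2 \<in> T" "t1 \<noteq> t2"
  shows "ncw [t1, t2] \<longleftrightarrow> abs_le W S (t1 \<otimes> t2) cx"
proof -
  define w where "w = t1 \<otimes> t2"
  have cl: "t1 \<in> carrier W" "t2 \<in> carrier W" "w \<in> carrier W" using assms T_carrier by (auto simp: w_def)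
  have lp2: "lp [t1, t2] = w" using cl by (simp add: w_def)
  have le2: "refl_length W S w \<le> 2" using refl_length_le[of "[t1, t2]"] lp2 assms by simp
  obtain ts where ts: "ts \<in> lists T" "lp ts = w" "length ts = refl_length W S w" using refl_length_word cl by blast
  have "ts \<noteq> []"
  proof
    assume "ts = []"
    then have "t1 \<otimes> t2 = \<one>" using ts by (simp add: w_def)
    then show False using assms cl T_inv by (metis inv_equality)
  qed
  moreover have "ts \<noteq> [t]" for t
  proof
    assume "ts = [t]"
    then have t: "t \<in> T" "t = t1 \<otimes> t2" using ts T_carrier by (auto simp: w_def)
    obtain u where u: "u \<in> lists S" "lp u = t" "odd (length u)" using T_odd_word t by blast
    obtain u1 where u1: "u1 \<in> lists S" "lp u1 = t1" "odd (length u1)" using T_odd_word assms by blast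
    obtain u2 where u2: "u2 \<in> lists S" "lp u2 = t2" "odd (length u2)" using T_odd_word assms by blast
    have "lp (u1 @ u2) = lp u" using u u1 u2 t lp_S_append by simp
    then show False using length_parity[of "u1 @ u2" u] u u1 u2 by auto
  qed
  ultimately have rl: "refl_length W S w = 2" using le2 ts
    by (cases ts; cases "tl ts") auto
  have "[t1, t2] \<in> Rex W S w" using assms lp2 rl by (simp add: Rex_def)
  then show ?thesis
    using ncw_iff_Rex[of "[t1, t2]" w 2] lp2 rl cl by (auto simp: nc_level_def w_def)
qed

end

section \<open>The noncrossing algebra\<close>

subsection \<open>Free algebras\<close>

lemma free_algebra_carrier_iff:
  "p \<in> carrier (free_algebra V) \<longleftrightarrow> (\<forall>u \<in> Poly_Mapping.keys p. letters u \<in> lists V)"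
  by (simp add: free_algebra_def)

lemma word_monom_carrier_iff [simp]: "word_monom xs \<in> carrier (free_algebra V) \<longleftrightarrow> xs \<in> lists V"
  by (simp add: free_algebra_carrier_iff word_monom_def)

lemma word_monom_mult: "word_monom xs * word_monom ys = word_monom (xs @ ys)"
  by (simp add: word_monom_def mult_single plus_free_mon_def)

lemma word_monom_Nil: "word_monom [] = 1"
  by (simp add: word_monom_def zero_free_mon_def flip: single_one)

lemma word_monom_frag: "word_monom xs = frag_of (Word xs)"
  by (simp add: word_monom_def)

lemma lookup_word_monom: "Poly_Mapping.lookup (word_monom xs) u = (if letters u = xs then 1 else 0)"
  by (cases u) (auto simp: word_monom_def lookup_single when_def)

lemma free_algebra_induct [consumes 1, case_names zero word diff]:
  assumes "p \<in> carrier (free_algebra V)" "P 0" "\<And>xs. xs \<in> lists V \<Longrightarrow> P (word_monom xs)"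
    "\<And>p q. P p \<Longrightarrow> P q \<Longrightarrow> P (p - q)"
  shows "P p"
proof (rule frag_induction[where S = "{u. letters u \<in> lists V}" and P = P])
  show "Poly_Mapping.keys p \<subseteq> {u. letters u \<in> lists V}"
    using assms(1) by (auto simp: free_algebra_carrier_iff)
  show "P (frag_of u)" if "u \<in> {u. letters u \<in> lists V}" for u
    using assms(3)[of "letters u"] that by (simp add: word_monom_frag)
qed (use assms in auto)

lemma free_algebra_add: "\<lbrakk>p \<in> carrier (free_algebra V); q \<in> carrier (free_algebra V)\<rbrakk> \<Longrightarrow> p + q \<in> carrier (free_algebra V)"
  using abelian_groupE(1)[OF ring.is_abelian_group[OF ring_free_algebra]] by fastforce

lemma free_algebra_mult: "\<lbrakk>p \<in> carrier (free_algebra V); q \<in> carrier (free_algebra V)\<rbrakk> \<Longrightarrow> p * q \<in> carrier (free_algebra V)"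
  using monoid.m_closed[OF ring.is_monoid[OF ring_free_algebra]] by fastforce

lemma free_algebra_uminus: "p \<in> carrier (free_algebra V) \<Longrightarrow> - p \<in> carrier (free_algebra V)"
  by (simp add: free_algebra_carrier_iff in_keys_iff)

lemma free_algebra_diff: "\<lbrakk>p \<in> carrier (free_algebra V); q \<in> carrier (free_algebra V)\<rbrakk> \<Longrightarrow> p - q \<in> carrier (free_algebra V)"
  using free_algebra_add[of p V "- q"] free_algebra_uminus by auto

lemma free_algebra_zero [simp]: "0 \<in> carrier (free_algebra V)"
  by (simp add: free_algebra_carrier_iff)

lemma free_algebra_cmul: "p \<in> carrier (free_algebra V) \<Longrightarrow> frag_cmul k p \<in> carrier (free_algebra V)"
  by (auto simp: free_algebra_carrier_iff)

lemma free_algebra_sum: "(\<And>i. i \<in> J \<Longrightarrow> f i \<in> carrier (free_algebra V)) \<Longrightarrow> sum f J \<in> carrier (free_algebra V)"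
  by (induction J rule: infinite_finite_induct) (auto intro: free_algebra_add)

lemma free_algebra_a_inv: "p \<in> carrier (free_algebra V) \<Longrightarrow> \<ominus>\<^bsub>free_algebra V\<^esub> p = - p"
proof -
  assume p: "p \<in> carrier (free_algebra V)"
  interpret F: ring "free_algebra V" by (rule ring_free_algebra)
  show ?thesis by (rule F.minus_equality) (use p free_algebra_uminus in auto)
qed

lemma free_algebra_minus:
  "\<lbrakk>p \<in> carrier (free_algebra V); q \<in> carrier (free_algebra V)\<rbrakk> \<Longrightarrow> p \<ominus>\<^bsub>free_algebra V\<^esub> q = p - q"
  by (simp add: a_minus_def free_algebra_a_inv)

lemma frag_cmul_diff: "frag_cmul k (p - q) = frag_cmul k p - frag_cmul k q"
  using frag_cmul_distrib2[of k p "- q"] by (simp add: poly_mapping_eqI lookup_minus lookup_add)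

lemma frag_cmul_mult_right:
  fixes p q :: "'a :: monoid_add \<Rightarrow>\<^sub>0 int"
  shows "p * frag_cmul k q = frag_cmul k (p * q)"
proof -
  have single: "frag_cmul k (frag_of x) = Poly_Mapping.single x k" for x :: 'a
    by (rule poly_mapping_eqI) (simp add: lookup_single when_def)
  have 1: "frag_cmul k r = Poly_Mapping.single 0 k * r" for r :: "'a \<Rightarrow>\<^sub>0 int"
    by (rule frag_induction[where S = UNIV and c = r])
      (auto simp: single mult_single frag_cmul_diff right_diff_distrib)
  have 2: "Poly_Mapping.single 0 k * r = r * Poly_Mapping.single 0 k" for r :: "'a \<Rightarrow>\<^sub>0 int"
    by (rule frag_induction[where S = UNIV and c = r])
      (auto simp: mult_single left_diff_distrib right_diff_distrib)
  show "p * frag_cmul k q = frag_cmul k (p * q)" by (metis 1 2 mult.assoc)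
qed

context coxeter_element
begin

section \<open>The ideal of relations and words that are not noncrossing\<close>

abbreviation "FA \<equiv> free_algebra T"
abbreviation "RL \<equiv> nc_relations W S cx"
abbreviation "ID \<equiv> Idl\<^bsub>FA\<^esub> RL"
abbreviation "NA \<equiv> nc_algebra W S cx"

text \<open>As reflections are involutions, \<open>x \<in> fac w\<close> iff \<open>w = x y\<close> for the reflections \<open>x\<close> and \<open>y = x w\<close>.\<close>

definition fac :: "'a \<Rightarrow> 'a set" where
  "fac w = {x \<in> T. x \<otimes> w \<in> T}"

lemma finite_fac [simp]: "finite (fac w)"
  using finite_T by (simp add: fac_def)

lemma facD: "x \<in> fac w \<Longrightarrow> x \<in> T" "x \<in> fac w \<Longrightarrow> x \<otimes> w \<in> T"
  by (auto simp: fac_def)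

lemma lp_fac: "w \<in> carrier W \<Longrightarrow> x \<in> fac w \<Longrightarrow> lp [x, x \<otimes> w] = w"
  using T_cancel T_carrier facD by (metis list_prod_Cons list_prod_Nil r_one)

text \<open>The Hurwitz move from \<open>x y\<close> to \<open>y x^y\<close>, read on first letters.
  As a permutation of \<open>fac w\<close> it makes the sums in \<open>D_rel2\<close> and
  \<open>Dfree_square\<close> cancel.\<close>

lemma fac_step:
  assumes "w \<in> carrier W" "x \<in> fac w"
  shows "x \<otimes> w \<in> fac w" "(x \<otimes> w) \<otimes> w = conj_by W x (x \<otimes> w)"
proof -
  have x: "x \<in> T" "x \<otimes> w \<in> T" "x \<in> carrier W" using assms facD T_carrier by auto
  have "conj_by W x (x \<otimes> w) = (x \<otimes> w) \<otimes> x \<otimes> (x \<otimes> w)"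
    using x by (simp add: conj_by_def T_inv)
  also have "\<dots> = (x \<otimes> w) \<otimes> w"
    using x assms T_cancel[OF x(1) assms(1)] by (simp add: m_assoc)
  finally show e: "(x \<otimes> w) \<otimes> w = conj_by W x (x \<otimes> w)" ..
  show "x \<otimes> w \<in> fac w" using x conj_by_T[of x "x \<otimes> w"] e by (simp add: fac_def)
qed

lemma bij_fac_step: "w \<in> carrier W \<Longrightarrow> bij_betw (\<lambda>x. x \<otimes> w) (fac w) (fac w)"
proof -
  assume w: "w \<in> carrier W"
  have inj: "inj_on (\<lambda>x. x \<otimes> w) (fac w)" using w facD T_carrier by (auto simp: inj_on_def)
  moreover have "(\<lambda>x. x \<otimes> w) ` fac w = fac w"
    using fac_step(1)[OF w] by (intro endo_inj_surj inj) auto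
  ultimately show ?thesis by (simp add: bij_betw_def)
qed

lemma nc_level_carrier: "w \<in> nc_level W S cx k \<Longrightarrow> w \<in> carrier W"
  by (simp add: nc_level_def)

lemma nc_level_2_ncw:
  assumes "w \<in> nc_level W S cx 2"
  obtains a b where "a \<in> T" "b \<in> T" "w = a \<otimes> b" "ncw [a, b]"
proof -
  obtain ts where ts: "ts \<in> lists T" "lp ts = w" "length ts = refl_length W S w"
    using refl_length_word nc_level_carrier[OF assms] by blast
  have "ncw ts \<and> lp ts = w \<and> length ts = 2"
    unfolding ncw_iff_Rex using ts assms by (simp add: Rex_def)
  moreover then obtain a b where "ts = [a, b]" by (auto simp: length_Suc_conv numeral_2_eq_2)
  ultimately show ?thesis using that[of a b] ts T_carrier by auto
qed

lemma Rex_level_2: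
  assumes "w \<in> nc_level W S cx 2"
  shows "Rex W S w = (\<lambda>x. [x, x \<otimes> w]) ` fac w"
proof -
  obtain a b where ab: "a \<in> T" "b \<in> T" "w = a \<otimes> b" "ncw [a, b]" using nc_level_2_ncw assms by blast
  have w: "w \<in> carrier W" using assms nc_level_carrier by blast
  show ?thesis
  proof safe
    fix ts assume "ts \<in> Rex W S w"
    then have ts: "ncw ts" "lp ts = w" "length ts = 2" using ncw_iff_Rex assms by blast+
    then obtain x y where xy: "ts = [x, y]" by (auto simp: length_Suc_conv numeral_2_eq_2)
    then have T: "x \<in> T" "y \<in> T" using ncw_T[OF ts(1)] by auto
    then have "x \<otimes> w = y" using ts xy T_cancel[of x y] T_carrier by auto
    then show "ts \<in> (\<lambda>x. [x, x \<otimes> w]) ` fac w" using T xy by (auto simp: fac_def)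
  next
    fix x assume x: "x \<in> fac w"
    have "ncw ([] @ [x, x \<otimes> w] @ [])"
      by (rule ncw_replace[of _ "[a, b]"]) (use ab x lp_fac[OF w x] facD T_carrier in auto)
    then show "[x, x \<otimes> w] \<in> Rex W S w"
      using ncw_iff_Rex[of "[x, x \<otimes> w]" w 2] lp_fac[OF w x] by simp
  qed
qed

definition rel2 :: "'a \<Rightarrow> 'a free_mon \<Rightarrow>\<^sub>0 int" where
  "rel2 w = (\<Sum>x\<in>fac w. word_monom [x, x \<otimes> w])"

lemma sum_Rex_level_2:
  assumes "w \<in> nc_level W S cx 2"
  shows "(\<Sum>ts\<in>Rex W S w. word_monom ts) = rel2 w"
  unfolding rel2_def Rex_level_2[OF assms] by (subst sum.reindex) (auto simp: inj_on_def)

text \<open>For distinct letters \<open>ncw_pair_iff\<close> applies, and squares are never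
  noncrossing; so the two families of monomial relations merge into one.\<close>

lemma nc_relations_cases:
  assumes "r \<in> RL"
  obtains (word) t t' where "t \<in> T" "t' \<in> T" "\<not> ncw [t, t']" "r = word_monom [t, t']"
  | (rel2) w where "w \<in> nc_level W S cx 2" "r = rel2 w"
proof -
  consider (a) t where "t \<in> T" "r = word_monom [t, t]"
    | (b) t t' where "t \<in> T" "t' \<in> T" "\<not> abs_le W S (t \<otimes> t') cx" "r = word_monom [t, t']"
    | (c) w where "w \<in> nc_level W S cx 2" "r = (\<Sum>ts\<in>Rex W S w. word_monom ts)"
    using assms unfolding nc_relations_def by blast
  then show ?thesis
  proof cases
    case a
    then show ?thesis using ncw_no_square[of "[]" t "[]"] word by simp
  next
    case b
    show ?thesis
    proof (cases "t = t'")
      case True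
      then show ?thesis using b ncw_no_square[of "[]" t "[]"] word by simp
    next
      case False
      then show ?thesis using b ncw_pair_iff word by blast
    qed
  next
    case c
    then show ?thesis using rel2 sum_Rex_level_2 by simp
  qed
qed

lemma rel2_in_RL: "w \<in> nc_level W S cx 2 \<Longrightarrow> rel2 w \<in> RL"
  using sum_Rex_level_2[of w, symmetric] unfolding nc_relations_def by blast

lemma word_in_RL: "t \<in> T \<Longrightarrow> t' \<in> T \<Longrightarrow> \<not> ncw [t, t'] \<Longrightarrow> word_monom [t, t'] \<in> RL"
  using ncw_pair_iff[of t t'] unfolding nc_relations_def by (cases "t = t'") blast+

lemma RL_carrier: "RL \<subseteq> carrier FA"
proof
  fix r assume "r \<in> RL"
  then show "r \<in> carrier FA"
    by (cases rule: nc_relations_cases) (auto simp: rel2_def facD intro!: free_algebra_sum)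
qed

lemma ideal_ID: "ideal ID FA"
  by (rule ring.genideal_ideal[OF ring_free_algebra RL_carrier])

lemma RL_ID: "RL \<subseteq> ID"
  by (rule ring.genideal_self[OF ring_free_algebra RL_carrier])

lemma ID_carrier: "p \<in> ID \<Longrightarrow> p \<in> carrier FA"
  using additive_subgroup.a_Hcarr[OF ideal.axioms(1)[OF ideal_ID]] .

lemma ID_zero [simp]: "0 \<in> ID"
  using additive_subgroup.zero_closed[OF ideal.axioms(1)[OF ideal_ID]] by simp

lemma ID_add: "p \<in> ID \<Longrightarrow> q \<in> ID \<Longrightarrow> p + q \<in> ID"
  using additive_subgroup.a_closed[OF ideal.axioms(1)[OF ideal_ID]] by simp

lemma ID_uminus: "p \<in> ID \<Longrightarrow> - p \<in> ID"
  using additive_subgroup.a_inv_closed[OF ideal.axioms(1)[OF ideal_ID], of p] ID_carrier[of p]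
  by (simp add: free_algebra_a_inv)

lemma ID_diff: "p \<in> ID \<Longrightarrow> q \<in> ID \<Longrightarrow> p - q \<in> ID"
  using ID_add[of p "- q"] ID_uminus by simp

lemma ID_cmul: "p \<in> ID \<Longrightarrow> frag_cmul k p \<in> ID"
  by (rule frag_closure_minus_cmul) (auto intro: ID_diff)

lemma ID_sum: "(\<And>i. i \<in> J \<Longrightarrow> f i \<in> ID) \<Longrightarrow> sum f J \<in> ID"
  by (induction J rule: infinite_finite_induct) (auto intro: ID_add)

lemma ID_mult_left: "p \<in> ID \<Longrightarrow> q \<in> carrier FA \<Longrightarrow> q * p \<in> ID"
  using ideal.I_l_closed[OF ideal_ID] by simp

lemma ID_mult_right: "p \<in> ID \<Longrightarrow> q \<in> carrier FA \<Longrightarrow> p * q \<in> ID"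
  using ideal.I_r_closed[OF ideal_ID] by simp

text \<open>The additive span of the relations multiplied by words on both sides. It contains
  \<open>ID\<close>, which gives an induction rule for the ideal.\<close>

inductive_set relspan :: "('a free_mon \<Rightarrow>\<^sub>0 int) set" where
  zero: "0 \<in> relspan"
| gen: "\<lbrakk>r \<in> RL; u \<in> lists T; v \<in> lists T\<rbrakk> \<Longrightarrow> word_monom u * r * word_monom v \<in> relspan"
| diff: "\<lbrakk>p \<in> relspan; q \<in> relspan\<rbrakk> \<Longrightarrow> p - q \<in> relspan"

lemma relspan_word_mult:
  "p \<in> relspan \<Longrightarrow> w \<in> lists T \<Longrightarrow> word_monom w * p \<in> relspan \<and> p * word_monom w \<in> relspan"
proof (induction rule: relspan.induct)
  case (gen r u v)
  have "word_monom w * (word_monom u * r * word_monom v) = word_monom (w @ u) * r * word_monom v"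
    "word_monom u * r * word_monom v * word_monom w = word_monom u * r * word_monom (v @ w)"
    by (simp_all add: mult.assoc flip: word_monom_mult)
  then show ?case using relspan.gen[of r "w @ u" v] relspan.gen[of r u "v @ w"] gen by simp
qed (auto simp: right_diff_distrib left_diff_distrib intro: relspan.zero relspan.diff)

lemma relspan_carrier: "p \<in> relspan \<Longrightarrow> p \<in> carrier FA"
  by (induction rule: relspan.induct)
    (use RL_carrier in \<open>auto intro!: free_algebra_diff free_algebra_mult\<close>)

lemma ID_relspan: "ID \<subseteq> relspan"
proof (rule ring.genideal_minimal[OF ring_free_algebra])
  interpret F: ring FA by (rule ring_free_algebra)
  have uminus: "- p \<in> relspan" if "p \<in> relspan" for p
    using relspan.diff[OF relspan.zero that] by simp
  have mult: "x * a \<in> relspan \<and> a * x \<in> relspan" if "a \<in> relspan" "x \<in> carrier FA" for a x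
    using that(2)
  proof (induction rule: free_algebra_induct)
    case (word xs)
    then show ?case using relspan_word_mult[OF that(1)] by blast
  qed (auto simp: right_diff_distrib left_diff_distrib intro: relspan.zero relspan.diff)
  show "ideal relspan FA"
  proof (rule idealI[OF ring_free_algebra])
    show "subgroup relspan (add_monoid FA)"
    proof (rule F.add.subgroupI)
      show "\<ominus>\<^bsub>FA\<^esub> a \<in> relspan" if "a \<in> relspan" for a
        using that uminus relspan_carrier by (simp add: free_algebra_a_inv)
      show "a \<oplus>\<^bsub>FA\<^esub> b \<in> relspan" if "a \<in> relspan" "b \<in> relspan" for a b
        using relspan.diff[OF that(1) uminus[OF that(2)]] by simp
    qed (use relspan.zero relspan_carrier in auto)
  qed (use mult in auto)
  show "RL \<subseteq> relspan"
    using relspan.gen[of _ "[]" "[]"] by (auto simp: word_monom_Nil)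
qed

lemma ID_induct [consumes 1, case_names zero gen diff]:
  assumes "p \<in> ID" "P 0"
    "\<And>r u v. \<lbrakk>r \<in> RL; u \<in> lists T; v \<in> lists T\<rbrakk> \<Longrightarrow> P (word_monom u * r * word_monom v)"
    "\<And>p q. P p \<Longrightarrow> P q \<Longrightarrow> P (p - q)"
  shows "P p"
proof -
  have "p \<in> relspan" using assms(1) ID_relspan by blast
  then show ?thesis by (induction rule: relspan.induct) (use assms in auto)
qed

lemma rel2_sandwich:
  "word_monom u * rel2 w * word_monom v = (\<Sum>x\<in>fac w. word_monom (u @ [x, x \<otimes> w] @ v))"
  by (simp add: rel2_def sum_distrib_left sum_distrib_right word_monom_mult)

text \<open>So a relation placed between two words has either all or none of its terms noncrossing,
  and the cut-off in \<open>D\<close> never splits it.\<close>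

lemma ncw_sandwich_iff:
  assumes "w \<in> nc_level W S cx 2" "x \<in> fac w" "y \<in> fac w"
  shows "ncw (u @ [x, x \<otimes> w] @ v) \<longleftrightarrow> ncw (u @ [y, y \<otimes> w] @ v)"
proof -
  have w: "w \<in> carrier W" using assms nc_level_carrier by blast
  show ?thesis
    using ncw_replace[of u "[x, x \<otimes> w]" v "[y, y \<otimes> w]"] ncw_replace[of u "[y, y \<otimes> w]" v "[x, x \<otimes> w]"]
      lp_fac[OF w assms(2)] lp_fac[OF w assms(3)] assms(2,3)[THEN facD(1)] assms(2,3)[THEN facD(2)] by auto
qed

text \<open>
  Once all proper factors are noncrossing, rewrite the product of the first two letters: by
  \<open>ncw_join\<close>, every other factorization of it produces a shorter word that vanishes.
\<close>

lemma not_ncw_ID: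
  "ts \<in> lists T \<Longrightarrow> \<not> ncw ts \<Longrightarrow> word_monom ts \<in> ID"
proof (induction "length ts" arbitrary: ts rule: less_induct)
  case less
  have sub: "word_monom (a @ us @ b) \<in> ID" if "word_monom us \<in> ID" "a \<in> lists T" "b \<in> lists T" for a us b
    using ID_mult_right[OF ID_mult_left[OF that(1), of "word_monom a"], of "word_monom b"] that
    by (simp add: word_monom_mult)
  have inner: "word_monom ts \<in> ID" if "ts = a @ us @ b" "\<not> ncw us" "length us < length ts" for a us b
    using less.hyps[OF that(3)] that less.prems(1) sub by auto
  consider "ts = []" | t where "ts = [t]" | x t where "ts = [x, t]" | x y us t where "ts = x # y # us @ [t]"
  proof (cases ts)
    case (Cons x l)
    show ?thesis
    proof (cases l)
      case (Cons y l')
      then show ?thesis using that \<open>ts = x # l\<close> by (cases l' rule: rev_cases) auto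
    qed (use that Cons in auto)
  qed (use that in auto)
  then show ?case
  proof cases
    case 1
    then show ?thesis using less.prems by simp
  next
    case 2
    then show ?thesis using less.prems ncw_single by simp
  next
    case 3
    then show ?thesis using less.prems word_in_RL RL_ID by auto
  next
    case (4 x y us t)
    have T: "x \<in> T" "y \<in> T" "us \<in> lists T" "t \<in> T" using less.prems 4 by auto
    show ?thesis
    proof (cases "ncw (x # y # us) \<and> ncw (y # us @ [t])")
      case False
      then show ?thesis
        using inner[of "[]" "x # y # us" "[t]"] inner[of "[x]" "y # us @ [t]" "[]"] 4 by auto
    next
      case True
      define w where "w = x \<otimes> y"
      have cl: "x \<in> carrier W" "y \<in> carrier W" "w \<in> carrier W" using T T_carrier by (auto simp: w_def)
      have "ncw [x, y]" using True ncw_prefix[of "[x, y]" us] by simp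
      then have w2: "w \<in> nc_level W S cx 2" using ncw_iff_Rex[of "[x, y]" w 2] cl by (simp add: w_def)
      have xw: "x \<otimes> w = y" using T_cancel[OF T(1) cl(2)] by (simp add: w_def)
      then have xf: "x \<in> fac w" using T by (simp add: fac_def)
      have other: "word_monom ([] @ [x', x' \<otimes> w] @ us @ [t]) \<in> ID" if "x' \<in> fac w" "x' \<noteq> x" for x'
      proof -
        let ?y = "x' \<otimes> w"
        have x': "x' \<in> T" "?y \<in> T" using that facD by auto
        have "\<not> ncw (?y # us @ [t])"
        proof
          assume *: "ncw (?y # us @ [t])"
          have "x' \<otimes> (?y \<otimes> lp us) = (x' \<otimes> ?y) \<otimes> lp us"
            using x' T_carrier T(3) lp_T_closed by (simp add: m_assoc)
          also have "x' \<otimes> ?y = x \<otimes> y" using T_cancel[OF x'(1) cl(3)] by (simp add: w_def)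
          finally have "lp (x # y # us) = lp (x' # ?y # us)"
            using cl T(3) lp_T_closed by (simp add: m_assoc)
          then have "ncw (x # (y # us) @ [t])"
            using True * x' T that(2) by (intro ncw_join[of x "y # us" x' "?y # us" t]) auto
          then show False using less.prems 4 by simp
        qed
        then have "word_monom (?y # us @ [t]) \<in> ID"
          using less.hyps[of "?y # us @ [t]"] 4 T x' by auto
        then show ?thesis using sub[of "?y # us @ [t]" "[x']" "[]"] x' by simp
      qed
      have "word_monom [] * rel2 w * word_monom (us @ [t]) \<in> ID"
        using rel2_in_RL[OF w2] RL_ID T by (intro ID_mult_right ID_mult_left) auto
      also have "word_monom [] * rel2 w * word_monom (us @ [t])
          = word_monom ts + (\<Sum>x'\<in>fac w - {x}. word_monom ([] @ [x', x' \<otimes> w] @ us @ [t]))"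
        unfolding rel2_sandwich by (subst sum.remove[OF finite_fac xf]) (simp add: 4 xw)
      finally have "word_monom ts + (\<Sum>x'\<in>fac w - {x}. word_monom ([] @ [x', x' \<otimes> w] @ us @ [t])) \<in> ID" .
      moreover have "(\<Sum>x'\<in>fac w - {x}. word_monom ([] @ [x', x' \<otimes> w] @ us @ [t])) \<in> ID"
        using other by (intro ID_sum) blast
      ultimately show ?thesis using ID_diff by fastforce
    qed
  qed
qed

subsection \<open>The twisted derivations\<close>

text \<open>Passing a letter costs a sign and a conjugation by \<open>t\<close>. As only letters
  equal to \<open>t\<close> are deleted, conjugation by the deleted letter is conjugation by
  \<open>t\<close>; \<open>dw_sum\<close> recovers the explicit sum.\<close>

fun dw :: "'a \<Rightarrow> 'a list \<Rightarrow> 'a free_mon \<Rightarrow>\<^sub>0 int" where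
  "dw t [] = 0"
| "dw t (x # xs) = (if x = t then word_monom xs else 0) - word_monom [conj_by W x t] * dw t xs"

text \<open>The twisted Leibniz rule.\<close>

lemma dw_append:
  "dw t (u @ v) = dw t u * word_monom v
     + frag_cmul ((- 1) ^ length u) (word_monom (map (\<lambda>x. conj_by W x t) u) * dw t v)"
proof (induction u)
  case Nil
  then show ?case by (simp add: word_monom_Nil)
next
  case (Cons x u)
  have "word_monom [conj_by W x t] * frag_cmul ((- 1) ^ length u) (word_monom (map (\<lambda>x. conj_by W x t) u) * dw t v)
      = - frag_cmul ((- 1) ^ length (x # u)) (word_monom (map (\<lambda>x. conj_by W x t) (x # u)) * dw t v)"
    by (simp add: frag_cmul_mult_right word_monom_mult flip: mult.assoc)
  then show ?case
    by (simp add: Cons word_monom_mult algebra_simps flip: minus_frag_cmul)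
qed

lemma dw_notin: "t \<notin> set v \<Longrightarrow> dw t v = 0"
  by (induction v) auto

lemma dw_carrier: "ts \<in> lists T \<Longrightarrow> t \<in> T \<Longrightarrow> dw t ts \<in> carrier FA"
  by (induction ts rule: list.induct)
    (auto intro!: free_algebra_diff free_algebra_uminus free_algebra_mult simp: conj_by_T)

lemma dw_sum:
  "dw t ts = (\<Sum>i<length ts. if ts ! i = t
     then frag_cmul ((- 1) ^ i) (word_monom (map (\<lambda>u. conj_by W u t) (take i ts) @ drop (Suc i) ts)) else 0)"
proof (induction ts)
  case (Cons x ts)
  have "word_monom [conj_by W x t] * dw t ts = - (\<Sum>i<length ts. if ts ! i = t
     then frag_cmul ((- 1) ^ Suc i) (word_monom (map (\<lambda>u. conj_by W u t) (x # take i ts) @ drop (Suc i) ts)) else 0)"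
    unfolding Cons sum_distrib_left sum_negf[symmetric]
    by (intro sum.cong) (auto simp: frag_cmul_mult_right word_monom_mult)
  then show ?case
    unfolding length_Cons sum.lessThan_Suc_shift by (simp cong: if_cong)
qed simp

text \<open>The cut-off is essential: for distinct \<open>t\<close>, \<open>t'\<close> with
  \<open>[t, t']\<close> not noncrossing, \<open>dw t\<close> sends the relation
  \<open>word_monom [t, t']\<close> to the single letter \<open>word_monom [t']\<close>, which is
  outside the ideal.\<close>

definition D :: "'a \<Rightarrow> ('a free_mon \<Rightarrow>\<^sub>0 int) \<Rightarrow> 'a free_mon \<Rightarrow>\<^sub>0 int" where
  "D t = frag_extend (\<lambda>u. if ncw (letters u) then dw t (letters u) else 0)"

lemma D_zero [simp]: "D t 0 = 0"
  and D_add: "D t (p + q) = D t p + D t q"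
  and D_diff: "D t (p - q) = D t p - D t q"
  by (simp_all add: D_def frag_extend_add frag_extend_diff)

lemma D_sum: "D t (sum f J) = (\<Sum>i\<in>J. D t (f i))"
  by (induction J rule: infinite_finite_induct) (simp_all add: D_add)

lemma D_word: "D t (word_monom xs) = (if ncw xs then dw t xs else 0)"
  by (simp add: D_def word_monom_frag)

lemma D_carrier: "p \<in> carrier FA \<Longrightarrow> t \<in> T \<Longrightarrow> D t p \<in> carrier FA"
  by (induction rule: free_algebra_induct) (auto simp: D_word D_diff dw_carrier intro: free_algebra_diff)

lemma conj_fac:
  assumes "w \<in> carrier W" "t \<in> T" "x \<in> fac w"
  shows "conj_by W x t \<in> fac (conj_by W w t)"
    "conj_by W x t \<otimes> conj_by W w t = conj_by W (x \<otimes> w) t"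
proof -
  have x: "x \<in> T" "x \<otimes> w \<in> T" "x \<in> carrier W" "t \<in> carrier W" using assms facD T_carrier by auto
  show e: "conj_by W x t \<otimes> conj_by W w t = conj_by W (x \<otimes> w) t"
    using x assms by (simp add: conj_by_def m_assoc inv_cancel)
  show "conj_by W x t \<in> fac (conj_by W w t)"
    using x conj_by_T[of _ t] assms(2) e by (simp add: fac_def)
qed

lemma conj_conj: "\<lbrakk>x \<in> carrier W; t \<in> T\<rbrakk> \<Longrightarrow> conj_by W (conj_by W x t) t = x"
  using T_carrier[of t] T_inv[of t] T_square[of t] T_cancel[of t]
  by (simp add: conj_by_def m_assoc)

lemma rel2_conj:
  assumes "w \<in> carrier W" "t \<in> T"
  shows "(\<Sum>x\<in>fac w. word_monom [conj_by W x t, conj_by W (x \<otimes> w) t]) = rel2 (conj_by W w t)"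
  unfolding rel2_def
proof (rule sum.reindex_bij_witness[where i = "\<lambda>x. conj_by W x t" and j = "\<lambda>x. conj_by W x t"])
  have wt: "conj_by W w t \<in> carrier W" using assms T_carrier by (simp add: conj_by_def)
  show "conj_by W x t \<in> fac w" if "x \<in> fac (conj_by W w t)" for x
    using conj_fac(1)[OF wt assms(2) that] conj_conj assms by simp
qed (use conj_fac[OF assms] conj_conj assms facD T_carrier in auto)

text \<open>By the Leibniz rule, deletions in \<open>u\<close> leave the relation intact, deletions
  in the middle pair cancel under the permutation of \<open>fac w\<close>, and deletions in
  \<open>v\<close> leave the relation of the conjugate of \<open>w\<close> by
  \<open>t\<close>.\<close>

lemma D_rel2:
  assumes w: "w \<in> nc_level W S cx 2" and t: "t \<in> T" and u: "u \<in> lists T" and v: "v \<in> lists T"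
    and n: "\<And>x. x \<in> fac w \<Longrightarrow> ncw (u @ [x, x \<otimes> w] @ v)"
  shows "D t (word_monom u * rel2 w * word_monom v) \<in> ID"
proof -
  have wc: "w \<in> carrier W" using w nc_level_carrier by blast
  define s where "s = (- 1 :: int) ^ length u"
  define u' where "u' = word_monom (map (\<lambda>x. conj_by W x t) u)"
  have u': "u' \<in> carrier FA" using map_conj_by_T[OF u t] by (simp add: u'_def)
  \<comment> \<open>Deleting the first letter of \<open>[x, x w]\<close> leaves \<open>x w\<close>;
    deleting the second leaves \<open>x\<close> conjugated by \<open>x w\<close>, which is
    \<open>(x w) w\<close> by \<open>fac_step\<close>. Both deletions are therefore values of the
    same function \<open>f\<close>.\<close>
  define f where "f y = (if y = t then word_monom [y \<otimes> w] else 0)" for y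
  have pair: "dw t [x, x \<otimes> w] = f x - f (x \<otimes> w)" if "x \<in> fac w" for x
    using fac_step(2)[OF wc that] by (auto simp: f_def word_monom_Nil)
  have "dw t (u @ [x, x \<otimes> w] @ v) = dw t u * word_monom [x, x \<otimes> w] * word_monom v
      + frag_cmul s (u' * (f x - f (x \<otimes> w)) * word_monom v)
      + frag_cmul s (u' * word_monom [conj_by W x t, conj_by W (x \<otimes> w) t] * dw t v)" if "x \<in> fac w" for x
  proof -
    have "dw t ([x, x \<otimes> w] @ v) = (f x - f (x \<otimes> w)) * word_monom v
        + word_monom [conj_by W x t, conj_by W (x \<otimes> w) t] * dw t v"
      using dw_append[of t "[x, x \<otimes> w]" v] unfolding pair[OF that] by simp
    moreover have "dw t (u @ [x, x \<otimes> w] @ v) = dw t u * (word_monom [x, x \<otimes> w] * word_monom v)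
        + frag_cmul s (u' * dw t ([x, x \<otimes> w] @ v))"
      by (simp only: dw_append[of t u] s_def u'_def word_monom_mult)
    ultimately show ?thesis
      by (simp only: distrib_left frag_cmul_distrib2 mult.assoc add.assoc)
  qed
  then have "D t (word_monom u * rel2 w * word_monom v) =
      (\<Sum>x\<in>fac w. dw t u * word_monom [x, x \<otimes> w] * word_monom v
      + frag_cmul s (u' * (f x - f (x \<otimes> w)) * word_monom v)
      + frag_cmul s (u' * word_monom [conj_by W x t, conj_by W (x \<otimes> w) t] * dw t v))"
    unfolding rel2_sandwich D_sum by (intro sum.cong) (simp_all add: D_word n[simplified])
  also have "\<dots> = dw t u * rel2 w * word_monom v
      + frag_cmul s (u' * (\<Sum>x\<in>fac w. f x - f (x \<otimes> w)) * word_monom v)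
      + frag_cmul s (u' * rel2 (conj_by W w t) * dw t v)"
    unfolding sum.distrib frag_cmul_sum[symmetric] sum_distrib_left[symmetric] sum_distrib_right[symmetric]
      rel2_conj[OF wc t] rel2_def[of w] ..
  also have "(\<Sum>x\<in>fac w. f x - f (x \<otimes> w)) = 0"
    using sum.reindex_bij_betw[OF bij_fac_step[OF wc], of f] by (simp add: sum_subtractf)
  finally have e: "D t (word_monom u * rel2 w * word_monom v) =
      dw t u * rel2 w * word_monom v + frag_cmul s (u' * rel2 (conj_by W w t) * dw t v)" by simp
  have "dw t u * rel2 w * word_monom v \<in> ID"
    using rel2_in_RL[OF w] RL_ID u v t by (intro ID_mult_right ID_mult_left dw_carrier) auto
  \<comment> \<open>The conjugate of \<open>w\<close> by \<open>t\<close> need not lie below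
    \<open>cx\<close> in general. If \<open>t\<close> occurs in \<open>v\<close>, a Hurwitz move of
    that occurrence to the front exhibits the conjugated pair inside a noncrossing word; otherwise
    \<open>dw t v = 0\<close>.\<close>
  moreover have "u' * rel2 (conj_by W w t) * dw t v \<in> ID"
  proof (cases "t \<in> set v")
    case True
    then obtain v0 v1 where v01: "v = v0 @ t # v1" by (meson split_list)
    obtain a b where ab: "a \<in> T" "b \<in> T" "w = a \<otimes> b" "ncw [a, b]" using nc_level_2_ncw w by blast
    have "a \<otimes> w = b" using ab T_cancel T_carrier by simp
    then have "a \<in> fac w" using ab by (simp add: fac_def)
    then have "ncw ((u @ [a, b] @ v0) @ t # v1)" using n[of a] v01 \<open>a \<otimes> w = b\<close> by simp
    then have "ncw ((t # map (\<lambda>x. conj_by W x t) u) @ [conj_by W a t, conj_by W b t] @ map (\<lambda>x. conj_by W x t) v0 @ v1)"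
      using ncw_hurwitz by fastforce
    then have nab: "ncw [conj_by W a t, conj_by W b t]" by (rule ncw_infix)
    have "conj_by W a t \<otimes> conj_by W b t = conj_by W w t"
      using ab t T_carrier by (simp add: conj_by_def m_assoc inv_cancel)
    then have "lp [conj_by W a t, conj_by W b t] = conj_by W w t"
      using ab t conj_by_T T_carrier by simp
    then have "conj_by W w t \<in> nc_level W S cx 2"
      using ncw_iff_Rex[of "[conj_by W a t, conj_by W b t]" "conj_by W w t" 2] nab by simp
    then show ?thesis
      using rel2_in_RL RL_ID u' v t by (intro ID_mult_right ID_mult_left dw_carrier) auto
  next
    case False
    then show ?thesis by (simp add: dw_notin)
  qed
  ultimately show ?thesis unfolding e by (intro ID_add ID_cmul)
qed

lemma D_ID:
  assumes "p \<in> ID" "t \<in> T"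
  shows "D t p \<in> ID"
  using assms(1)
proof (induction rule: ID_induct)
  case (gen r u v)
  show ?case
    using gen(1)
  proof (cases rule: nc_relations_cases)
    case (word a b)
    then have "\<not> ncw (u @ [a, b] @ v)" using ncw_infix by blast
    then show ?thesis using word by (simp add: word_monom_mult D_word)
  next
    case (rel2 w)
    show ?thesis
    proof (cases "\<exists>x\<in>fac w. ncw (u @ [x, x \<otimes> w] @ v)")
      case True
      then have "\<And>x. x \<in> fac w \<Longrightarrow> ncw (u @ [x, x \<otimes> w] @ v)"
        using ncw_sandwich_iff[OF rel2(1)] by blast
      then show ?thesis using D_rel2[OF rel2(1) assms(2) gen(2,3)] rel2 by simp
    next
      case False
      then have "D t (word_monom u * rel2 w * word_monom v) = 0"
        unfolding rel2_sandwich D_sum by (intro sum.neutral) (auto simp: D_word)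
      then show ?thesis using rel2 by simp
    qed
  qed
qed (auto simp: D_diff intro: ID_diff)

text \<open>The derivation without the cut-off, for which the recursion on the first letter holds
  for every polynomial. It agrees with \<open>D\<close> on combinations of noncrossing
  words.\<close>

definition Dfree :: "'a \<Rightarrow> ('a free_mon \<Rightarrow>\<^sub>0 int) \<Rightarrow> 'a free_mon \<Rightarrow>\<^sub>0 int" where
  "Dfree t = frag_extend (\<lambda>u. dw t (letters u))"

lemma Dfree_diff: "Dfree t (p - q) = Dfree t p - Dfree t q"
  and Dfree_zero [simp]: "Dfree t 0 = 0"
  by (simp_all add: Dfree_def frag_extend_diff)

lemma Dfree_word: "Dfree t (word_monom xs) = dw t xs"
  by (simp add: Dfree_def word_monom_frag)

lemma Dfree_letter_mult:
  "Dfree t (word_monom [a] * p) = (if a = t then p else 0) - word_monom [conj_by W a t] * Dfree t p"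
proof (rule frag_induction[where S = UNIV and c = p])
  show "Dfree t (word_monom [a] * frag_of x) = (if a = t then frag_of x else 0) - word_monom [conj_by W a t] * Dfree t (frag_of x)"
    for x
    using Dfree_word[of t "a # letters x"] Dfree_word[of t "letters x"]
      word_monom_mult[of "[a]" "letters x"] by (simp add: word_monom_frag)
qed (auto simp: right_diff_distrib Dfree_diff)

text \<open>
  The two orders of deleting a pair of letters occur with opposite signs, for two factorizations of the
  same product.
\<close>

lemma Dfree_square:
  assumes w: "w \<in> carrier W"
  shows "ts \<in> lists T \<Longrightarrow> (\<Sum>x\<in>fac w. Dfree (x \<otimes> w) (dw x ts)) = 0"
proof (induction ts rule: list.induct)
  case (Cons z zs)
  have z: "z \<in> T" "z \<in> carrier W" "zs \<in> lists T" using Cons.prems T_carrier by auto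
  \<comment> \<open>The terms in which \<open>z\<close> is deleted first or second are
    \<open>f (x w)\<close> and \<open>- f x\<close>; summed over \<open>fac w\<close> they cancel.
    In the remaining terms \<open>z\<close> ends up conjugated by \<open>w\<close>, independently of
    \<open>x\<close>, and factors out.\<close>
  define f where "f y = (if y = z \<otimes> w then dw y zs else 0)" for y
  have cz: "z = x \<longleftrightarrow> x \<otimes> w = z \<otimes> w" if "x \<in> fac w" for x
    using that facD T_carrier z w by auto
  have cc: "conj_by W z x = x \<otimes> w \<longleftrightarrow> x = z \<otimes> w" if "x \<in> fac w" for x
  proof -
    have x: "x \<in> T" "x \<in> carrier W" using that facD T_carrier by auto
    have "conj_by W z x = x \<otimes> (z \<otimes> x)" using x z by (simp add: conj_by_def T_inv m_assoc)
    then have "conj_by W z x = x \<otimes> w \<longleftrightarrow> z \<otimes> x = w" using x z w by simp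
    also have "\<dots> \<longleftrightarrow> x = z \<otimes> w" using T_cancel[OF z(1)] x w by metis
    finally show ?thesis .
  qed
  have cw: "conj_by W (conj_by W z x) (x \<otimes> w) = conj_by W z w" if "x \<in> fac w" for x
  proof -
    have x: "x \<in> T" "x \<in> carrier W" using that facD T_carrier by auto
    have "conj_by W z w = conj_by W z (x \<otimes> (x \<otimes> w))" using T_cancel[OF x(1) w] by simp
    also have "\<dots> = conj_by W (conj_by W z x) (x \<otimes> w)"
      using x z w by (simp add: conj_by_def inv_mult_group m_assoc)
    finally show ?thesis ..
  qed
  have "Dfree (x \<otimes> w) (dw x (z # zs)) = f (x \<otimes> w) - f x + word_monom [conj_by W z w] * Dfree (x \<otimes> w) (dw x zs)"
    if "x \<in> fac w" for x
    using cz[OF that] cc[OF that] cw[OF that]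
    by (auto simp: Dfree_diff Dfree_letter_mult Dfree_word f_def)
  then have "(\<Sum>x\<in>fac w. Dfree (x \<otimes> w) (dw x (z # zs)))
      = (\<Sum>x\<in>fac w. f (x \<otimes> w)) - (\<Sum>x\<in>fac w. f x) + word_monom [conj_by W z w] * (\<Sum>x\<in>fac w. Dfree (x \<otimes> w) (dw x zs))"
    by (simp add: sum.distrib sum_subtractf sum_distrib_left)
  then show ?case using sum.reindex_bij_betw[OF bij_fac_step[OF w], of f] Cons.IH[OF z(3)] by simp
qed simp

lemma keys_dw:
  assumes "u \<in> Poly_Mapping.keys (dw t ts)" "t \<in> T" "ts \<in> lists T"
  obtains i where "i < length ts" "ts ! i = t"
    "letters u = map (\<lambda>x. conj_by W x t) (take i ts) @ drop (Suc i) ts"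
proof -
  have "(\<Sum>i<length ts. Poly_Mapping.lookup (if ts ! i = t
     then frag_cmul ((- 1) ^ i) (word_monom (map (\<lambda>u. conj_by W u t) (take i ts) @ drop (Suc i) ts)) else 0) u) \<noteq> 0"
    using assms(1) unfolding in_keys_iff dw_sum lookup_sum .
  then obtain i where "i < length ts" "Poly_Mapping.lookup (if ts ! i = t
     then frag_cmul ((- 1) ^ i) (word_monom (map (\<lambda>u. conj_by W u t) (take i ts) @ drop (Suc i) ts)) else 0) u \<noteq> 0"
    by (metis (no_types, lifting) lessThan_iff sum.not_neutral_contains_not_neutral)
  then show ?thesis
    by (intro that[of i]) (auto simp: lookup_word_monom split: if_splits)
qed

lemma keys_dw_word:
  assumes "u \<in> Poly_Mapping.keys (dw t ts)" "t \<in> T" "ts \<in> lists T"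
  shows "letters u \<in> lists T" "Suc (length (letters u)) = length ts" "lp (letters u) = t \<otimes> lp ts"
    "ncw ts \<Longrightarrow> ncw (letters u)"
proof -
  obtain i where i: "i < length ts" "ts ! i = t"
    "letters u = map (\<lambda>x. conj_by W x t) (take i ts) @ drop (Suc i) ts"
    using keys_dw assms by blast
  have e: "ts = take i ts @ t # drop (Suc i) ts" using i id_take_nth_drop by metis
  have T: "take i ts \<in> lists T" "drop (Suc i) ts \<in> lists T"
    using assms(3) set_take_subset[of i ts] set_drop_subset[of "Suc i" ts] by auto
  show uT: "letters u \<in> lists T" using i(3) T map_conj_by_T[OF T(1) assms(2)] by simp
  show "Suc (length (letters u)) = length ts" using i by simp
  have "lp ts = t \<otimes> lp (letters u)"
    using list_prod_hurwitz[of t "take i ts" "drop (Suc i) ts"] e i(3) T lists_T_carrier T_carrier assms(2) by simp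
  then show "lp (letters u) = t \<otimes> lp ts" using T_cancel assms(2) lp_T_closed uT by simp
  show "ncw (letters u)" if "ncw ts"
    using ncw_tl[OF ncw_hurwitz[of "take i ts" t "drop (Suc i) ts"]] that e i(3) by simp
qed

lemma D_eq_Dfree: "(\<And>u. u \<in> Poly_Mapping.keys p \<Longrightarrow> ncw (letters u)) \<Longrightarrow> D t p = Dfree t p"
  unfolding D_def Dfree_def by (intro frag_extend_eq) auto

text \<open>Makes the form respect the quadratic relations in its left argument. Deletion keeps
  words noncrossing, so the cut-off is invisible after the first step and
  \<open>Dfree_square\<close> applies.\<close>

lemma D_square:
  assumes w: "w \<in> carrier W" and p: "p \<in> carrier FA"
  shows "(\<Sum>x\<in>fac w. D (x \<otimes> w) (D x p)) = 0"
  using p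
proof (induction rule: free_algebra_induct)
  case (word xs)
  show ?case
  proof (cases "ncw xs")
    case True
    have "D (x \<otimes> w) (D x (word_monom xs)) = Dfree (x \<otimes> w) (dw x xs)" if "x \<in> fac w" for x
      using True D_eq_Dfree[of "dw x xs" "x \<otimes> w"] keys_dw_word(4)[OF _ facD(1)[OF that] word] by (simp add: D_word)
    then show ?thesis using Dfree_square[OF w word] by simp
  qed (simp add: D_word)
qed (simp_all add: D_diff sum_subtractf)

subsection \<open>The form on words\<close>

definition phi :: "'a list \<Rightarrow> ('a free_mon \<Rightarrow>\<^sub>0 int) \<Rightarrow> int" where
  "phi ts p = Poly_Mapping.lookup (fold D ts p) (Word [])"

lemma fold_D_zero [simp]: "fold D ts 0 = 0"
  by (induction ts) auto

lemma fold_D_diff: "fold D ts (p - q) = fold D ts p - fold D ts q"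
  by (induction ts arbitrary: p q) (auto simp: D_diff)

lemma fold_D_add: "fold D ts (p + q) = fold D ts p + fold D ts q"
  by (induction ts arbitrary: p q) (auto simp: D_add)

lemma fold_D_sum: "fold D ts (sum f J) = (\<Sum>i\<in>J. fold D ts (f i))"
  by (induction J rule: infinite_finite_induct) (simp_all add: fold_D_add)

lemma fold_D_carrier: "ts \<in> lists T \<Longrightarrow> p \<in> carrier FA \<Longrightarrow> fold D ts p \<in> carrier FA"
  by (induction ts arbitrary: p rule: list.induct) (auto simp: D_carrier)

lemma fold_D_ID: "ts \<in> lists T \<Longrightarrow> p \<in> ID \<Longrightarrow> fold D ts p \<in> ID"
  by (induction ts arbitrary: p rule: list.induct) (auto simp: D_ID)

lemma phi_zero [simp]: "phi ts 0 = 0"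
  and phi_diff: "phi ts (p - q) = phi ts p - phi ts q"
  and phi_add: "phi ts (p + q) = phi ts p + phi ts q"
  by (simp_all add: phi_def fold_D_diff fold_D_add lookup_minus lookup_add)

text \<open>All relations have degree two, so the ideal contains no constant terms.\<close>

lemma lookup_ID_Nil:
  assumes "p \<in> ID"
  shows "Poly_Mapping.lookup p (Word []) = 0"
  using assms
proof (induction rule: ID_induct)
  case (gen r u v)
  show ?case
    using gen(1)
    by (cases rule: nc_relations_cases)
      (simp_all add: rel2_sandwich word_monom_mult lookup_word_monom lookup_sum)
qed (simp_all add: lookup_minus)

lemma phi_ID: "ts \<in> lists T \<Longrightarrow> p \<in> ID \<Longrightarrow> phi ts p = 0"
  unfolding phi_def by (intro lookup_ID_Nil fold_D_ID)

text \<open>A grading by the product in the group as well as by length; deleting \<open>t\<close>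
  multiplies the product by \<open>t\<close> on the left.\<close>

definition isotypic :: "'a \<Rightarrow> nat \<Rightarrow> ('a free_mon \<Rightarrow>\<^sub>0 int) \<Rightarrow> bool" where
  "isotypic w k p \<longleftrightarrow>
     (\<forall>u\<in>Poly_Mapping.keys p. letters u \<in> lists T \<and> lp (letters u) = w \<and> length (letters u) = k)"

lemma isotypic_word: "xs \<in> lists T \<Longrightarrow> isotypic (lp xs) (length xs) (word_monom xs)"
  by (simp add: isotypic_def word_monom_def)

lemma isotypic_D:
  assumes "isotypic w k p" "t \<in> T"
  shows "isotypic (t \<otimes> w) (k - 1) (D t p)" "k = 0 \<Longrightarrow> D t p = 0"
proof -
  have sub: "Poly_Mapping.keys (D t p) \<subseteq> (\<Union>u\<in>Poly_Mapping.keys p. Poly_Mapping.keys (dw t (letters u)))"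
    unfolding D_def by (rule order_trans[OF keys_frag_extend]) (auto split: if_splits)
  show "isotypic (t \<otimes> w) (k - 1) (D t p)"
    unfolding isotypic_def
  proof
    fix v assume "v \<in> Poly_Mapping.keys (D t p)"
    then obtain u where u: "u \<in> Poly_Mapping.keys p" "v \<in> Poly_Mapping.keys (dw t (letters u))"
      using sub by blast
    then have *: "letters u \<in> lists T" "lp (letters u) = w" "length (letters u) = k"
      using assms(1) unfolding isotypic_def by blast+
    show "letters v \<in> lists T \<and> lp (letters v) = t \<otimes> w \<and> length (letters v) = k - 1"
      using keys_dw_word(1-3)[OF u(2) assms(2) *(1)] *(2,3) by auto
  qed
  show "D t p = 0" if "k = 0"
  proof -
    have "Poly_Mapping.keys (dw t (letters u)) = {}" if "u \<in> Poly_Mapping.keys p" for u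
      using assms that \<open>k = 0\<close> by (simp add: isotypic_def)
    then show ?thesis using sub by auto
  qed
qed

lemma phi_isotypic:
  "\<lbrakk>isotypic w k p; ts \<in> lists T; w \<in> carrier W; phi ts p \<noteq> 0\<rbrakk> \<Longrightarrow> lp ts = w \<and> length ts = k"
proof (induction ts arbitrary: w k p rule: list.induct)
  case Nil
  then have "Word [] \<in> Poly_Mapping.keys p" by (simp add: phi_def in_keys_iff)
  then show ?case using Nil by (auto simp: isotypic_def)
next
  case (Cons t ts)
  have T: "t \<in> T" "ts \<in> lists T" "t \<in> carrier W" using Cons.prems T_carrier by auto
  have phi: "phi ts (D t p) \<noteq> 0" using Cons.prems by (simp add: phi_def)
  then have "k \<noteq> 0" using isotypic_D(2)[OF Cons.prems(1) T(1)] by auto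
  moreover have "lp ts = t \<otimes> w \<and> length ts = k - 1"
    using Cons.IH[OF isotypic_D(1)[OF Cons.prems(1) T(1)] T(2) _ phi] T Cons.prems by simp
  ultimately show ?case using T_cancel[OF T(1) Cons.prems(3)] by simp
qed

text \<open>The cut-off in \<open>D\<close> tests only the right argument. A nonzero pairing forces
  that word to be noncrossing with the product and length of \<open>ts\<close>, so \<open>ts\<close>
  would be noncrossing too.\<close>

lemma phi_ncw:
  assumes "ts \<in> lists T" "p \<in> carrier FA" "\<not> ncw ts"
  shows "phi ts p = 0"
  using assms(2)
proof (induction rule: free_algebra_induct)
  case (word xs)
  show ?case
  proof (rule ccontr)
    assume *: "phi ts (word_monom xs) \<noteq> 0"
    then have "lp ts = lp xs \<and> length ts = length xs"
      using phi_isotypic[OF isotypic_word[OF word] assms(1)] word lp_T_closed by blast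
    moreover have "ncw xs"
    proof (cases ts)
      case Nil
      then show ?thesis using assms by simp
    next
      case (Cons t ts')
      then show ?thesis using * by (auto simp: phi_def D_word split: if_splits)
    qed
    ultimately show False using ncw_replace[of "[]" xs "[]" ts] assms by simp
  qed
qed (simp_all add: phi_diff)

text \<open>If \<open>t\<close> does not occur after the first letter, only that letter can be
  deleted, and the tails are compared. Otherwise the second alternative holds at once. It does not
  exclude \<open>x = t\<close>; for decreasing words sortedness does.\<close>

lemma phi_leading:
  assumes "ncw xs" "ts \<in> lists T" "phi ts (word_monom xs) \<noteq> 0"
  shows "ts = xs \<or> (\<exists>as x t bs cs. xs = as @ x # bs \<and> ts = as @ t # cs \<and> t \<in> set bs \<and> length bs = length cs)"
  using assms
proof (induction ts arbitrary: xs rule: list.induct)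
  case Nil
  then show ?case by (simp add: phi_def lookup_word_monom split: if_splits)
next
  case (Cons t ts)
  have xs: "xs \<in> lists T" using Cons.prems ncw_T by blast
  have len: "length (t # ts) = length xs"
    using phi_isotypic[OF isotypic_word[OF xs] Cons.prems(2) lp_T_closed[OF xs] Cons.prems(3)] by simp
  then obtain x ys where xy: "xs = x # ys" by (cases xs) auto
  have "phi ts (dw t xs) \<noteq> 0" using Cons.prems by (simp add: phi_def D_word)
  then have *: "(if x = t then phi ts (word_monom ys) else 0) - phi ts (word_monom [conj_by W x t] * dw t ys) \<noteq> 0"
    using xy by (auto simp: phi_diff split: if_splits)
  show ?case
  proof (cases "t \<in> set ys")
    case True
    then show ?thesis using xy len by (intro disjI2 exI[of _ "[]"]) auto
  next
    case False
    then have e: "x = t" "phi ts (word_monom ys) \<noteq> 0" using * by (auto simp: dw_notin split: if_splits)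
    moreover have "ncw ys" using Cons.prems(1) xy ncw_tl by blast
    ultimately have "ts = ys \<or> (\<exists>as x t bs cs. ys = as @ x # bs \<and> ts = as @ t # cs \<and> t \<in> set bs \<and> length bs = length cs)"
      using Cons.IH[of ys] Cons.prems(2) by auto
    then show ?thesis using e xy by (metis append_Cons)
  qed
qed

lemma phi_diagonal:
  "ncw xs \<Longrightarrow> distinct xs \<Longrightarrow> phi xs (word_monom xs) = 1"
proof (induction xs)
  case (Cons x xs)
  then have "phi xs (word_monom xs) = 1" using ncw_tl by auto
  then show ?case using Cons.prems by (simp add: phi_def D_word dw_notin)
qed (simp add: phi_def lookup_word_monom)

definition form0 :: "('a free_mon \<Rightarrow>\<^sub>0 int) \<Rightarrow> ('a free_mon \<Rightarrow>\<^sub>0 int) \<Rightarrow> int" where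
  "form0 p q = (\<Sum>u\<in>Poly_Mapping.keys p. Poly_Mapping.lookup p u * phi (letters u) q)"

text \<open>The integers appear as the free abelian group on one generator, so that
  \<open>frag_extend\<close> supplies linearity in \<open>p\<close>.\<close>

lemma form0_lookup:
  "form0 p q = Poly_Mapping.lookup (frag_extend (\<lambda>u. frag_cmul (phi (letters u) q) (frag_of ())) p) ()"
  by (simp add: form0_def frag_extend_def lookup_sum)

lemma form0_zero_left [simp]: "form0 0 q = 0"
  and form0_diff_left: "form0 (p - p') q = form0 p q - form0 p' q"
  and form0_add_left: "form0 (p + p') q = form0 p q + form0 p' q"
  and form0_word: "form0 (word_monom ts) q = phi ts q"
  by (simp_all add: form0_lookup frag_extend_diff frag_extend_add lookup_minus lookup_add word_monom_frag)

lemma form0_add_right: "form0 p (q + q') = form0 p q + form0 p q'"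
  and form0_diff_right: "form0 p (q - q') = form0 p q - form0 p q'"
  and form0_zero_right [simp]: "form0 p 0 = 0"
  by (simp_all add: form0_def phi_add phi_diff algebra_simps sum.distrib sum_subtractf)

lemma form0_ID_right: "p \<in> carrier FA \<Longrightarrow> q \<in> ID \<Longrightarrow> form0 p q = 0"
  by (induction rule: free_algebra_induct) (auto simp: form0_word phi_ID form0_diff_left)

lemma form0_sum_left: "form0 (sum f J) q = (\<Sum>i\<in>J. form0 (f i) q)"
  by (induction J rule: infinite_finite_induct) (simp_all add: form0_add_left)

lemma form0_ID_left:
  assumes "p \<in> ID" "q \<in> carrier FA"
  shows "form0 p q = 0"
  using assms(1)
proof (induction rule: ID_induct)
  case (gen r u v)
  show ?case
    using gen(1)
  proof (cases rule: nc_relations_cases)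
    case (word a b)
    then have "\<not> ncw (u @ [a, b] @ v)" using ncw_infix by blast
    then show ?thesis using word gen phi_ncw[of "u @ [a, b] @ v" q] assms(2)
      by (simp add: word_monom_mult form0_word)
  next
    case (rel2 w)
    have w: "w \<in> carrier W" using rel2 nc_level_carrier by blast
    have "(\<Sum>x\<in>fac w. fold D (u @ [x, x \<otimes> w] @ v) q)
        = fold D v (\<Sum>x\<in>fac w. D (x \<otimes> w) (D x (fold D u q)))"
      by (simp add: fold_D_sum)
    also have "\<dots> = 0" using D_square[OF w fold_D_carrier[OF gen(2) assms(2)]] by simp
    finally have "(\<Sum>x\<in>fac w. phi (u @ [x, x \<otimes> w] @ v) q) = 0"
      by (simp add: phi_def flip: lookup_sum)
    then show ?thesis using rel2 by (simp add: rel2_sandwich form0_sum_left form0_word)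
  qed
qed (simp_all add: form0_diff_left)

end

subsection \<open>Unitriangular systems\<close>

text \<open>For a minimal \<open>z\<close> the unknown \<open>c z\<close> occurs only in the
  equation at \<open>z\<close>. Solve the rest first; the diagonal entry 1 then determines
  \<open>c z\<close> over the integers.\<close>

lemma unitriangular_solve:
  fixes G :: "'b \<Rightarrow> 'b \<Rightarrow> int"
  assumes "finite J" "wf r" "\<And>x. x \<in> J \<Longrightarrow> G x x = 1"
    "\<And>t x. t \<in> J \<Longrightarrow> x \<in> J \<Longrightarrow> G t x \<noteq> 0 \<Longrightarrow> t = x \<or> (x, t) \<in> r"
  shows "(\<exists>c. \<forall>x\<in>J. (\<Sum>t\<in>J. c t * G t x) = f x) \<and>
    (\<forall>c. (\<forall>x\<in>J. (\<Sum>t\<in>J. c t * G t x) = 0) \<longrightarrow> (\<forall>t\<in>J. c t = 0))"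
  using assms(1,3,4)
proof (induction J rule: finite_psubset_induct)
  case (psubset J)
  show ?case
  proof (cases "J = {}")
    case False
    then obtain z where z: "z \<in> J" "\<And>y. (y, z) \<in> r \<Longrightarrow> y \<notin> J"
      using assms(2) by (metis wf_eq_minimal ex_in_conv)
    let ?J = "J - {z}"
    have Gz: "G z x = 0" if "x \<in> ?J" for x using psubset.prems(2)[OF z(1), of x] z(2)[of x] that by auto
    have split: "(\<Sum>t\<in>J. c t * G t x) = c z * G z x + (\<Sum>t\<in>?J. c t * G t x)" for c x
      using z(1) psubset.hyps by (simp add: sum.remove)
    have IH: "(\<exists>c. \<forall>x\<in>?J. (\<Sum>t\<in>?J. c t * G t x) = f x) \<and>
      (\<forall>c. (\<forall>x\<in>?J. (\<Sum>t\<in>?J. c t * G t x) = 0) \<longrightarrow> (\<forall>t\<in>?J. c t = 0))"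
      using z(1) psubset.prems by (intro psubset.IH) auto
    then obtain c where c: "\<And>x. x \<in> ?J \<Longrightarrow> (\<Sum>t\<in>?J. c t * G t x) = f x" by blast
    define c' where "c' = c(z := f z - (\<Sum>t\<in>?J. c t * G t z))"
    have e: "(\<Sum>t\<in>?J. c' t * G t x) = (\<Sum>t\<in>?J. c t * G t x)" for x
      by (intro sum.cong) (auto simp: c'_def)
    have "(\<Sum>t\<in>J. c' t * G t x) = f x" if "x \<in> J" for x
    proof (cases "x = z")
      case True
      then show ?thesis unfolding split e using psubset.prems(1)[OF z(1)] by (simp add: c'_def)
    next
      case False
      then show ?thesis unfolding split e using that Gz c by simp
    qed
    moreover have "d t = 0" if "\<forall>x\<in>J. (\<Sum>t\<in>J. d t * G t x) = 0" "t \<in> J" for d t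
    proof -
      have "(\<Sum>t\<in>?J. d t * G t x) = 0" if "x \<in> ?J" for x
        using \<open>\<forall>x\<in>J. _\<close> split[of d x] Gz[OF that] that by simp
      then have 0: "\<forall>t\<in>?J. d t = 0" using IH by blast
      then have "d z * G z z = 0" using that(1) split[of d z] z(1) by simp
      then show ?thesis using 0 that(2) psubset.prems(1)[OF z(1)] by (cases "t = z") auto
    qed
    ultimately show ?thesis by blast
  qed simp
qed

context coxeter_element
begin

subsection \<open>Straightening\<close>

definition dec_words :: "'a list set" where
  "dec_words = {xs. ncw xs \<and> sorted_wrt (\<lambda>a b. idx b < idx a) xs}"

lemma finite_dec_words: "finite dec_words"
proof (rule finite_subset)
  show "dec_words \<subseteq> {xs. set xs \<subseteq> T \<and> length xs \<le> card S}"
    by (auto simp: dec_words_def ncw_def)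
qed (rule finite_lists_length_le[OF finite_T])

lemma dec_words_distinct: "xs \<in> dec_words \<Longrightarrow> distinct xs"
proof -
  assume "xs \<in> dec_words"
  then have "sorted_wrt (\<lambda>a b. idx b < idx a) xs" by (simp add: dec_words_def)
  then show "distinct xs" by (induction xs) auto
qed

text \<open>A larger index counts as smaller, so that straightening, which raises the index at the
  first changed letter, descends in \<open>lex later\<close>.\<close>

definition later :: "('a \<times> 'a) set" where
  "later = {(a, b). a \<in> T \<and> b \<in> T \<and> idx b < idx a}"

lemma wf_later: "wf (lex later)"
proof (rule wf_lex, rule wf_subset[OF wf_measure[of "\<lambda>t. Max (idx ` T) - idx t"]])
  show "later \<subseteq> measure (\<lambda>t. Max (idx ` T) - idx t)"
  proof (clarsimp simp: later_def)
    fix a b assume "a \<in> T" "idx b < idx a"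
    moreover have "idx a \<le> Max (idx ` T)" using finite_T \<open>a \<in> T\<close> by simp
    ultimately show "Max (idx ` T) - idx a < Max (idx ` T) - idx b" by simp
  qed
qed

text \<open>The smallest first letter starts an increasing factorization, and there is only one.\<close>

lemma increasing_first:
  assumes "ncw [x, y]" "idx x < idx y" "x' \<in> fac (x \<otimes> y)" "x' \<noteq> x"
  shows "idx x < idx x'"
proof -
  define w where "w = x \<otimes> y"
  have T: "x \<in> T" "y \<in> T" using ncw_T[OF assms(1)] by auto
  then have cl: "x \<in> carrier W" "y \<in> carrier W" "w \<in> carrier W" using T_carrier by (auto simp: w_def)
  have x'T: "x' \<in> T" using assms(3) facD by blast
  obtain rs where rs: "rs \<in> lists T" "lp (x # y # rs) = cx" "length rs + 2 = card S"
    using assms(1) by (auto simp: ncw_def)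
  have "fac w \<noteq> {}" using assms(3) by (auto simp: w_def)
  then obtain z where z: "z \<in> fac w" "\<And>v. v \<in> fac w \<Longrightarrow> idx z \<le> idx v"
    using ex_min_if_finite[OF finite_imageI[OF finite_fac], of idx w] by (metis arg_min_if_finite(1) arg_min_least finite_fac)
  have zT: "z \<in> T" "z \<otimes> w \<in> T" "z \<in> carrier W" using z facD T_carrier by auto
  have zw: "z \<otimes> (z \<otimes> w) = w" using T_cancel zT cl by simp
  have "z \<otimes> w \<noteq> z"
  proof
    assume "z \<otimes> w = z"
    then have "x \<otimes> y = \<one>" using zT cl by (simp add: w_def)
    then have "x = y" using T cl T_inv inv_equality by metis
    then show False using assms(2) by simp
  qed
  then have "idx z < idx (z \<otimes> w)"
    using z(2)[OF fac_step(1)[OF cl(3) z(1)]] idx_inj zT by (metis order_le_less)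
  then have "x = z"
    using increasing_unique[OF T zT(1,2) rs(1) _ rs(2,3) assms(2)] zw by (simp add: w_def)
  then have "idx x \<le> idx x'" using z(2) assms(3) by (simp add: w_def)
  then show ?thesis using idx_inj[OF T(1) x'T] assms(4) by (metis order_le_less)
qed

definition straight :: "('a free_mon \<Rightarrow>\<^sub>0 int) \<Rightarrow> bool" where
  "straight p \<longleftrightarrow> (\<exists>c. p - (\<Sum>b\<in>dec_words. frag_cmul (c b) (word_monom b)) \<in> ID)"

lemma straight_ID: "p \<in> ID \<Longrightarrow> straight p"
  unfolding straight_def by (intro exI[of _ "\<lambda>_. 0"]) simp

lemma straight_diff:
  assumes "straight p" "straight q"
  shows "straight (p - q)"
proof -
  obtain c d where cd: "p - (\<Sum>b\<in>dec_words. frag_cmul (c b) (word_monom b)) \<in> ID"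
    "q - (\<Sum>b\<in>dec_words. frag_cmul (d b) (word_monom b)) \<in> ID"
    using assms unfolding straight_def by blast
  have "(p - q) - (\<Sum>b\<in>dec_words. frag_cmul (c b - d b) (word_monom b)) =
      (p - (\<Sum>b\<in>dec_words. frag_cmul (c b) (word_monom b))) - (q - (\<Sum>b\<in>dec_words. frag_cmul (d b) (word_monom b)))"
    by (simp add: frag_cmul_diff_distrib sum_subtractf)
  also have "\<dots> \<in> ID" using cd by (rule ID_diff)
  finally show ?thesis unfolding straight_def by (intro exI[of _ "\<lambda>b. c b - d b"])
qed

lemma straight_add: "straight p \<Longrightarrow> straight q \<Longrightarrow> straight (p + q)"
  using straight_diff[of p "0 - q"] straight_diff[of 0 q] straight_ID[of 0] by simp

lemma straight_sum: "(\<And>i. i \<in> J \<Longrightarrow> straight (f i)) \<Longrightarrow> straight (sum f J)"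
  by (induction J rule: infinite_finite_induct) (auto intro: straight_add straight_ID)

lemma straight_dec: "xs \<in> dec_words \<Longrightarrow> straight (word_monom xs)"
proof -
  assume "xs \<in> dec_words"
  then have "(\<Sum>b\<in>dec_words. frag_cmul (if b = xs then 1 else 0) (word_monom b)) = word_monom xs"
    using finite_dec_words by (subst sum.remove[of _ xs]) (auto intro: sum.neutral)
  then show ?thesis unfolding straight_def by (intro exI[of _ "\<lambda>b. if b = xs then 1 else 0"]) simp
qed

text \<open>At two neighbours in increasing order the rank two relation trades the word for others
  which, by \<open>increasing_first\<close>, have a later letter at that place.\<close>

lemma straight_word: "xs \<in> lists T \<Longrightarrow> straight (word_monom xs)"
proof (induction xs rule: wf_induct_rule[OF wf_later])
  case (1 xs)
  show ?case
  proof (cases "ncw xs")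
    case False
    then show ?thesis using not_ncw_ID 1 straight_ID by blast
  next
    case n: True
    show ?thesis
    proof (cases "xs \<in> dec_words")
      case True
      then show ?thesis by (rule straight_dec)
    next
      case False
      have "transp (\<lambda>a b. idx b < idx a)" by (rule transpI) simp
      then obtain i where i: "Suc i < length xs" "\<not> idx (xs ! Suc i) < idx (xs ! i)"
        using False n by (auto simp: dec_words_def sorted_wrt_iff_nth_Suc_transp)
      define x y where "x = xs ! i" and "y = xs ! Suc i"
      define a b where "a = take i xs" and "b = drop (Suc (Suc i)) xs"
      have e: "xs = a @ [x, y] @ b"
        using i id_take_nth_drop[of i xs] Cons_nth_drop_Suc[of "Suc i" xs] by (simp add: x_def y_def a_def b_def)
      have T: "a \<in> lists T" "x \<in> T" "y \<in> T" "b \<in> lists T" using 1(2) e by auto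
      have "x \<noteq> y" using n e ncw_no_square by auto
      then have lt: "idx x < idx y" using i(2) idx_inj[OF T(2,3)] unfolding x_def y_def by (meson linorder_neqE_nat)
      have nxy: "ncw [x, y]" using n e ncw_infix by blast
      define w where "w = x \<otimes> y"
      have w2: "w \<in> nc_level W S cx 2"
        using ncw_iff_Rex[of "[x, y]" w 2] nxy T T_carrier by (simp add: w_def)
      have xw: "x \<otimes> w = y" using T_cancel T T_carrier by (simp add: w_def)
      have xf: "x \<in> fac w" using T xw by (simp add: fac_def)
      have other: "straight (word_monom (a @ [x', x' \<otimes> w] @ b))" if "x' \<in> fac w - {x}" for x'
      proof (rule 1(1))
        have x': "x' \<in> T" "x' \<otimes> w \<in> T" using that facD by auto
        then show "a @ [x', x' \<otimes> w] @ b \<in> lists T" using T by auto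
        have "(x', x) \<in> later"
          using increasing_first[OF nxy lt] that x' T by (auto simp: later_def w_def)
        then show "(a @ [x', x' \<otimes> w] @ b, xs) \<in> lex later"
          unfolding e by (auto simp: lex_conv)
      qed
      have "word_monom a * rel2 w * word_monom b \<in> ID"
        using rel2_in_RL[OF w2] RL_ID T by (intro ID_mult_right ID_mult_left) auto
      moreover have "word_monom a * rel2 w * word_monom b
          = word_monom xs + (\<Sum>x'\<in>fac w - {x}. word_monom (a @ [x', x' \<otimes> w] @ b))"
        unfolding rel2_sandwich by (subst sum.remove[OF finite_fac xf]) (simp add: e xw)
      ultimately have eq: "word_monom xs = word_monom a * rel2 w * word_monom b -
          (\<Sum>x'\<in>fac w - {x}. word_monom (a @ [x', x' \<otimes> w] @ b))" "word_monom a * rel2 w * word_monom b \<in> ID"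
        by simp_all
      have "straight (\<Sum>x'\<in>fac w - {x}. word_monom (a @ [x', x' \<otimes> w] @ b))"
        by (rule straight_sum[OF other])
      from straight_diff[OF straight_ID[OF eq(2)] this] show ?thesis by (subst eq(1))
    qed
  qed
qed

lemma straight_all: "p \<in> carrier FA \<Longrightarrow> straight p"
  by (induction rule: free_algebra_induct) (auto intro: straight_ID straight_word straight_diff)

lemma phi_dec_words:
  assumes "t \<in> dec_words" "x \<in> dec_words" "phi t (word_monom x) \<noteq> 0"
  shows "t = x \<or> (x, t) \<in> lex later"
proof -
  have n: "ncw x" "t \<in> lists T" "x \<in> lists T" using assms ncw_T by (auto simp: dec_words_def)
  consider "t = x" | as a s bs cs where "x = as @ a # bs" "t = as @ s # cs" "s \<in> set bs" "length bs = length cs"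
    using phi_leading[OF n(1,2) assms(3)] by blast
  then show ?thesis
  proof cases
    case 2
    then have "idx s < idx a" using assms(2) by (auto simp: dec_words_def sorted_wrt_append)
    then have "(a, s) \<in> later" using 2 n by (auto simp: later_def)
    then show ?thesis using 2 by (auto simp: lex_conv)
  qed simp
qed

lemma dec_words_solve:
  "\<exists>c. \<forall>x\<in>dec_words. (\<Sum>t\<in>dec_words. c t * phi t (word_monom x)) = f x"
  and dec_words_independent:
  "\<lbrakk>\<And>x. x \<in> dec_words \<Longrightarrow> (\<Sum>t\<in>dec_words. c t * phi t (word_monom x)) = 0; t \<in> dec_words\<rbrakk> \<Longrightarrow> c t = 0"
  using unitriangular_solve[OF finite_dec_words wf_later, of "\<lambda>t x. phi t (word_monom x)" f]
    phi_dec_words phi_diagonal dec_words_distinct by (auto simp: dec_words_def)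

subsection \<open>The quotient\<close>

definition cls :: "('a free_mon \<Rightarrow>\<^sub>0 int) \<Rightarrow> ('a free_mon \<Rightarrow>\<^sub>0 int) set" where
  "cls p = ID +>\<^bsub>FA\<^esub> p"

lemma NA_Quot: "NA = FA Quot ID"
  by (simp add: nc_algebra_def Let_def)

lemma ring_NA: "ring NA"
  unfolding NA_Quot by (rule ideal.quotient_is_ring[OF ideal_ID])

lemma cls_hom: "cls \<in> ring_hom FA NA"
  using ideal.rcos_ring_hom[OF ideal_ID] unfolding NA_Quot cls_def[abs_def] .

lemma cls_closed [simp]: "p \<in> carrier FA \<Longrightarrow> cls p \<in> carrier NA"
  using ring_hom_closed[OF cls_hom] .

lemma cls_add: "\<lbrakk>p \<in> carrier FA; q \<in> carrier FA\<rbrakk> \<Longrightarrow> cls (p + q) = cls p \<oplus>\<^bsub>NA\<^esub> cls q"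
  using ring_hom_add[OF cls_hom, of p q] by simp

lemma cls_mult: "\<lbrakk>p \<in> carrier FA; q \<in> carrier FA\<rbrakk> \<Longrightarrow> cls (p * q) = cls p \<otimes>\<^bsub>NA\<^esub> cls q"
  using ring_hom_mult[OF cls_hom, of p q] by simp

lemma cls_one: "cls (word_monom []) = \<one>\<^bsub>NA\<^esub>"
  using ring_hom_one[OF cls_hom] by (simp add: word_monom_Nil)

lemma cls_zero [simp]: "cls 0 = \<zero>\<^bsub>NA\<^esub>"
  using ring_hom_zero[OF cls_hom ring_free_algebra ring_NA] by simp

lemma cls_eq_iff: "\<lbrakk>p \<in> carrier FA; q \<in> carrier FA\<rbrakk> \<Longrightarrow> cls p = cls q \<longleftrightarrow> p - q \<in> ID"
  using ring.quotient_eq_iff_same_a_r_cos[OF ring_free_algebra ideal_ID, of p q]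
  by (simp add: cls_def free_algebra_minus)

lemma cls_ID: "p \<in> ID \<Longrightarrow> cls p = \<zero>\<^bsub>NA\<^esub>"
  using cls_eq_iff[of p 0] ID_carrier by simp

lemma cls_diff: "\<lbrakk>p \<in> carrier FA; q \<in> carrier FA\<rbrakk> \<Longrightarrow> cls (p - q) = cls p \<ominus>\<^bsub>NA\<^esub> cls q"
proof -
  assume p: "p \<in> carrier FA" "q \<in> carrier FA"
  interpret R: ring NA by (rule ring_NA)
  have "cls p = cls (p - q) \<oplus>\<^bsub>NA\<^esub> cls q" using cls_add[OF free_algebra_diff[OF p] p(2)] by simp
  then show ?thesis
    using p by (simp add: a_minus_def R.a_assoc R.r_neg free_algebra_diff)
qed

lemma cls_surj:
  assumes "a \<in> carrier NA"
  obtains p where "p \<in> carrier FA" "a = cls p"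
  using assms unfolding NA_Quot FactRing_def by (auto simp: A_RCOSETS_def' cls_def)

lemma cls_sum:
  assumes "finite J" "\<And>i. i \<in> J \<Longrightarrow> f i \<in> carrier FA"
  shows "cls (sum f J) = (\<Oplus>\<^bsub>NA\<^esub> i \<in> J. cls (f i))"
proof -
  interpret R: ring NA by (rule ring_NA)
  show ?thesis
    using assms
  proof (induction J)
    case (insert i J)
    then have "cls (f i + sum f J) = cls (f i) \<oplus>\<^bsub>NA\<^esub> cls (sum f J)"
      by (intro cls_add free_algebra_sum) auto
    then show ?case using insert by (simp add: R.finsum_insert)
  qed simp
qed

lemma cls_cmul:
  assumes "p \<in> carrier FA"
  shows "[(k :: int)] \<cdot>\<^bsub>NA\<^esub> cls p = cls (frag_cmul k p)"
proof -
  interpret R: ring NA by (rule ring_NA)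
  have nat: "[n] \<cdot>\<^bsub>NA\<^esub> cls p = cls (frag_cmul (int n) p)" for n :: nat
  proof (induction n)
    case (Suc n)
    have "frag_cmul (int (Suc n)) p = frag_cmul (int n) p + p"
      using frag_cmul_distrib[of "int n" 1 p] by (simp add: add.commute)
    then show ?case using Suc assms by (simp add: cls_add free_algebra_cmul)
  qed simp
  show ?thesis
  proof (cases "k \<ge> 0")
    case True
    then show ?thesis using nat[of "nat k"] add_pow_int_ge[of k NA "cls p"] by simp
  next
    case False
    then have "[k] \<cdot>\<^bsub>NA\<^esub> cls p = \<ominus>\<^bsub>NA\<^esub> cls (frag_cmul (- k) p)"
      using nat[of "nat (- k)"] add_pow_int_lt[of k NA "cls p"] by simp
    also have "\<dots> = cls (0 - frag_cmul (- k) p)"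
      using assms by (simp only: cls_diff free_algebra_zero free_algebra_cmul cls_zero)
        (simp add: a_minus_def free_algebra_cmul)
    finally show ?thesis by simp
  qed
qed

lemma NA_induct [consumes 1, case_names zero word diff]:
  assumes "a \<in> carrier NA" "P \<zero>\<^bsub>NA\<^esub>" "\<And>ts. ts \<in> lists T \<Longrightarrow> P (cls (word_monom ts))"
    "\<And>a b. \<lbrakk>a \<in> carrier NA; b \<in> carrier NA; P a; P b\<rbrakk> \<Longrightarrow> P (a \<ominus>\<^bsub>NA\<^esub> b)"
  shows "P a"
proof -
  obtain p where p: "p \<in> carrier FA" "a = cls p" using cls_surj assms by blast
  have "p \<in> carrier FA \<and> P (cls p)"
    using p(1)
  proof (induction rule: free_algebra_induct)
    case (diff p q)
    then show ?case using assms(4)[of "cls p" "cls q"] by (simp add: cls_diff free_algebra_diff)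
  qed (use assms in auto)
  then show ?thesis using p by simp
qed

definition rep :: "('a free_mon \<Rightarrow>\<^sub>0 int) set \<Rightarrow> 'a free_mon \<Rightarrow>\<^sub>0 int" where
  "rep a = (SOME p. p \<in> carrier FA \<and> cls p = a)"

lemma rep: "a \<in> carrier NA \<Longrightarrow> rep a \<in> carrier FA \<and> cls (rep a) = a"
  unfolding rep_def by (rule someI_ex) (metis cls_surj)

lemma rep_cls: "p \<in> carrier FA \<Longrightarrow> rep (cls p) - p \<in> ID"
  using rep[of "cls p"] cls_eq_iff[of "rep (cls p)" p] by simp

lemma nc_gen_cls: "nc_gen W S cx t = cls (word_monom [t])"
  by (simp add: nc_gen_def cls_def Let_def)

lemma nc_monom_cls: "ts \<in> lists T \<Longrightarrow> nc_monom W S cx ts = cls (word_monom ts)"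
proof (induction ts rule: list.induct)
  case Nil
  then show ?case by (simp add: nc_monom_def cls_one)
next
  case (Cons t ts)
  then have "nc_monom W S cx (t # ts) = cls (word_monom [t]) \<otimes>\<^bsub>NA\<^esub> cls (word_monom ts)"
    by (simp add: nc_monom_def nc_gen_cls)
  then show ?case using Cons.prems by (simp add: word_monom_mult flip: cls_mult)
qed

text \<open>The source of uniqueness for both definite descriptions: \<open>nc_delta\<close> and,
  one argument at a time, \<open>nc_form\<close>.\<close>

lemma hom_NA_determined:
  assumes "f \<in> hom (add_monoid NA) G" "g \<in> hom (add_monoid NA) G" "group G"
    "\<And>ts. ts \<in> lists T \<Longrightarrow> f (cls (word_monom ts)) = g (cls (word_monom ts))" "a \<in> carrier NA"
  shows "f a = g a"
proof -
  interpret R: ring NA by (rule ring_NA)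
  interpret f: group_hom "add_monoid NA" G f
    using assms R.add.is_group by (simp add: group_hom_def group_hom_axioms_def)
  interpret g: group_hom "add_monoid NA" G g
    using assms R.add.is_group by (simp add: group_hom_def group_hom_axioms_def)
  show ?thesis
    using assms(5)
  proof (induction rule: NA_induct)
    case zero
    then show ?case using f.hom_one g.hom_one by simp
  next
    case (diff a b)
    have hdiff: "h (a \<ominus>\<^bsub>NA\<^esub> b) = h a \<otimes>\<^bsub>G\<^esub> inv\<^bsub>G\<^esub> (h b)" if "group_hom (add_monoid NA) G h" for h
    proof -
      interpret h: group_hom "add_monoid NA" G h by fact
      show ?thesis using diff(1,2) h.hom_mult[of a "\<ominus>\<^bsub>NA\<^esub> b"] h.hom_inv[of b] R.a_inv_closed[OF diff(2)] by (simp add: a_minus_def a_inv_def)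
    qed
    show ?case using hdiff[OF f.group_hom_axioms] hdiff[OF g.group_hom_axioms] diff by simp
  qed (use assms in auto)
qed

subsection \<open>The operators and the form\<close>

definition delta :: "'a \<Rightarrow> ('a free_mon \<Rightarrow>\<^sub>0 int) set \<Rightarrow> ('a free_mon \<Rightarrow>\<^sub>0 int) set" where
  "delta t = (\<lambda>a\<in>carrier NA. cls (D t (rep a)))"

lemma delta_cls:
  assumes "t \<in> T" "p \<in> carrier FA"
  shows "delta t (cls p) = cls (D t p)"
proof -
  have "D t (rep (cls p) - p) \<in> ID" using rep_cls assms D_ID by blast
  then show ?thesis
    using rep[of "cls p"] assms cls_eq_iff[of "D t (rep (cls p))" "D t p"] D_carrier
    by (simp add: delta_def D_diff)
qed

lemma delta_hom: "t \<in> T \<Longrightarrow> delta t \<in> hom (add_monoid NA) (add_monoid NA)"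
proof (rule homI)
  fix a b assume t: "t \<in> T" and ab: "a \<in> carrier (add_monoid NA)" "b \<in> carrier (add_monoid NA)"
  then obtain p q where pq: "p \<in> carrier FA" "a = cls p" "q \<in> carrier FA" "b = cls q"
    by (metis cls_surj partial_object.select_convs(1))
  then show "delta t (a \<otimes>\<^bsub>add_monoid NA\<^esub> b) = delta t a \<otimes>\<^bsub>add_monoid NA\<^esub> delta t b"
    using t by (simp add: delta_cls D_add D_carrier free_algebra_add flip: cls_add)
next
  fix a assume t: "t \<in> T" and a: "a \<in> carrier (add_monoid NA)"
  then obtain p where "p \<in> carrier FA" "a = cls p" by (metis cls_surj partial_object.select_convs(1))
  then show "delta t a \<in> carrier (add_monoid NA)" using t by (simp add: delta_cls D_carrier)
qed

lemma delta_formula: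
  assumes "t \<in> T" "ncw ts" "length ts = k"
  shows "cls (D t (word_monom ts)) = (\<Oplus>\<^bsub>NA\<^esub> i \<in> {..<k}. if ts ! i = t
    then [((- 1) ^ i :: int)] \<cdot>\<^bsub>NA\<^esub> nc_monom W S cx (map (\<lambda>u. conj_by W u (ts ! i)) (take i ts) @ drop (Suc i) ts)
    else \<zero>\<^bsub>NA\<^esub>)"
proof -
  interpret R: ring NA by (rule ring_NA)
  have tsT: "ts \<in> lists T" using assms ncw_T by blast
  have T: "map (\<lambda>u. conj_by W u t) (take i ts) @ drop (Suc i) ts \<in> lists T" for i
    using map_conj_by_T[of "take i ts" t] assms(1) tsT set_take_subset[of i ts] set_drop_subset[of "Suc i" ts] by auto
  define g where "g i = (if ts ! i = t
    then frag_cmul ((- 1) ^ i) (word_monom (map (\<lambda>u. conj_by W u t) (take i ts) @ drop (Suc i) ts)) else 0)" for i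
  have g: "g i \<in> carrier FA" for i unfolding g_def using T[of i] by (auto intro!: free_algebra_cmul)
  have "D t (word_monom ts) = (\<Sum>i<k. g i)"
    using assms dw_sum[of t ts] by (simp add: D_word g_def)
  then have "cls (D t (word_monom ts)) = (\<Oplus>\<^bsub>NA\<^esub> i \<in> {..<k}. cls (g i))"
    using cls_sum[of "{..<k}" g] g by simp
  also have "\<dots> = (\<Oplus>\<^bsub>NA\<^esub> i \<in> {..<k}. if ts ! i = t
    then [((- 1) ^ i :: int)] \<cdot>\<^bsub>NA\<^esub> nc_monom W S cx (map (\<lambda>u. conj_by W u (ts ! i)) (take i ts) @ drop (Suc i) ts)
    else \<zero>\<^bsub>NA\<^esub>)"
  proof -
    have "cls (g i) = (if ts ! i = t
      then [((- 1) ^ i :: int)] \<cdot>\<^bsub>NA\<^esub> nc_monom W S cx (map (\<lambda>u. conj_by W u (ts ! i)) (take i ts) @ drop (Suc i) ts)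
      else \<zero>\<^bsub>NA\<^esub>)" for i
      using T[of i] nc_monom_cls[OF T[of i]] cls_cmul[of "word_monom (map (\<lambda>u. conj_by W u t) (take i ts) @ drop (Suc i) ts)" "(- 1) ^ i"]
      by (auto simp: g_def)
    then show ?thesis by (simp only:)
  qed
  finally show ?thesis .
qed

lemma is_nc_delta_delta:
  assumes t: "t \<in> T"
  shows "is_nc_delta W S cx t (delta t)"
  unfolding is_nc_delta_def Let_def
proof (intro conjI allI ballI)
  show "delta t \<in> hom (add_monoid NA) (add_monoid NA)" using t by (rule delta_hom)
  show "delta t \<in> extensional (carrier NA)" by (simp add: delta_def)
  fix k w ts assume "w \<in> nc_level W S cx k" "ts \<in> Rex W S w"
  then have ts: "ncw ts" "lp ts = w" "length ts = k" using ncw_iff_Rex by blast+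
  then show "delta t (nc_monom W S cx ts) = (\<Oplus>\<^bsub>NA\<^esub> i \<in> {..<k}. if ts ! i = t
    then [((- 1) ^ i :: int)] \<cdot>\<^bsub>NA\<^esub> nc_monom W S cx (map (\<lambda>u. conj_by W u (ts ! i)) (take i ts) @ drop (Suc i) ts)
    else \<zero>\<^bsub>NA\<^esub>)"
    using delta_formula[OF t ts(1,3)] t ncw_T[OF ts(1)]
    by (simp only: nc_monom_cls delta_cls word_monom_carrier_iff)
qed

text \<open>The description prescribes values only on reduced words. All other monomials vanish by
  \<open>not_ncw_ID\<close>, so additivity determines the operator.\<close>

lemma nc_delta_eq:
  assumes t: "t \<in> T"
  shows "nc_delta W S cx t = delta t"
  unfolding nc_delta_def
proof (rule the_equality)
  show "is_nc_delta W S cx t (delta t)" using is_nc_delta_delta t .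
  fix d assume d: "is_nc_delta W S cx t d"
  interpret R: ring NA by (rule ring_NA)
  have dh: "d \<in> hom (add_monoid NA) (add_monoid NA)" "d \<in> extensional (carrier NA)"
    using d by (simp_all add: is_nc_delta_def Let_def)
  have eq: "d (cls (word_monom ts)) = delta t (cls (word_monom ts))" if "ts \<in> lists T" for ts
  proof (cases "ncw ts")
    case True
    then have *: "lp ts \<in> nc_level W S cx (length ts)" "ts \<in> Rex W S (lp ts)"
      using ncw_iff_Rex[of ts "lp ts" "length ts"] by auto
    have "f (nc_monom W S cx ts) = (\<Oplus>\<^bsub>NA\<^esub> i \<in> {..<length ts}. if ts ! i = t
      then [((- 1) ^ i :: int)] \<cdot>\<^bsub>NA\<^esub> nc_monom W S cx (map (\<lambda>u. conj_by W u (ts ! i)) (take i ts) @ drop (Suc i) ts)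
      else \<zero>\<^bsub>NA\<^esub>)" if "is_nc_delta W S cx t f" for f
      using that * unfolding is_nc_delta_def Let_def by blast
    from this[OF d] this[OF is_nc_delta_delta[OF t]] show ?thesis using nc_monom_cls[OF that] by simp
  next
    case False
    then have z: "cls (word_monom ts) = \<zero>\<^bsub>NA\<^esub>" using cls_ID not_ncw_ID that by blast
    have hz: "f \<zero>\<^bsub>NA\<^esub> = \<zero>\<^bsub>NA\<^esub>" if "f \<in> hom (add_monoid NA) (add_monoid NA)" for f
      using hom_one[OF that] R.add.is_group by simp
    then show ?thesis using z hz[OF dh(1)] hz[OF delta_hom[OF t]] by simp
  qed
  show "d = delta t"
  proof (rule extensionalityI[OF dh(2)])
    show "delta t \<in> extensional (carrier NA)" by (simp add: delta_def)
    show "d a = delta t a" if "a \<in> carrier NA" for a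
      using hom_NA_determined[OF dh(1) delta_hom[OF t] R.add.is_group eq that] .
  qed
qed

lemma fold_nc_delta_cls:
  "ts \<in> lists T \<Longrightarrow> p \<in> carrier FA \<Longrightarrow> fold (nc_delta W S cx) ts (cls p) = cls (fold D ts p)"
  by (induction ts arbitrary: p rule: list.induct) (auto simp: nc_delta_eq delta_cls D_carrier)

definition form :: "('a free_mon \<Rightarrow>\<^sub>0 int) set \<Rightarrow> ('a free_mon \<Rightarrow>\<^sub>0 int) set \<Rightarrow> int" where
  "form a b = (if a \<in> carrier NA \<and> b \<in> carrier NA then form0 (rep a) (rep b) else 0)"

lemma form_cls:
  assumes "p \<in> carrier FA" "q \<in> carrier FA"
  shows "form (cls p) (cls q) = form0 p q"
proof -
  have r: "rep (cls p) \<in> carrier FA" "rep (cls q) \<in> carrier FA" using rep assms by auto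
  have "form0 (rep (cls p)) (rep (cls q)) = form0 p (rep (cls q))"
    using form0_ID_left[OF rep_cls[OF assms(1)] r(2)] by (simp add: form0_diff_left)
  also have "\<dots> = form0 p q"
    using form0_ID_right[OF assms(1) rep_cls[OF assms(2)]] by (simp add: form0_diff_right)
  finally show ?thesis using assms by (simp add: form_def)
qed

lemma form_bilinear: "int_bilinear NA form"
  unfolding int_bilinear_def
proof (intro ballI)
  fix a b c assume "a \<in> carrier NA" "b \<in> carrier NA" "c \<in> carrier NA"
  then obtain p q r where *: "p \<in> carrier FA" "a = cls p" "q \<in> carrier FA" "b = cls q" "r \<in> carrier FA" "c = cls r"
    by (metis cls_surj)
  then show "form (a \<oplus>\<^bsub>NA\<^esub> b) c = form a c + form b c \<and> form a (b \<oplus>\<^bsub>NA\<^esub> c) = form a b + form a c"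
    by (simp add: form_cls free_algebra_add form0_add_left form0_add_right flip: cls_add)
qed

definition homog :: "nat \<Rightarrow> ('a free_mon \<Rightarrow>\<^sub>0 int) \<Rightarrow> bool" where
  "homog k p \<longleftrightarrow> (\<forall>u\<in>Poly_Mapping.keys p. letters u \<in> lists T \<and> length (letters u) = k)"

lemma homog_carrier: "homog k p \<Longrightarrow> p \<in> carrier FA"
  by (auto simp: homog_def free_algebra_carrier_iff)

lemma homog_induct [consumes 1, case_names zero word diff]:
  assumes "homog k p" "P 0" "\<And>xs. xs \<in> lists T \<Longrightarrow> length xs = k \<Longrightarrow> P (word_monom xs)"
    "\<And>p q. P p \<Longrightarrow> P q \<Longrightarrow> P (p - q)"
  shows "P p"
proof (rule frag_induction[where S = "{u. letters u \<in> lists T \<and> length (letters u) = k}" and P = P])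
  show "P (frag_of u)" if "u \<in> {u. letters u \<in> lists T \<and> length (letters u) = k}" for u
    using assms(3)[of "letters u"] that by (simp add: word_monom_frag)
qed (use assms in \<open>auto simp: homog_def\<close>)

lemma homog_add: "homog k p \<Longrightarrow> homog k q \<Longrightarrow> homog k (p + q)"
  unfolding homog_def using Poly_Mapping.keys_add[of p q] by blast

lemma homog_uminus: "homog k p \<Longrightarrow> homog k (- p)"
  by (simp add: homog_def in_keys_iff)

lemma homog_word: "xs \<in> lists T \<Longrightarrow> homog (length xs) (word_monom xs)"
  by (simp add: homog_def word_monom_def)

lemma phi_homog_neq: "homog k p \<Longrightarrow> ts \<in> lists T \<Longrightarrow> length ts \<noteq> k \<Longrightarrow> phi ts p = 0"
proof (induction rule: homog_induct)
  case (word xs)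
  then show ?case using phi_isotypic[OF isotypic_word] lp_T_closed by blast
qed (simp_all add: phi_diff)

lemma fold_D_isotypic:
  "isotypic w k p \<Longrightarrow> ts \<in> lists T \<Longrightarrow> \<exists>w'. isotypic w' (k - length ts) (fold D ts p)"
proof (induction ts arbitrary: w k p rule: list.induct)
  case (Cons t ts)
  then show ?case using isotypic_D(1)[of w k p t] Cons.IH[of "t \<otimes> w" "k - 1" "D t p"] by simp
qed auto

lemma fold_D_homog: "homog k p \<Longrightarrow> ts \<in> lists T \<Longrightarrow> length ts = k \<Longrightarrow> fold D ts p = frag_cmul (phi ts p) (word_monom [])"
proof (induction rule: homog_induct)
  case (word xs)
  obtain w where w: "isotypic w 0 (fold D ts (word_monom xs))"
    using fold_D_isotypic[OF isotypic_word[OF word(1)] word(3)] word by auto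
  show ?case
  proof (rule poly_mapping_eqI)
    fix u :: "'a free_mon"
    have "Poly_Mapping.lookup (fold D ts (word_monom xs)) u = 0" if "letters u \<noteq> []"
      using w that by (auto simp: isotypic_def in_keys_iff)
    then show "Poly_Mapping.lookup (fold D ts (word_monom xs)) u = Poly_Mapping.lookup (frag_cmul (phi ts (word_monom xs)) (word_monom [])) u"
      by (cases u) (auto simp: phi_def lookup_word_monom)
  qed
qed (simp_all add: fold_D_diff phi_diff frag_cmul_diff_distrib)

lemma nc_graded_cls:
  assumes "a \<in> nc_graded W S cx k"
  obtains p where "homog k p" "a = cls p"
proof -
  interpret R: ring NA by (rule ring_NA)
  have "\<exists>p. homog k p \<and> a = cls p"
    using assms unfolding nc_graded_def
  proof (induction rule: generate.induct)
    case one
    show ?case by (intro exI[of _ 0]) (simp add: homog_def)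
  next
    case (incl h)
    then show ?case using homog_word nc_monom_cls by auto
  next
    case (inv h)
    then obtain ts where ts: "ts \<in> lists T" "length ts = k" "h = cls (word_monom ts)" using nc_monom_cls by auto
    have "cls (0 - word_monom ts) = \<ominus>\<^bsub>NA\<^esub> h"
      using ts by (simp only: cls_diff free_algebra_zero word_monom_carrier_iff cls_zero) (simp add: a_minus_def)
    then have "inv\<^bsub>add_monoid NA\<^esub> h = cls (0 - word_monom ts)" by (simp only: a_inv_def)
    then show ?case using homog_uminus[OF homog_word[OF ts(1)]] ts(2) by (intro exI[of _ "- word_monom ts"]) simp
  next
    case (eng a b)
    then obtain p q where "homog k p" "a = cls p" "homog k q" "b = cls q" by blast
    then show ?case using homog_add[of k p q] cls_add[of p q] homog_carrier by (intro exI[of _ "p + q"]) simp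
  qed
  then show ?thesis using that by blast
qed

lemma nc_monom_graded: "ts \<in> lists T \<Longrightarrow> cls (word_monom ts) \<in> nc_graded W S cx (length ts)"
  unfolding nc_graded_def using nc_monom_cls[of ts] by (intro generate.incl) auto

lemma form_homog_neq:
  assumes "homog k p" "homog l q" "k \<noteq> l"
  shows "form0 p q = 0"
  using assms(1)
proof (induction rule: homog_induct)
  case (word xs)
  then show ?case using phi_homog_neq[OF assms(2)] assms(3) by (simp add: form0_word)
qed (simp_all add: form0_diff_left)

lemma is_nc_form_form: "is_nc_form W S cx form"
  unfolding is_nc_form_def Let_def
proof (intro conjI allI ballI impI)
  show "int_bilinear NA form" by (rule form_bilinear)
  show "form \<one>\<^bsub>NA\<^esub> \<one>\<^bsub>NA\<^esub> = 1"
    using form_cls[of "word_monom []" "word_monom []"] phi_diagonal[of "[]"]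
    by (simp add: cls_one form0_word)
  show "form x y = 0" if "x \<notin> carrier NA \<or> y \<notin> carrier NA" for x y using that by (auto simp: form_def)
  show "form x y = 0" if kl: "k \<noteq> l" "x \<in> nc_graded W S cx k" "y \<in> nc_graded W S cx l" for k l x y
  proof -
    obtain p where p: "homog k p" "x = cls p" using nc_graded_cls[OF kl(2)] by blast
    obtain q where "homog l q" "y = cls q" using nc_graded_cls[OF kl(3)] by blast
    with p show ?thesis using form_homog_neq kl(1) form_cls homog_carrier by simp
  qed
  show "[form (nc_monom W S cx ts) x] \<cdot>\<^bsub>NA\<^esub> \<one>\<^bsub>NA\<^esub> = fold (nc_delta W S cx) ts x"
    if ts: "ts \<in> lists T" "length ts = k" and x: "x \<in> nc_graded W S cx k" for k ts x
  proof -
    obtain p where p: "homog k p" "x = cls p" using x nc_graded_cls by blast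
    have "fold (nc_delta W S cx) ts x = cls (frag_cmul (phi ts p) (word_monom []))"
      using p fold_nc_delta_cls[OF ts(1)] fold_D_homog[OF p(1) ts] homog_carrier by simp
    also have "\<dots> = [phi ts p] \<cdot>\<^bsub>NA\<^esub> \<one>\<^bsub>NA\<^esub>"
      using cls_cmul[of "word_monom []" "phi ts p"] by (simp add: cls_one)
    also have "phi ts p = form (nc_monom W S cx ts) x"
      using p ts nc_monom_cls form_cls homog_carrier by (simp add: form0_word)
    finally show ?thesis ..
  qed
qed

text \<open>The clause for the form fixes only multiples of the unit of the algebra; the constant
  coefficient recovers the integer.\<close>

lemma one_torsion_free:
  assumes "[(j :: int)] \<cdot>\<^bsub>NA\<^esub> \<one>\<^bsub>NA\<^esub> = [n] \<cdot>\<^bsub>NA\<^esub> \<one>\<^bsub>NA\<^esub>"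
  shows "j = n"
proof -
  have "cls (frag_cmul j (word_monom [])) = cls (frag_cmul n (word_monom []))"
    using assms cls_cmul[of "word_monom []"] by (simp add: cls_one)
  then have "frag_cmul j (word_monom []) - frag_cmul n (word_monom []) \<in> ID"
    by (subst (asm) cls_eq_iff) (auto intro: free_algebra_cmul)
  from lookup_ID_Nil[OF this] show ?thesis by (simp add: lookup_minus lookup_word_monom)
qed

lemma int_bilinear_homs:
  assumes "int_bilinear NA B" "a \<in> carrier NA"
  shows "(\<lambda>b. B a b) \<in> hom (add_monoid NA) integer_group" "(\<lambda>b. B b a) \<in> hom (add_monoid NA) integer_group"
  using assms by (auto simp: int_bilinear_def hom_def)

text \<open>On two monomials of equal length the value is forced by the operators, on different
  lengths by orthogonality of degrees.\<close>

lemma nc_form_eq: "nc_form W S cx = form"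
  unfolding nc_form_def
proof (rule the_equality)
  show "is_nc_form W S cx form" by (rule is_nc_form_form)
  fix B assume B: "is_nc_form W S cx B"
  have bil: "int_bilinear NA B" using B by (simp add: is_nc_form_def Let_def)
  have words: "B (cls (word_monom ts)) (cls (word_monom us)) = form (cls (word_monom ts)) (cls (word_monom us))"
    if "ts \<in> lists T" "us \<in> lists T" for ts us
  proof (cases "length ts = length us")
    case True
    have "[F (cls (word_monom ts)) (cls (word_monom us))] \<cdot>\<^bsub>NA\<^esub> \<one>\<^bsub>NA\<^esub> = fold (nc_delta W S cx) ts (cls (word_monom us))"
      if "is_nc_form W S cx F" for F
      using that True nc_monom_graded[OF \<open>us \<in> lists T\<close>] \<open>ts \<in> lists T\<close> nc_monom_cls[OF \<open>ts \<in> lists T\<close>]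
      unfolding is_nc_form_def Let_def by metis
    then show ?thesis using B is_nc_form_form one_torsion_free by metis
  next
    case False
    have "F (cls (word_monom ts)) (cls (word_monom us)) = 0" if "is_nc_form W S cx F" for F
      using that False nc_monom_graded[OF \<open>us \<in> lists T\<close>] nc_monom_graded[OF \<open>ts \<in> lists T\<close>]
      unfolding is_nc_form_def Let_def by blast
    then show ?thesis using B is_nc_form_form by metis
  qed
  show "B = form"
  proof (intro ext)
    fix a b
    show "B a b = form a b"
    proof (cases "a \<in> carrier NA \<and> b \<in> carrier NA")
      case True
      have half: "B a (cls (word_monom us)) = form a (cls (word_monom us))" if "us \<in> lists T" for us
        using hom_NA_determined[OF int_bilinear_homs(2)[OF bil] int_bilinear_homs(2)[OF form_bilinear] group_integer_group]
          words that True by simp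
      show ?thesis
        using hom_NA_determined[OF int_bilinear_homs(1)[OF bil] int_bilinear_homs(1)[OF form_bilinear] group_integer_group]
          half True by simp
    next
      case False
      then show ?thesis using B by (auto simp: is_nc_form_def Let_def form_def)
    qed
  qed
qed

subsection \<open>Unimodularity\<close>

definition combo :: "('a list \<Rightarrow> int) \<Rightarrow> 'a free_mon \<Rightarrow>\<^sub>0 int" where
  "combo c = (\<Sum>b\<in>dec_words. frag_cmul (c b) (word_monom b))"

lemma combo_carrier [simp]: "combo c \<in> carrier FA"
  unfolding combo_def using ncw_T by (auto simp: dec_words_def intro!: free_algebra_sum free_algebra_cmul)

lemma NA_combo:
  assumes "a \<in> carrier NA"
  obtains c where "a = cls (combo c)"
proof -
  obtain p where p: "p \<in> carrier FA" "a = cls p" using cls_surj assms by blast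
  obtain c where "p - combo c \<in> ID" using straight_all[OF p(1)] by (auto simp: straight_def combo_def)
  then show ?thesis using that[of c] p cls_eq_iff by simp
qed

lemma form0_cmul_left: "form0 (frag_cmul k p) q = k * form0 p q"
  by (simp add: form0_lookup frag_extend_cmul)

lemma form0_combo: "form0 (combo c) q = (\<Sum>b\<in>dec_words. c b * phi b q)"
  by (simp add: combo_def form0_sum_left form0_cmul_left form0_word)

lemma hom_combo:
  assumes "f \<in> hom (add_monoid NA) integer_group"
  shows "f (cls (combo c)) = (\<Sum>b\<in>dec_words. c b * f (cls (word_monom b)))"
proof -
  interpret R: ring NA by (rule ring_NA)
  interpret f: group_hom "add_monoid NA" integer_group f
    using assms R.add.is_group by (simp add: group_hom_def group_hom_axioms_def)
  have f_add: "f (cls (p + q)) = f (cls p) + f (cls q)" if "p \<in> carrier FA" "q \<in> carrier FA" for p q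
    using that f.hom_mult[of "cls p" "cls q"] by (simp add: cls_add)
  have f0: "f \<zero>\<^bsub>NA\<^esub> = 0" using f.hom_one by simp
  have f_diff: "f (cls (p - q)) = f (cls p) - f (cls q)" if "p \<in> carrier FA" "q \<in> carrier FA" for p q
    using f_add[of "p - q" q] that free_algebra_diff[OF that] by simp
  have f_cmul: "f (cls (frag_cmul k p)) = k * f (cls p)" if p: "p \<in> carrier FA" for k p
  proof -
    have nat: "f (cls (frag_cmul (int n) p)) = int n * f (cls p)" for n
    proof (induction n)
      case (Suc n)
      have "frag_cmul (int (Suc n)) p = frag_cmul (int n) p + p"
        using frag_cmul_distrib[of "int n" 1 p] by (simp add: add.commute)
      then show ?case using Suc p by (simp add: f_add free_algebra_cmul algebra_simps)
    qed (simp add: f0)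
    show ?thesis
    proof (cases "k \<ge> 0")
      case True
      then show ?thesis using nat[of "nat k"] by simp
    next
      case False
      have "frag_cmul k p = 0 - frag_cmul (int (nat (- k))) p" using False by simp
      then have "f (cls (frag_cmul k p)) = f (cls 0) - f (cls (frag_cmul (int (nat (- k))) p))"
        using f_diff[OF free_algebra_zero free_algebra_cmul[OF p]] by simp
      then show ?thesis using nat[of "nat (- k)"] False f0 by simp
    qed
  qed
  have "f (cls (\<Sum>b\<in>J. frag_cmul (c b) (word_monom b))) = (\<Sum>b\<in>J. c b * f (cls (word_monom b)))"
    if "finite J" "J \<subseteq> dec_words" for J
    using that
  proof (induction J)
    case (insert b J)
    have "word_monom b \<in> carrier FA" if "b \<in> dec_words" for b using that ncw_T by (auto simp: dec_words_def)
    then have "frag_cmul (c b) (word_monom b) \<in> carrier FA" "(\<Sum>b\<in>J. frag_cmul (c b) (word_monom b)) \<in> carrier FA"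
      "word_monom b \<in> carrier FA"
      using insert.prems by (auto intro!: free_algebra_sum free_algebra_cmul)
    then show ?case using insert by (simp add: f_add f_cmul)
  qed (simp add: f0)
  from this[OF finite_dec_words order_refl] show ?thesis by (simp add: combo_def)
qed

text \<open>Straightening writes every element in decreasing monomials, so functionals are compared
  there. Independence of the rows of the Gram matrix gives injectivity, and its integral solvability
  gives surjectivity.\<close>

theorem unimodular_form: "unimodular NA (nc_form W S cx)"
  unfolding unimodular_def nc_form_eq
proof (intro conjI)
  show "int_bilinear NA form" by (rule form_bilinear)
  let ?F = "\<lambda>a. \<lambda>b\<in>carrier NA. form a b"
  have dc: "cls (word_monom b) \<in> carrier NA" "word_monom b \<in> carrier FA" if "b \<in> dec_words" for b
    using that ncw_T by (auto simp: dec_words_def)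
  have closed: "?F a \<in> carrier (int_dual NA)" if "a \<in> carrier NA" for a
  proof -
    interpret R: ring NA by (rule ring_NA)
    show ?thesis using that form_bilinear by (auto simp: int_dual_def hom_def int_bilinear_def)
  qed
  show "?F \<in> iso (add_monoid NA) (int_dual NA)"
    unfolding iso_def bij_betw_def
  proof (intro CollectI conjI)
    show "?F \<in> hom (add_monoid NA) (int_dual NA)"
      using closed form_bilinear by (intro homI) (auto simp: int_dual_def int_bilinear_def fun_eq_iff restrict_def)
    show "inj_on ?F (carrier (add_monoid NA))"
    proof (rule inj_onI)
      fix a a' assume "a \<in> carrier (add_monoid NA)" "a' \<in> carrier (add_monoid NA)" and eq: "?F a = ?F a'"
      then obtain c c' where c: "a = cls (combo c)" "a' = cls (combo c')"
        using NA_combo by (metis partial_object.select_convs(1))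
      have "(\<Sum>b\<in>dec_words. (c b - c' b) * phi b (word_monom x)) = 0" if "x \<in> dec_words" for x
      proof -
        have "form a (cls (word_monom x)) = form a' (cls (word_monom x))"
          using fun_cong[OF eq, of "cls (word_monom x)"] dc[OF that] by simp
        then show ?thesis
          using c dc(2)[OF that] by (simp add: form_cls form0_combo left_diff_distrib sum_subtractf)
      qed
      then have "c b - c' b = 0" if "b \<in> dec_words" for b
        using dec_words_independent[of "\<lambda>b. c b - c' b" b] that by blast
      then have "combo c = combo c'" unfolding combo_def by (intro sum.cong) auto
      then show "a = a'" using c by simp
    qed
    show "?F ` carrier (add_monoid NA) = carrier (int_dual NA)"
    proof (intro equalityI subsetI)
      fix f assume "f \<in> ?F ` carrier (add_monoid NA)"
      then show "f \<in> carrier (int_dual NA)" using closed by auto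
    next
      fix f assume f: "f \<in> carrier (int_dual NA)"
      then have fh: "f \<in> hom (add_monoid NA) integer_group" and fe: "f \<in> extensional (carrier NA)"
        by (auto simp: int_dual_def)
      obtain c where c: "\<And>x. x \<in> dec_words \<Longrightarrow> (\<Sum>t\<in>dec_words. c t * phi t (word_monom x)) = f (cls (word_monom x))"
        using dec_words_solve[of "\<lambda>x. f (cls (word_monom x))"] by blast
      let ?a = "cls (combo c)"
      have a: "?a \<in> carrier NA" by simp
      have w: "form ?a (cls (word_monom x)) = f (cls (word_monom x))" if "x \<in> dec_words" for x
        using c[OF that] dc(2)[OF that] by (simp add: form_cls form0_combo)
      have "?F ?a = f"
      proof (rule extensionalityI[OF _ fe])
        show "?F ?a b = f b" if b: "b \<in> carrier NA" for b
        proof -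
          obtain d where d: "b = cls (combo d)" using NA_combo b by blast
          have "form ?a b = f b"
            unfolding d hom_combo[OF fh] hom_combo[OF int_bilinear_homs(1)[OF form_bilinear a]]
            by (intro sum.cong) (simp_all add: w)
          then show ?thesis using b by simp
        qed
      qed simp
      then show "f \<in> ?F ` carrier (add_monoid NA)" using a by (intro image_eqI[of f ?F ?a]) simp_all
    qed
  qed
qed

end

theorem proposition4p5:
  fixes W :: "('a, 'm) monoid_scheme" and S :: "'a set" and \<gamma> :: 'a
  assumes "coxeter_system W S" and "finite (carrier W)"
    and "bipartite_coxeter_element W S \<gamma>"
  shows "unimodular (nc_algebra W S \<gamma>) (nc_form W S \<gamma>)"
proof -
  obtain m where m: "coxeter_matrix S m"
    "\<And>u v. u \<in> lists S \<Longrightarrow> v \<in> lists S \<Longrightarrow> list_prod W u = list_prod W v \<longleftrightarrow> equivclp (coxeter_step S m) u v"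
    and W: "group W" "S \<subseteq> carrier W" "generate W S = carrier W"
    using assms(1) unfolding coxeter_system_def by blast
  obtain ss1 ss2 where ss: "distinct ss1" "distinct ss2" "set ss1 \<union> set ss2 = S" "set ss1 \<inter> set ss2 = {}"
    "\<gamma> = list_prod W ss1 \<otimes>\<^bsub>W\<^esub> list_prod W ss2"
    using assms(3) unfolding bipartite_coxeter_element_def by blast
  interpret coxeter_element W S m "ss1 @ ss2"
    by (intro coxeter_element.intro coxeter.intro coxeter_axioms.intro coxeter_element_axioms.intro)
      (use W m ss assms(2) in auto)
  have "\<gamma> = list_prod W (ss1 @ ss2)"
    using ss(3,5) lp_S_append[of ss1 ss2] by (metis append_in_lists_conv in_listsI set_append)
  then show ?thesis using unimodular_form by simp
qed

end
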